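(* Let $(X_i,\varepsilon_i)$, $i\in\mathbb{N}$, be i.i.d. and $Y_i=m(X_i)+\varepsilon_i$, where the distribution of $X_i$ has support $[0,1]$, cdf $F_X$ and a density $f_X$ that is positive on $[0,1]$, and $E[\varepsilon_i\mid X_i]=0$, $\mathrm{Var}(\varepsilon_i)=\sigma^2\in(0,\infty)$. Let $\vartheta_0\in[0,1)$ and $\Delta\in(0,1-\vartheta_0]$, and let $m:[0,1]\to\mathbb{R}$ be continuous with $m\equiv 0$ on $[0,\vartheta_0]$, $m>0$ on $(\vartheta_0,\vartheta_0+\Delta)$ and $m\ge 0$ on $[\vartheta_0+\Delta,1]$. For $\vartheta\in[0,1]$ set $$M(\vartheta)=\int_{\vartheta_0}^{\vartheta}m(x)\,dF_X(x)\,I\{\vartheta>\vartheta_0\},\qquad M_n(\vartheta)=\frac1n\sum_{i=1}^n Y_i I\{X_i\le\vartheta\}.$$ Then the process $\{\sqrt n\,(M_n(\vartheta)-M(\vartheta))\mid\vartheta\in[0,1]\}$ converges weakly to a centered Gaussian process. Consequently, if $(c_n)$ is a positive sequence with $c_n\to0$ and $t_n=n^{-1/2}/c_n$, then $$\mathbb{P}\Big(\sup_{\vartheta\in[0,1]}|M_n(\vartheta)-M(\vartheta)|>t_n\Big)\to0 ,$$ and, if also $t_n\to 0$, the estimator $\hat\vartheta_n=\int_0^1 I\{M_n(\vartheta)\le t_n\}\,d\vartheta$ is consistent for $\vartheta_0$, i.e. $\hat\vartheta_n\to\vartheta_0$ in probability.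
   Context: $I\{\cdot\}$ denotes the indicator function. Weak convergence of the process is in the space $\ell^\infty([0,1])$ of bounded functions with the supremum norm (in the sense of Hoffmann-J\o rgensen, as usual in empirical process theory). *)

theory Defs
  imports "HOL-Probability.Probability"
begin

definition topological_support :: "real measure \<Rightarrow> real set" where
  "topological_support \<mu> = {x. \<forall>U. open U \<longrightarrow> x \<in> U \<longrightarrow> 0 < emeasure \<mu> U}"

text \<open>The library's \<^term>\<open>funspace\<close> is the metric space of bounded functions on a set
  (extensional outside it) with the supremum metric.\<close>

definition linf :: "'i set \<Rightarrow> ('i \<Rightarrow> real) metric" where
  "linf T = funspace T euclidean_metric"

definition borel_metric :: "'b metric \<Rightarrow> 'b measure" where
  "borel_metric D = sigma (mspace D) {U. openin (mtopology_of D) U}"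

text \<open>Outer expectation of a bounded, possibly non-measurable function. Boundedness makes
  the set of integrable majorants nonempty and their integrals bounded below, and allowing
  extended-real majorants would not change the infimum.\<close>

definition outer_expectation :: "'a measure \<Rightarrow> ('a \<Rightarrow> real) \<Rightarrow> real" where
  "outer_expectation M T =
     Inf {(\<integral>\<omega>. U \<omega> \<partial>M) | U. integrable M U \<and> (\<forall>\<omega>\<in>space M. T \<omega> \<le> U \<omega>)}"

text \<open>Weak convergence in the sense of Hoffmann-Joergensen: the maps \<^term>\<open>Z n\<close> need not be measurable; the limit is given by its law, a Borel
  probability measure on the metric space.\<close>

definition hj_weak_conv ::
    "'b metric \<Rightarrow> 'a measure \<Rightarrow> (nat \<Rightarrow> 'a \<Rightarrow> 'b) \<Rightarrow> 'b measure \<Rightarrow> bool" where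
  "hj_weak_conv D M Z L \<longleftrightarrow>
     (\<forall>n. Z n \<in> space M \<rightarrow> mspace D) \<and>
     prob_space L \<and> space L = mspace D \<and> sets L = sets (borel_metric D) \<and>
     (\<forall>h. continuous_map (mtopology_of D) euclideanreal h \<and> bounded (h ` mspace D) \<longrightarrow>
        (\<lambda>n. outer_expectation M (\<lambda>\<omega>. h (Z n \<omega>))) \<longlonglongrightarrow> (\<integral>z. h z \<partial>L))"

definition tight_law :: "'b metric \<Rightarrow> 'b measure \<Rightarrow> bool" where
  "tight_law D L \<longleftrightarrow>
     (\<forall>e>0. \<exists>K. compactin (mtopology_of D) K \<and> K \<in> sets L \<and> measure L (space L - K) < e)"

text \<open>For \<^term>\<open>s = 0\<close> this is the point mass at the mean.\<close>

definition normal_law :: "real \<Rightarrow> real \<Rightarrow> real measure" where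
  "normal_law \<mu> s = distr std_normal_distribution borel (\<lambda>x. \<mu> + s * x)"

text \<open>\<^term>\<open>L\<close> is the law of a process indexed by \<^term>\<open>T\<close>, viewed on its path space. The
  finite-dimensional distributions are multivariate normal, i.e. every linear combination of
  finitely many coordinates is (possibly degenerate) normal.\<close>

definition gaussian_process :: "'i set \<Rightarrow> ('i \<Rightarrow> real) measure \<Rightarrow> bool" where
  "gaussian_process T L \<longleftrightarrow>
     prob_space L \<and> (\<forall>t\<in>T. (\<lambda>z. z t) \<in> borel_measurable L) \<and>
     (\<forall>F a. finite F \<and> F \<subseteq> T \<longrightarrow>
        (\<exists>\<mu> s. distr L borel (\<lambda>z. \<Sum>t\<in>F. a t * z t) = normal_law \<mu> s))"

definition centered_gaussian_process :: "'i set \<Rightarrow> ('i \<Rightarrow> real) measure \<Rightarrow> bool" where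
  "centered_gaussian_process T L \<longleftrightarrow>
     gaussian_process T L \<and> (\<forall>t\<in>T. (\<integral>z. z t \<partial>L) = 0)"

definition conv_in_prob :: "'a measure \<Rightarrow> (nat \<Rightarrow> 'a \<Rightarrow> real) \<Rightarrow> real \<Rightarrow> bool" where
  "conv_in_prob M Z z \<longleftrightarrow>
     (\<forall>e>0. (\<lambda>n. measure M {\<omega> \<in> space M. \<bar>Z n \<omega> - z\<bar> > e}) \<longlonglongrightarrow> 0)"

definition M_true :: "(real \<Rightarrow> real) \<Rightarrow> (real \<Rightarrow> real) \<Rightarrow> real \<Rightarrow> real \<Rightarrow> real" where
  "M_true F m \<theta>0 \<theta> =
     (LINT x:{\<theta>0..\<theta>}|interval_measure F. m x) * of_bool (\<theta> > \<theta>0)"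

text \<open>The sample is indexed from 0, so the first \<^term>\<open>n\<close> observations are those with
  index below \<^term>\<open>n\<close>.\<close>

definition M_emp ::
    "(nat \<Rightarrow> 'a \<Rightarrow> real) \<Rightarrow> (nat \<Rightarrow> 'a \<Rightarrow> real) \<Rightarrow> nat \<Rightarrow> 'a \<Rightarrow> real \<Rightarrow> real" where
  "M_emp X Y n \<omega> \<theta> = 1 / real n * (\<Sum>i<n. Y i \<omega> * of_bool (X i \<omega> \<le> \<theta>))"

definition theta_hat ::
    "(nat \<Rightarrow> 'a \<Rightarrow> real) \<Rightarrow> (nat \<Rightarrow> 'a \<Rightarrow> real) \<Rightarrow> (nat \<Rightarrow> real) \<Rightarrow> nat \<Rightarrow> 'a \<Rightarrow> real" where
  "theta_hat X Y t n \<omega> = (LINT \<theta>:{0..1}|lborel. of_bool (M_emp X Y n \<omega> \<theta> \<le> t n))"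

end

theory Submission
  imports Defs
begin

text \<open>
  After centring, \<open>sqrt n * (M_n - M)\<close> is the empirical process of the i.i.d. pairs \<open>(X, Y)\<close> indexed
  by \<open>(x, y) \<mapsto> y * of_bool (x \<le> t)\<close>, because \<open>E[Y; X \<le> t] = M t\<close>. Only second moments of \<open>Y\<close> are
  available, so oscillations are controlled by symmetrisation: a ghost sample made of the observations
  \<open>n, \<dots>, 2n - 1\<close> introduces random signs, and in the order of the \<open>X\<close>-values the signed process is a
  random walk, to which Levy's reflection principle applies. A fourth moment bound for the signed
  endpoint then gives an oscillation probability over a cell of order the square of its \<open>Y\<^sup>2\<close>-mass, and
  these squares have a small sum over a fine partition.

  On a countable dense grid, convergence of linear combinations (the one-dimensional central limit
  theorem) gives weak convergence in \<open>\<real>\<^sup>\<nat>\<close> by Stone--Weierstrass for trigonometric polynomials; the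
  Gaussian limit there is a triangular transform of independent standard normals. The oscillation
  bound passes to the limit, whose step interpolations therefore converge uniformly almost surely, and
  the sup-norm limit carries the limit law. For the outer expectations it suffices to treat Lipschitz
  functions, since a bounded continuous function lies between Lipschitz ones with almost the same
  integral under the limit law.

  The supremum of the process is bounded in probability, which gives the remaining two claims: on
  \<open>sup |M_n - M| \<le> t_n\<close> the level set of \<open>M_n\<close> contains \<open>[0, \<theta>\<^sub>0]\<close> and, as soon as
  \<open>2 t_n < M (\<theta>\<^sub>0 + e)\<close>, is contained in \<open>[0, \<theta>\<^sub>0 + e]\<close>.
\<close>

section \<open>Weak convergence of random sequences\<close>

inductive_set trig_polys :: "((nat \<Rightarrow> real) \<Rightarrow> real) set" where
  cos: "(\<lambda>x. c * cos ((\<Sum>i<N. a i * x i) + b)) \<in> trig_polys"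
| add: "f \<in> trig_polys \<Longrightarrow> g \<in> trig_polys \<Longrightarrow> (\<lambda>x. f x + g x) \<in> trig_polys"

lemma linear_form_pad:
  fixes a x :: "nat \<Rightarrow> real"
  assumes "N \<le> N'"
  shows "(\<Sum>i<N. a i * x i) = (\<Sum>i<N'. (if i < N then a i else 0) * x i)"
  using assms by (intro sum.mono_neutral_cong_left) auto

lemma trig_polys_mult_cos:
  assumes "f \<in> trig_polys"
  shows "(\<lambda>x. f x * (c * cos ((\<Sum>i<N. a i * x i) + b))) \<in> trig_polys"
  using assms
proof induction
  case (cos c' a' N' b')
  define K where "K = max N N'"
  define \<alpha> where "\<alpha> i = (if i < N then a i else 0)" for i
  define \<beta> where "\<beta> i = (if i < N' then a' i else 0)" for i
  have 1: "(\<Sum>i<N. a i * x i) = (\<Sum>i<K. \<alpha> i * x i)" for x :: "nat \<Rightarrow> real"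
    unfolding \<alpha>_def by (rule linear_form_pad) (simp add: K_def)
  have 2: "(\<Sum>i<N'. a' i * x i) = (\<Sum>i<K. \<beta> i * x i)" for x :: "nat \<Rightarrow> real"
    unfolding \<beta>_def by (rule linear_form_pad) (simp add: K_def)
  have "c' * cos (B + b') * (c * cos (A + b)) =
        (c * c' / 2) * cos (A - B + (b - b')) + (c * c' / 2) * cos (A + B + (b + b'))"
    for A B :: real
  proof -
    have "A - B + (b - b') = (A + b) - (B + b')" "A + B + (b + b') = (A + b) + (B + b')" by simp_all
    then show ?thesis
      using cos_times_cos[of "A + b" "B + b'"] by (simp only:) (simp add: field_simps)
  qed
  then have "(\<lambda>x. c' * cos ((\<Sum>i<N'. a' i * x i) + b') * (c * cos ((\<Sum>i<N. a i * x i) + b)))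
    = (\<lambda>x. (c * c' / 2) * cos ((\<Sum>i<K. (\<alpha> i - \<beta> i) * x i) + (b - b'))
         + (c * c' / 2) * cos ((\<Sum>i<K. (\<alpha> i + \<beta> i) * x i) + (b + b')))"
    unfolding 1 2 by (simp add: sum.distrib sum_subtractf left_diff_distrib distrib_right)
  then show ?case by (simp only: ) (intro trig_polys.intros)
next
  case (add f g)
  then show ?case by (simp add: distrib_right trig_polys.add)
qed

lemma trig_polys_mult:
  assumes "g \<in> trig_polys" "f \<in> trig_polys"
  shows "(\<lambda>x. f x * g x) \<in> trig_polys"
  using assms
proof induction
  case (cos c a N b)
  then show ?case by (intro trig_polys_mult_cos)
next
  case (add g h)
  then show ?case by (simp add: distrib_left trig_polys.add)
qed

lemma continuous_on_coordinate [continuous_intros]: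
  "continuous_on S (\<lambda>x :: 'i \<Rightarrow> 'b::topological_space. x i)"
  by (rule continuous_on_subset[OF continuous_on_product_coordinates subset_UNIV])

lemma trig_polys_continuous: "f \<in> trig_polys \<Longrightarrow> continuous_on S f"
  by (induction rule: trig_polys.induct) (auto intro!: continuous_intros)

lemma trig_polys_bounded: "f \<in> trig_polys \<Longrightarrow> \<exists>B. \<forall>x. \<bar>f x\<bar> \<le> B"
proof (induction rule: trig_polys.induct)
  case (cos c a N b)
  have "\<bar>c * cos y\<bar> \<le> \<bar>c\<bar>" for y by (simp add: abs_mult mult_left_le)
  then show ?case by blast
next
  case (add f g)
  then obtain B C where "\<And>x. \<bar>f x\<bar> \<le> B" "\<And>x. \<bar>g x\<bar> \<le> C" by blast
  then have "\<bar>f x + g x\<bar> \<le> B + C" for x using abs_triangle_ineq[of "f x" "g x"]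
    by (smt (verit))
  then show ?case by blast
qed

lemma compact_box: "compact {x :: nat \<Rightarrow> real. \<forall>i. \<bar>x i\<bar> \<le> R i}"
proof -
  have "compact_space (product_topology (\<lambda>i. top_of_set {- R i..R i}) UNIV)"
    by (simp add: compact_space_product_topology compact_space_subtopology)
  then have "compactin (product_topology (\<lambda>i. euclidean) UNIV) (PiE UNIV (\<lambda>i. {- R i..R i}))"
    by (auto simp: compactin_PiE)
  moreover have "PiE UNIV (\<lambda>i. {- R i..R i}) = {x. \<forall>i. \<bar>x i\<bar> \<le> R i}"
    by (auto simp: PiE_def abs_le_iff) (metis Pi_mem UNIV_I atLeastAtMost_iff minus_le_iff)+
  ultimately show ?thesis
    by (simp add: euclidean_product_topology)
qed

lemma arcsin_sin_fold: "\<bar>arcsin (sin x)\<bar> \<le> pi / 2" "sin (arcsin (sin x)) = sin x"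
  using arcsin_lbound[of "sin x"] arcsin_ubound[of "sin x"] by (auto simp: abs_le_iff)

text \<open>Periodic trigonometric polynomials with periods \<open>2 * pi * \<rho> i\<close> are determined by their values on
  the box, so that the uniform bound on the box holds globally.\<close>

lemma trig_poly_approx:
  fixes f :: "(nat \<Rightarrow> real) \<Rightarrow> real"
  assumes f: "continuous_on UNIV f" "\<And>x. \<bar>f x\<bar> \<le> B" and \<rho>: "\<And>i. \<rho> i > 0" and e: "e > 0"
  obtains p where "p \<in> trig_polys" "\<And>x. \<bar>p x\<bar> \<le> B + e"
    "\<And>x. \<forall>i. \<bar>x i\<bar> \<le> pi / 2 * \<rho> i \<Longrightarrow> \<bar>f x - p x\<bar> < e"
proof -
  define fold :: "(nat \<Rightarrow> real) \<Rightarrow> nat \<Rightarrow> real" where "fold x = (\<lambda>i. \<rho> i * arcsin (sin (x i / \<rho> i)))" for x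
  define S where "S = {x :: nat \<Rightarrow> real. \<forall>i. \<bar>x i\<bar> \<le> pi / 2 * \<rho> i}"
  define R where "R = {p \<in> trig_polys. \<forall>x. p (fold x) = p x}"
  have sin_R: "(\<lambda>x. sin (x i / \<rho> i)) \<in> R" for i
  proof -
    have "(\<lambda>x. 1 * cos ((\<Sum>j<Suc i. (if j = i then 1 / \<rho> i else 0) * x j) + - (pi/2))) \<in> trig_polys"
      by (rule trig_polys.cos)
    moreover have "(\<Sum>j<Suc i. (if j = i then 1 / \<rho> i else 0) * x j) = x i / \<rho> i" for x :: "nat \<Rightarrow> real"
      by (simp add: if_distrib[of "\<lambda>u. u * _"] sum.delta cong: if_cong)
    ultimately have "(\<lambda>x. cos (x i / \<rho> i - pi/2)) \<in> trig_polys" by simp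
    then have "(\<lambda>x. sin (x i / \<rho> i)) \<in> trig_polys" by (simp add: cos_diff)
    then show ?thesis using \<rho>[of i] arcsin_sin_fold(2) by (simp add: R_def fold_def)
  qed
  interpret function_ring_on R S
  proof
    show "compact S" unfolding S_def by (rule compact_box)
    show "continuous_on S f" if "f \<in> R" for f using that trig_polys_continuous by (auto simp: R_def)
    show "(\<lambda>x. f x + g x) \<in> R" if "f \<in> R" "g \<in> R" for f g
      using that by (auto simp: R_def trig_polys.add)
    show "(\<lambda>x. f x * g x) \<in> R" if "f \<in> R" "g \<in> R" for f g
      using that by (auto simp: R_def trig_polys_mult)
    show "(\<lambda>_. c) \<in> R" for c
      using trig_polys.cos[of c _ 0 0] by (auto simp: R_def)
    show "\<exists>f\<in>R. f x \<noteq> f y" if xy: "x \<in> S" "y \<in> S" "x \<noteq> y" for x y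
    proof -
      obtain i where i: "x i \<noteq> y i" using xy(3) by (auto simp: fun_eq_iff)
      have "\<bar>x i / \<rho> i\<bar> \<le> pi / 2" "\<bar>y i / \<rho> i\<bar> \<le> pi / 2"
        using xy(1,2) \<rho>[of i] by (auto simp: S_def field_simps)
      then have "- (pi / 2) \<le> x i / \<rho> i" "x i / \<rho> i \<le> pi / 2" "- (pi / 2) \<le> y i / \<rho> i" "y i / \<rho> i \<le> pi / 2"
        by linarith+
      then have "sin (x i / \<rho> i) = sin (y i / \<rho> i) \<Longrightarrow> x i / \<rho> i = y i / \<rho> i"
        by (rule sin_inj_pi)
      then have "sin (x i / \<rho> i) \<noteq> sin (y i / \<rho> i)"
        using i \<rho>[of i] by auto
      then show ?thesis by (intro bexI[OF _ sin_R[of i]])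
    qed
  qed
  obtain p where p: "p \<in> R" "\<forall>x\<in>S. \<bar>f x - p x\<bar> < e"
    using Stone_Weierstrass_basic[OF continuous_on_subset[OF f(1)] e] by auto
  have "fold x \<in> S" for x
    using \<rho> arcsin_sin_fold(1) by (auto simp: S_def fold_def abs_mult mult.commute mult_left_mono less_imp_le)
  then have "\<bar>f (fold x) - p x\<bar> < e" for x using p by (force simp: R_def)
  then have "\<bar>p x\<bar> \<le> B + e" for x
  proof -
    have "\<bar>f (fold x) - p x\<bar> < e" by fact
    then show ?thesis using f(2)[of "fold x"] by linarith
  qed
  with p show ?thesis by (intro that[of p]) (auto simp: R_def S_def)
qed

lemma (in prob_space) expectation_diff_bound:
  fixes f p :: "(nat \<Rightarrow> real) \<Rightarrow> real"
  assumes V: "V \<in> borel_measurable M" and f: "f \<in> borel_measurable borel" and p: "p \<in> borel_measurable borel"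
    and S: "S \<in> sets borel" "prob {\<omega> \<in> space M. V \<omega> \<notin> S} \<le> e"
    and B: "\<And>x. \<bar>f x\<bar> \<le> B" "\<And>x. \<bar>p x\<bar> \<le> B + d" and d: "d > 0" "\<And>x. x \<in> S \<Longrightarrow> \<bar>f x - p x\<bar> \<le> d"
  shows "\<bar>(\<integral>\<omega>. f (V \<omega>) \<partial>M) - (\<integral>\<omega>. p (V \<omega>) \<partial>M)\<bar> \<le> d + (2 * B + d) * e"
proof -
  note [measurable] = V f p S(1)
  have B0: "B \<ge> 0" using B(1)[of undefined] by linarith
  have i: "integrable M (\<lambda>\<omega>. f (V \<omega>))" "integrable M (\<lambda>\<omega>. p (V \<omega>))"
    using B by (auto intro: integrable_const_bound[where B=B] integrable_const_bound[where B="B+d"])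
  let ?E = "{\<omega> \<in> space M. V \<omega> \<notin> S}"
  have "\<bar>(\<integral>\<omega>. f (V \<omega>) \<partial>M) - (\<integral>\<omega>. p (V \<omega>) \<partial>M)\<bar> = \<bar>\<integral>\<omega>. f (V \<omega>) - p (V \<omega>) \<partial>M\<bar>"
    using i by simp
  also have "\<dots> \<le> (\<integral>\<omega>. \<bar>f (V \<omega>) - p (V \<omega>)\<bar> \<partial>M)" by (rule integral_abs_bound)
  also have "\<dots> \<le> (\<integral>\<omega>. d + (2 * B + d) * indicator ?E \<omega> \<partial>M)"
  proof (rule integral_mono)
    show "integrable M (\<lambda>\<omega>. d + (2 * B + d) * indicator ?E \<omega>)"
      by (auto intro!: Bochner_Integration.integrable_add integrable_mult_right simp: emeasure_eq_measure)
    show "\<bar>f (V \<omega>) - p (V \<omega>)\<bar> \<le> d + (2 * B + d) * indicator ?E \<omega>" if "\<omega> \<in> space M" for \<omega>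
    proof (cases "V \<omega> \<in> S")
      case True then show ?thesis using d(2) by simp
    next
      case False
      have "\<bar>f (V \<omega>) - p (V \<omega>)\<bar> \<le> B + (B + d)" using B[of "V \<omega>"] by linarith
      then show ?thesis using False that d(1) by simp
    qed
  qed (use i in auto)
  also have "\<dots> = d + (2 * B + d) * prob ?E"
    by (subst Bochner_Integration.integral_add) (auto simp: prob_space emeasure_eq_measure)
  also have "\<dots> \<le> d + (2 * B + d) * e"
    using S(2) B0 d(1) by (intro add_left_mono mult_left_mono) auto
  finally show ?thesis .
qed

lemma (in prob_space) prob_outside_box:
  fixes V :: "'a \<Rightarrow> nat \<Rightarrow> real"
  assumes [measurable]: "\<And>i. (\<lambda>\<omega>. V \<omega> i) \<in> borel_measurable M"
    and R: "\<And>i. prob {\<omega> \<in> space M. \<bar>V \<omega> i\<bar> > R i} \<le> e * (1/2) ^ Suc i"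
  shows "prob {\<omega> \<in> space M. V \<omega> \<notin> {x. \<forall>i. \<bar>x i\<bar> \<le> R i}} \<le> e"
proof -
  let ?A = "\<lambda>i. {\<omega> \<in> space M. \<bar>V \<omega> i\<bar> > R i}"
  have s: "(\<lambda>i. e * (1/2) ^ Suc i) sums (e * 1)"
    by (intro sums_mult power_half_series)
  have sm: "summable (\<lambda>i. prob (?A i))"
    by (rule summable_comparison_test_ev[OF _ sums_summable[OF s]]) (use R in auto)
  have "{\<omega> \<in> space M. V \<omega> \<notin> {x. \<forall>i. \<bar>x i\<bar> \<le> R i}} = (\<Union>i. ?A i)"
    by (auto simp: not_le)
  also have "prob \<dots> \<le> (\<Sum>i. prob (?A i))"
    by (rule finite_measure_subadditive_countably[OF _ sm]) auto
  also have "\<dots> \<le> (\<Sum>i. e * (1/2) ^ Suc i)"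
    by (rule suminf_le[OF R sm sums_summable[OF s]])
  also have "\<dots> = e" using sums_unique[OF s] by simp
  finally show ?thesis .
qed

lemma (in prob_space) random_variable_tight:
  fixes X :: "'a \<Rightarrow> real"
  assumes [measurable]: "X \<in> borel_measurable M" and "e > 0"
  obtains R where "R > 0" "prob {\<omega> \<in> space M. \<bar>X \<omega>\<bar> > R} \<le> e"
proof -
  let ?A = "\<lambda>n. {\<omega> \<in> space M. \<bar>X \<omega>\<bar> > real n}"
  have "(\<lambda>n. prob (?A n)) \<longlonglongrightarrow> prob (\<Inter>n. ?A n)"
    by (rule finite_Lim_measure_decseq) (auto simp: decseq_def)
  moreover have "(\<Inter>n. ?A n) = {}"
    by (auto simp: not_less) (metis reals_Archimedean2 less_le_not_le not_less)
  ultimately have "(\<lambda>n. prob (?A n)) \<longlonglongrightarrow> 0" by simp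
  then have "eventually (\<lambda>n. prob (?A n) < e) sequentially"
    using \<open>e > 0\<close> by (rule order_tendstoD)
  then obtain n where "\<And>k. k \<ge> n \<Longrightarrow> prob (?A k) < e" by (auto simp: eventually_sequentially)
  then show thesis by (intro that[of "real (Suc n)"]) (auto simp del: of_nat_Suc intro: less_imp_le)
qed

theorem weak_convergence_of_trig_convergence:
  fixes V :: "nat \<Rightarrow> 'a \<Rightarrow> nat \<Rightarrow> real" and N :: "(nat \<Rightarrow> real) measure"
    and f :: "(nat \<Rightarrow> real) \<Rightarrow> real"
  assumes "prob_space M" "prob_space N" and sN: "sets N = sets borel"
    and V: "\<And>n i. (\<lambda>\<omega>. V n \<omega> i) \<in> borel_measurable M"
    and trig: "\<And>k a b. (\<lambda>n. \<integral>\<omega>. cos ((\<Sum>i<k. a i * V n \<omega> i) + b) \<partial>M)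
                 \<longlonglongrightarrow> (\<integral>v. cos ((\<Sum>i<k. a i * v i) + b) \<partial>N)"
    and tight: "\<And>i e. e > 0 \<Longrightarrow> \<exists>R. \<forall>n. measure M {\<omega> \<in> space M. \<bar>V n \<omega> i\<bar> > R} \<le> e"
    and f: "continuous_on UNIV f" "\<And>x. \<bar>f x\<bar> \<le> B"
  shows "(\<lambda>n. \<integral>\<omega>. f (V n \<omega>) \<partial>M) \<longlonglongrightarrow> (\<integral>v. f v \<partial>N)"
proof -
  interpret M: prob_space M by fact
  interpret N: prob_space N by fact
  have Vb[measurable]: "V n \<in> borel_measurable M" for n
    using V by (rule measurable_coordinatewise_then_product)
  have cont_borel: "g \<in> borel_measurable borel" if "continuous_on UNIV g" for g :: "(nat \<Rightarrow> real) \<Rightarrow> real"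
    by (rule borel_measurable_continuous_onI[OF that])
  have N_id[measurable]: "(\<lambda>v. v) \<in> borel_measurable N"
    using sN by (simp add: measurable_ident_sets)
  have coordN[measurable]: "(\<lambda>v. v i) \<in> borel_measurable N" for i
    using measurable_compose[OF N_id cont_borel[OF continuous_on_coordinate]] by simp
  have trigconv: "(\<lambda>n. \<integral>\<omega>. p (V n \<omega>) \<partial>M) \<longlonglongrightarrow> (\<integral>v. p v \<partial>N)" if "p \<in> trig_polys" for p
    using that
  proof induction
    case (cos c a k b)
    show ?case using tendsto_mult_left[OF trig[of a k b], of c] by simp
  next
    case (add f g)
    have "integrable M (\<lambda>\<omega>. h (V n \<omega>))" "integrable N h" if h: "h \<in> trig_polys" for h n
    proof -
      obtain C where C: "\<And>x. \<bar>h x\<bar> \<le> C" using trig_polys_bounded[OF h] by blast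
      have [measurable]: "h \<in> borel_measurable borel" by (rule cont_borel[OF trig_polys_continuous[OF h]])
      show "integrable M (\<lambda>\<omega>. h (V n \<omega>))" by (rule M.integrable_const_bound[where B=C]) (use C in auto)
      show "integrable N h" by (rule N.integrable_const_bound[where B=C]) (use C in \<open>auto simp: measurable_cong_sets[OF sN refl]\<close>)
    qed
    then show ?case using add tendsto_add[OF add.IH] by simp
  qed
  have B0: "B \<ge> 0" using f(2)[of undefined] by linarith
  have key: "\<exists>n0. \<forall>n\<ge>n0. \<bar>(\<integral>\<omega>. f (V n \<omega>) \<partial>M) - (\<integral>v. f v \<partial>N)\<bar> \<le> 3 * e + (4 * B + 2 * e) * e"
    if e: "e > 0" for e
  proof -
    have "\<exists>R>0. (\<forall>n. M.prob {\<omega> \<in> space M. \<bar>V n \<omega> i\<bar> > R} \<le> e * (1/2) ^ Suc i) \<and>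
             N.prob {v \<in> space N. \<bar>v i\<bar> > R} \<le> e * (1/2) ^ Suc i" for i
    proof -
      have pos: "e * (1/2) ^ Suc i > 0" using e by simp
      obtain R1 where R1: "\<And>n. M.prob {\<omega> \<in> space M. \<bar>V n \<omega> i\<bar> > R1} \<le> e * (1/2) ^ Suc i"
        using tight[OF pos] by blast
      obtain R2 where R2: "R2 > 0" "N.prob {v \<in> space N. \<bar>v i\<bar> > R2} \<le> e * (1/2) ^ Suc i"
        using N.random_variable_tight[OF coordN pos] by blast
      have "M.prob {\<omega> \<in> space M. \<bar>V n \<omega> i\<bar> > max R1 R2} \<le> e * (1/2) ^ Suc i" for n
      proof (rule order_trans[OF M.finite_measure_mono R1[of n]])
        show "{\<omega> \<in> space M. \<bar>V n \<omega> i\<bar> > R1} \<in> M.events"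
          using borel_measurable_abs[OF V[of n i]] unfolding borel_measurable_iff_greater by blast
      qed auto
      moreover have "N.prob {v \<in> space N. \<bar>v i\<bar> > max R1 R2} \<le> e * (1/2) ^ Suc i"
        by (rule order_trans[OF N.finite_measure_mono R2(2)]) auto
      ultimately show ?thesis using R2(1) by (intro exI[of _ "max R1 R2"]) auto
    qed
    then have "\<exists>R. \<forall>i. R i > 0 \<and> (\<forall>n. M.prob {\<omega> \<in> space M. \<bar>V n \<omega> i\<bar> > R i} \<le> e * (1/2) ^ Suc i) \<and>
             N.prob {v \<in> space N. \<bar>v i\<bar> > R i} \<le> e * (1/2) ^ Suc i"
      by (intro choice allI)
    then obtain R where R: "\<And>i. R i > 0"
      "\<And>n i. M.prob {\<omega> \<in> space M. \<bar>V n \<omega> i\<bar> > R i} \<le> e * (1/2) ^ Suc i"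
      "\<And>i. N.prob {v \<in> space N. \<bar>v i\<bar> > R i} \<le> e * (1/2) ^ Suc i" by blast
    define S where "S = {x :: nat \<Rightarrow> real. \<forall>i. \<bar>x i\<bar> \<le> R i}"
    have S[measurable]: "S \<in> sets borel"
      unfolding S_def by (rule borel_closed, rule compact_imp_closed, rule compact_box)
    obtain p where p: "p \<in> trig_polys" "\<And>x. \<bar>p x\<bar> \<le> B + e"
      "\<And>x. \<forall>i. \<bar>x i\<bar> \<le> pi / 2 * (R i / (pi / 2)) \<Longrightarrow> \<bar>f x - p x\<bar> < e"
      using trig_poly_approx[OF f, of "\<lambda>i. R i / (pi / 2)" e] R(1) e by auto
    have pS: "\<bar>f x - p x\<bar> \<le> e" if "x \<in> S" for x using p(3)[of x] that by (auto simp: S_def)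
    have fb: "f \<in> borel_measurable borel" and pb: "p \<in> borel_measurable borel"
      using f(1) trig_polys_continuous[OF p(1)] by (auto intro: cont_borel)
    have 1: "\<bar>(\<integral>\<omega>. f (V n \<omega>) \<partial>M) - (\<integral>\<omega>. p (V n \<omega>) \<partial>M)\<bar> \<le> e + (2 * B + e) * e" for n
      by (rule M.expectation_diff_bound[OF Vb fb pb S _ f(2) p(2) e pS])
         (auto simp only: S_def intro!: M.prob_outside_box V R(2))
    have 2: "\<bar>(\<integral>v. f v \<partial>N) - (\<integral>v. p v \<partial>N)\<bar> \<le> e + (2 * B + e) * e"
      by (rule N.expectation_diff_bound[OF N_id fb pb S _ f(2) p(2) e pS])
         (auto simp only: S_def intro!: N.prob_outside_box coordN R(3))
    from LIMSEQ_D[OF trigconv[OF p(1)] e] obtain n0 where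
      n0: "\<And>n. n \<ge> n0 \<Longrightarrow> \<bar>(\<integral>\<omega>. p (V n \<omega>) \<partial>M) - (\<integral>v. p v \<partial>N)\<bar> < e" by auto
    show ?thesis
    proof (intro exI[of _ n0] allI impI)
      fix n assume "n \<ge> n0"
      have "\<bar>(\<integral>\<omega>. f (V n \<omega>) \<partial>M) - (\<integral>v. f v \<partial>N)\<bar> \<le> (e + (2 * B + e) * e) + e + (e + (2 * B + e) * e)"
        using 1[of n] 2 n0[OF \<open>n \<ge> n0\<close>] by linarith
      then show "\<bar>(\<integral>\<omega>. f (V n \<omega>) \<partial>M) - (\<integral>v. f v \<partial>N)\<bar> \<le> 3 * e + (4 * B + 2 * e) * e"
        by (simp add: algebra_simps)
    qed
  qed
  show ?thesis
  proof (rule LIMSEQ_I)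
    fix r :: real assume r: "r > 0"
    define e where "e = min 1 (r / (2 * (5 + 4 * B)))"
    have pos: "2 * (5 + 4 * B) > 0" using B0 by simp
    have "e \<le> r / (2 * (5 + 4 * B))" by (simp add: e_def)
    then have "e * (2 * (5 + 4 * B)) \<le> r" using pos_le_divide_eq[OF pos] by blast
    then have e: "e > 0" "e \<le> 1" "e * (5 + 4 * B) < r"
      using r pos by (auto simp: e_def simp del: distrib_left_numeral)
    have "3 * e + (4 * B + 2 * e) * e \<le> e * (5 + 4 * B)"
      using e mult_left_mono[OF e(2), of "2 * e"] by (simp add: algebra_simps)
    with e(3) have lt: "3 * e + (4 * B + 2 * e) * e < r" by linarith
    obtain n0 where "\<And>n. n \<ge> n0 \<Longrightarrow> \<bar>(\<integral>\<omega>. f (V n \<omega>) \<partial>M) - (\<integral>v. f v \<partial>N)\<bar> \<le> 3 * e + (4 * B + 2 * e) * e"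
      using key[OF e(1)] by blast
    then show "\<exists>no. \<forall>n\<ge>no. norm ((\<integral>\<omega>. f (V n \<omega>) \<partial>M) - (\<integral>v. f v \<partial>N)) < r"
      using lt by (intro exI[of _ n0]) (auto intro: order.strict_trans1)
  qed
qed

section \<open>Gaussian sequences with prescribed covariance\<close>

definition square_integrable :: "'a measure \<Rightarrow> ('a \<Rightarrow> real) \<Rightarrow> bool" where
  "square_integrable M f \<longleftrightarrow> f \<in> borel_measurable M \<and> integrable M (\<lambda>x. (f x)\<^sup>2)"

lemma square_integrable_mult:
  assumes "square_integrable M f" "square_integrable M g"
  shows "integrable M (\<lambda>x. f x * g x)"
proof (rule Bochner_Integration.integrable_bound)
  show "integrable M (\<lambda>x. (f x)\<^sup>2 + (g x)\<^sup>2)" using assms by (simp add: square_integrable_def)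
  show "(\<lambda>x. f x * g x) \<in> borel_measurable M" using assms by (auto simp: square_integrable_def)
  have "\<bar>a * b\<bar> \<le> \<bar>a\<^sup>2 + b\<^sup>2\<bar>" for a b :: real
    using sum_squares_bound[of "\<bar>a\<bar>" "\<bar>b\<bar>"] mult_nonneg_nonneg[of "\<bar>a\<bar>" "\<bar>b\<bar>"]
    by (simp add: abs_mult del: mult_nonneg_nonneg)
  then show "AE x in M. norm (f x * g x) \<le> norm ((f x)\<^sup>2 + (g x)\<^sup>2)" by simp
qed

lemma square_integrable_scale: "square_integrable M f \<Longrightarrow> square_integrable M (\<lambda>x. c * f x)"
  by (auto simp: square_integrable_def power_mult_distrib)

lemma square_integrable_diff:
  assumes "square_integrable M f" "square_integrable M g"
  shows "square_integrable M (\<lambda>x. f x - g x)"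
  using assms square_integrable_mult[OF assms]
  by (auto simp: square_integrable_def power2_diff mult.assoc)

lemma square_integrable_add:
  assumes "square_integrable M f" "square_integrable M g"
  shows "square_integrable M (\<lambda>x. f x + g x)"
  using square_integrable_diff[OF assms(1) square_integrable_scale[OF assms(2), of "-1"]] by simp

lemma square_integrable_sum:
  assumes "\<And>i. i \<in> I \<Longrightarrow> square_integrable M (f i)"
  shows "square_integrable M (\<lambda>x. \<Sum>i\<in>I. f i x)"
  using assms
proof (induction I rule: infinite_finite_induct)
  case (insert i I)
  then show ?case by (simp add: square_integrable_add)
qed (auto simp: square_integrable_def)

text \<open>Gram--Schmidt; a vector in the span of its predecessors yields the zero function, because
  \<open>1 / 0 = 0\<close>.\<close>

fun gram_schmidt :: "'a measure \<Rightarrow> (nat \<Rightarrow> 'a \<Rightarrow> real) \<Rightarrow> nat \<Rightarrow> 'a \<Rightarrow> real" where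
  "gram_schmidt M g n =
     (let r = (\<lambda>x. g n x - (\<Sum>j<n. (\<integral>y. g n y * gram_schmidt M g j y \<partial>M) * gram_schmidt M g j x))
      in (\<lambda>x. 1 / sqrt (\<integral>y. (r y)\<^sup>2 \<partial>M) * r x))"

declare gram_schmidt.simps [simp del]

lemma cholesky:
  fixes g :: "nat \<Rightarrow> 'a \<Rightarrow> real"
  assumes g: "\<And>n. square_integrable M (g n)"
  obtains c :: "nat \<Rightarrow> nat \<Rightarrow> real" where
    "\<And>i k. (\<integral>x. g i x * g k x \<partial>M) = (\<Sum>j\<le>min i k. c i j * c k j)"
proof -
  define e where "e = gram_schmidt M g"
  define ip where "ip f h = (\<integral>x. f x * h x \<partial>M)" for f h :: "'a \<Rightarrow> real"
  define r where "r n = (\<lambda>x. g n x - (\<Sum>j<n. ip (g n) (e j) * e j x))" for n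
  define c where "c i j = (if j < i then ip (g i) (e j) else if j = i then sqrt (ip (r i) (r i)) else 0)" for i j
  have e_eq: "e n = (\<lambda>x. 1 / sqrt (ip (r n) (r n)) * r n x)" for n
    unfolding e_def by (subst gram_schmidt.simps)
      (simp add: r_def e_def ip_def Let_def power2_eq_square)
  have sq_e: "square_integrable M (e n)" for n
  proof (induction n rule: less_induct)
    case (less n)
    then show ?case unfolding e_eq[of n] r_def
      by (intro square_integrable_scale square_integrable_diff square_integrable_sum g) auto
  qed
  have sq_r: "square_integrable M (r n)" for n
    unfolding r_def by (intro square_integrable_scale square_integrable_diff square_integrable_sum g sq_e)
  have ip_comm: "ip f h = ip h f" for f h by (simp add: ip_def mult.commute)
  have ip_scale: "ip (\<lambda>x. a * f x) h = a * ip f h" for a f h by (simp add: ip_def mult.assoc)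
  have ip_diff: "ip (\<lambda>x. f x - f' x) h = ip f h - ip f' h"
    if "square_integrable M f" "square_integrable M f'" "square_integrable M h" for f f' h
    using that by (simp add: ip_def left_diff_distrib square_integrable_mult)
  have ip_sum: "ip (\<lambda>x. \<Sum>j\<in>J. b j * e j x) h = (\<Sum>j\<in>J. b j * ip (e j) h)"
    if "square_integrable M h" for b h and J :: "nat set"
  proof -
    have "(\<integral>x. (\<Sum>j\<in>J. b j * (e j x * h x)) \<partial>M) = (\<Sum>j\<in>J. b j * ip (e j) h)"
      using that sq_e by (simp add: ip_def Bochner_Integration.integral_sum square_integrable_mult)
    then show ?thesis by (simp add: ip_def sum_distrib_right mult.assoc)
  qed
  have e_zero: "e j = (\<lambda>_. 0)" if "ip (r j) (r j) = 0" for j using that by (simp add: e_eq)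
  have ip_nonneg: "ip f f \<ge> 0" for f by (simp add: ip_def)
  have norm_e: "ip (e j) (e j) = (if ip (r j) (r j) = 0 then 0 else 1)" for j
  proof (cases "ip (r j) (r j) = 0")
    case True then show ?thesis using e_zero[OF True] by (simp add: ip_def)
  next
    case False
    have "ip (e j) (e j) = 1 / sqrt (ip (r j) (r j)) * (1 / sqrt (ip (r j) (r j)) * ip (r j) (r j))"
      unfolding e_eq[of j] ip_scale by (subst ip_comm) (simp only: ip_scale)
    then show ?thesis using False ip_nonneg[of "r j"]
      by (simp add: field_simps flip: power2_eq_square)
  qed
  have orth: "i < n \<Longrightarrow> ip (e n) (e i) = 0" for i n
  proof (induction n arbitrary: i rule: less_induct)
    case (less n)
    have o: "ip (e j) (e i) = 0" if "j < n" "j \<noteq> i" for j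
    proof (cases "j < i")
      case True then show ?thesis using less.IH[of i j] less.prems ip_comm by simp
    next
      case False then show ?thesis using less.IH[of j i] that by simp
    qed
    have "ip (r n) (e i) = ip (g n) (e i) - (\<Sum>j<n. ip (g n) (e j) * ip (e j) (e i))"
      unfolding r_def
      by (subst ip_diff) (auto intro!: square_integrable_sum square_integrable_scale sq_e g simp: ip_sum sq_e)
    also have "(\<Sum>j<n. ip (g n) (e j) * ip (e j) (e i)) = (\<Sum>j<n. if j = i then ip (g n) (e i) * ip (e i) (e i) else 0)"
      by (rule sum.cong) (auto simp: o)
    also have "\<dots> = ip (g n) (e i) * ip (e i) (e i)" using less.prems by simp
    also have "\<dots> = ip (g n) (e i)"
      using norm_e[of i] e_zero[of i] by (auto simp: ip_def)
    finally have "ip (r n) (e i) = 0" by simp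
    then show ?case unfolding e_eq[of n] ip_scale by simp
  qed
  have orth': "ip (e j) (e k) = 0" if "j \<noteq> k" for j k
    using that orth[of j k] orth[of k j] ip_comm[of "e j"] by (cases "j < k") auto
  have g_eq: "AE x in M. g n x = (\<Sum>j\<le>n. c n j * e j x)" for n
  proof -
    have "AE x in M. r n x = c n n * e n x"
    proof (cases "ip (r n) (r n) = 0")
      case True
      have "AE x in M. (r n x)\<^sup>2 = 0"
        using True sq_r[of n] by (subst integral_nonneg_eq_0_iff_AE[symmetric])
          (auto simp: ip_def power2_eq_square square_integrable_def)
      then show ?thesis by eventually_elim (simp add: c_def True)
    next
      case False
      then show ?thesis unfolding e_eq[of n] by (simp add: c_def)
    qed
    then show ?thesis
    proof eventually_elim
      case (elim x)
      have "(\<Sum>j\<le>n. c n j * e j x) = (\<Sum>j<n. c n j * e j x) + c n n * e n x"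
        by (simp add: lessThan_Suc_atMost[symmetric])
      also have "(\<Sum>j<n. c n j * e j x) = (\<Sum>j<n. ip (g n) (e j) * e j x)"
        by (rule sum.cong) (auto simp: c_def)
      finally show ?case using elim by (simp add: r_def)
    qed
  qed
  have [measurable]: "e n \<in> borel_measurable M" "g n \<in> borel_measurable M" for n
    using sq_e g by (auto simp: square_integrable_def)
  show thesis
  proof
    fix i k
    have c_norm: "c i j * c k j * ip (e j) (e j) = c i j * c k j" if "j \<le> i" "j \<le> k" for j
    proof (cases "ip (r j) (r j) = 0")
      case True
      then have "c i j = 0" using that e_zero[OF True] by (auto simp: c_def ip_def)
      then show ?thesis by simp
    qed (simp add: norm_e)
    have "ip (g i) (g k) = ip (\<lambda>x. \<Sum>j\<le>i. c i j * e j x) (\<lambda>x. \<Sum>j\<le>k. c k j * e j x)"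
      unfolding ip_def
    proof (rule integral_cong_AE)
      show "AE x in M. g i x * g k x = (\<Sum>j\<le>i. c i j * e j x) * (\<Sum>j\<le>k. c k j * e j x)"
        using g_eq[of i] g_eq[of k] by eventually_elim simp
    qed auto
    also have "\<dots> = (\<Sum>j\<le>i. c i j * ip (e j) (\<lambda>x. \<Sum>l\<le>k. c k l * e l x))"
      by (intro ip_sum square_integrable_sum square_integrable_scale sq_e)
    also have "\<dots> = (\<Sum>j\<le>i. c i j * (\<Sum>l\<le>k. c k l * ip (e l) (e j)))"
      by (subst ip_comm) (simp only: ip_sum[OF sq_e])
    also have "\<dots> = (\<Sum>j\<le>i. c i j * (\<Sum>l\<le>k. if l = j then c k j * ip (e j) (e j) else 0))"
      by (intro sum.cong arg_cong2[where f="(*)"]) (auto simp: orth')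
    also have "\<dots> = (\<Sum>j\<le>i. if j \<le> k then c i j * c k j else 0)"
      by (rule sum.cong) (auto simp: c_norm mult.assoc[symmetric])
    also have "\<dots> = (\<Sum>j\<le>min i k. c i j * c k j)"
      by (rule sum.mono_neutral_cong_right) auto
    finally show "(\<integral>x. g i x * g k x \<partial>M) = (\<Sum>j\<le>min i k. c i j * c k j)" by (simp add: ip_def)
  qed
qed

lemma char_normal_law: "char (normal_law 0 s) t = exp (- (s * t)\<^sup>2 / 2)"
proof -
  have "char (normal_law 0 s) t = char std_normal_distribution (s * t)"
    by (simp add: normal_law_def char_def integral_distr mult.commute mult.left_commute)
  then show ?thesis by (simp add: char_std_normal_distribution)
qed

lemma real_distribution_normal_law: "real_distribution (normal_law \<mu> s)"
proof -
  interpret prob_space std_normal_distribution by (rule prob_space_normal_density) simp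
  show ?thesis unfolding normal_law_def by (rule real_distribution_distr) simp
qed

lemma integral_normal_law:
  fixes f :: "real \<Rightarrow> real"
  assumes [measurable]: "f \<in> borel_measurable borel"
  shows "(\<integral>x. f x \<partial>normal_law \<mu> s) = (\<integral>x. f (\<mu> + s * x) \<partial>std_normal_distribution)"
  unfolding normal_law_def by (subst integral_distr) auto

lemma gaussian_sequence_exists:
  fixes g :: "nat \<Rightarrow> 'a \<Rightarrow> real"
  assumes g: "\<And>n. square_integrable M (g n)"
  obtains N :: "(nat \<Rightarrow> real) measure" where "prob_space N" "sets N = sets borel"
    "\<And>k a. distr N borel (\<lambda>v. \<Sum>i<k. a i * v i) =
             normal_law 0 (sqrt (\<integral>x. (\<Sum>i<k. a i * g i x)\<^sup>2 \<partial>M))"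
proof -
  obtain c where c: "\<And>i k. (\<integral>x. g i x * g k x \<partial>M) = (\<Sum>j\<le>min i k. c i j * c k j)"
    using cholesky[of M g, OF g] by metis
  define Q where "Q = PiM (UNIV :: nat set) (\<lambda>_. std_normal_distribution)"
  have nd: "prob_space std_normal_distribution" by (rule prob_space_normal_density) simp
  interpret Q: product_prob_space "\<lambda>_. std_normal_distribution" "UNIV :: nat set"
    using nd by (simp add: product_prob_space_def product_prob_space_axioms_def product_sigma_finite_def prob_space_imp_sigma_finite)
  interpret QP: prob_space Q unfolding Q_def by (rule Q.P.prob_space_axioms)
  have Qc[measurable]: "(\<lambda>x. x j) \<in> borel_measurable Q" for j
    unfolding Q_def using measurable_component_singleton[of j UNIV "\<lambda>_. std_normal_distribution"] by simp
  have Q1: "distr Q borel (\<lambda>x. x j) = std_normal_distribution" for j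
  proof -
    have "distr Q borel (\<lambda>x. x j) = distr Q std_normal_distribution (\<lambda>x. x j)"
      by (rule distr_cong) auto
    then show ?thesis using Q.PiM_component[of j] by (simp add: Q_def)
  qed
  have indep: "QP.indep_vars (\<lambda>_. borel) (\<lambda>j x. x j) UNIV"
  proof (subst QP.indep_vars_iff_distr_eq_PiM)
    have "distr Q (PiM UNIV (\<lambda>i. borel)) (\<lambda>x. \<lambda>i\<in>UNIV. x i) = Q"
    proof -
      have "sets Q = sets (PiM UNIV (\<lambda>i::nat. borel :: real measure))"
        unfolding Q_def by (rule sets_PiM_cong) auto
      then have "distr Q (PiM UNIV (\<lambda>i. borel)) (\<lambda>x. x) = Q" using distr_id2 by metis
      then show ?thesis by (simp add: restrict_UNIV)
    qed
    then show "distr Q (PiM UNIV (\<lambda>i. borel)) (\<lambda>x. \<lambda>i\<in>UNIV. x i) = (\<Pi>\<^sub>M i\<in>UNIV. distr Q borel (\<lambda>x. x i))"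
      using Q1 by (simp add: Q_def)
  qed auto
  have Qd: "distr Q borel (\<lambda>x. b * x j) = normal_law 0 b" for b j
  proof -
    have "distr Q borel (\<lambda>x. b * x j) = distr (distr Q borel (\<lambda>x. x j)) borel (\<lambda>x. b * x)"
      by (subst distr_distr) (auto simp: comp_def)
    then show ?thesis unfolding Q1 by (simp add: normal_law_def)
  qed
  have lin: "distr Q borel (\<lambda>x. \<Sum>j<k. b j * x j) = normal_law 0 (sqrt (\<Sum>j<k. (b j)\<^sup>2))" for k b
  proof (rule Levy_uniqueness)
    show "char (distr Q borel (\<lambda>x. \<Sum>j<k. b j * x j)) = char (normal_law 0 (sqrt (\<Sum>j<k. (b j)\<^sup>2)))"
    proof
      fix t
      have "QP.indep_vars (\<lambda>_. borel) (\<lambda>j x. b j * x j) {..<k}"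
        by (rule QP.indep_vars_compose2[OF QP.indep_vars_subset[OF indep]]) auto
      then have "char (distr Q borel (\<lambda>x. \<Sum>j<k. b j * x j)) t = (\<Prod>j<k. char (distr Q borel (\<lambda>x. b j * x j)) t)"
        by (rule QP.char_distr_sum)
      also have "\<dots> = (\<Prod>j<k. complex_of_real (exp (- (b j * t)\<^sup>2 / 2)))"
        unfolding Qd char_normal_law ..
      also have "\<dots> = complex_of_real (exp (\<Sum>j<k. - (b j * t)\<^sup>2 / 2))"
        by (simp add: exp_sum)
      also have "(\<Sum>j<k. - (b j * t)\<^sup>2 / 2) = - (sqrt (\<Sum>j<k. (b j)\<^sup>2) * t)\<^sup>2 / 2"
        by (simp add: power_mult_distrib sum_nonneg sum_distrib_right sum_divide_distrib sum_negf)
      finally show "char (distr Q borel (\<lambda>x. \<Sum>j<k. b j * x j)) t = char (normal_law 0 (sqrt (\<Sum>j<k. (b j)\<^sup>2))) t"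
        by (simp add: char_normal_law)
    qed
  qed (auto intro!: QP.real_distribution_distr real_distribution_normal_law)
  define \<Phi> where "\<Phi> x = (\<lambda>i. \<Sum>j\<le>i. c i j * x j)" for x :: "nat \<Rightarrow> real"
  have [measurable]: "\<Phi> \<in> borel_measurable Q"
    unfolding \<Phi>_def by (rule measurable_coordinatewise_then_product) simp
  define N where "N = distr Q borel \<Phi>"
  show thesis
  proof
    show "prob_space N" unfolding N_def by (rule QP.prob_space_distr) simp
    show "sets N = sets borel" by (simp add: N_def)
    fix k :: nat and a :: "nat \<Rightarrow> real"
    define c' where "c' i j = (if j \<le> i then c i j else 0)" for i j
    have c'_sum: "(\<Sum>j\<le>i. c i j * x j) = (\<Sum>j<k. c' i j * x j)" if "i < k" for i and x :: "nat \<Rightarrow> real"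
      using that by (intro sum.mono_neutral_cong_left) (auto simp: c'_def)
    have c'_prod: "(\<integral>x. g i x * g l x \<partial>M) = (\<Sum>j<k. c' i j * c' l j)" if "i < k" "l < k" for i l
      unfolding c using that by (intro sum.mono_neutral_cong_left) (auto simp: c'_def)
    have "distr N borel (\<lambda>v. \<Sum>i<k. a i * v i) = distr Q borel (\<lambda>x. \<Sum>i<k. a i * \<Phi> x i)"
      unfolding N_def by (subst distr_distr) (auto simp: comp_def intro!: borel_measurable_sum borel_measurable_times)
    also have "(\<lambda>x. \<Sum>i<k. a i * \<Phi> x i) = (\<lambda>x. \<Sum>j<k. (\<Sum>i<k. a i * c' i j) * x j)"
    proof
      fix x
      have "(\<Sum>i<k. a i * \<Phi> x i) = (\<Sum>i<k. \<Sum>j<k. a i * c' i j * x j)"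
        by (rule sum.cong) (auto simp: \<Phi>_def c'_sum sum_distrib_left mult.assoc)
      also have "\<dots> = (\<Sum>j<k. \<Sum>i<k. a i * c' i j * x j)" by (rule sum.swap)
      finally show "(\<Sum>i<k. a i * \<Phi> x i) = (\<Sum>j<k. (\<Sum>i<k. a i * c' i j) * x j)" by (simp add: sum_distrib_right)
    qed
    also have "distr Q borel \<dots> = normal_law 0 (sqrt (\<Sum>j<k. (\<Sum>i<k. a i * c' i j)\<^sup>2))" by (rule lin)
    also have "(\<Sum>j<k. (\<Sum>i<k. a i * c' i j)\<^sup>2) = (\<integral>x. (\<Sum>i<k. a i * g i x)\<^sup>2 \<partial>M)"
    proof -
      have "(\<integral>x. (\<Sum>i<k. a i * g i x)\<^sup>2 \<partial>M) = (\<integral>x. (\<Sum>i<k. \<Sum>l<k. a i * a l * (g i x * g l x)) \<partial>M)"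
        by (simp add: power2_eq_square sum_product algebra_simps)
      also have "\<dots> = (\<Sum>i<k. \<Sum>l<k. a i * a l * (\<integral>x. g i x * g l x \<partial>M))"
        using square_integrable_mult[OF g g] by (simp add: Bochner_Integration.integral_sum)
      also have "\<dots> = (\<Sum>i<k. \<Sum>l<k. \<Sum>j<k. a i * a l * (c' i j * c' l j))"
        by (intro sum.cong) (auto simp: c'_prod sum_distrib_left)
      also have "\<dots> = (\<Sum>i<k. \<Sum>j<k. \<Sum>l<k. a i * a l * (c' i j * c' l j))"
        by (intro sum.cong refl sum.swap)
      also have "\<dots> = (\<Sum>j<k. \<Sum>i<k. \<Sum>l<k. a i * a l * (c' i j * c' l j))" by (rule sum.swap)
      also have "\<dots> = (\<Sum>j<k. (\<Sum>i<k. a i * c' i j)\<^sup>2)"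
        by (simp add: power2_eq_square sum_product algebra_simps)
      finally show ?thesis by simp
    qed
    finally show "distr N borel (\<lambda>v. \<Sum>i<k. a i * v i) = normal_law 0 (sqrt (\<integral>x. (\<Sum>i<k. a i * g i x)\<^sup>2 \<partial>M))" .
  qed
qed

section \<open>Sign sums\<close>

definition rsign :: "nat set \<Rightarrow> nat \<Rightarrow> real" where
  "rsign A i = (if i \<in> A then - 1 else 1)"

lemma sum_Pow_lessThan_Suc:
  fixes f :: "nat set \<Rightarrow> real"
  shows "(\<Sum>A\<in>Pow {..<Suc n}. f A) = (\<Sum>A\<in>Pow {..<n}. f A + f (insert n A))"
proof -
  have "Pow {..<Suc n} = Pow {..<n} \<union> insert n ` Pow {..<n}"
    by (simp add: lessThan_Suc Pow_insert)
  moreover have "inj_on (insert n) (Pow {..<n})"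
    by (rule inj_onI) (metis PowD insert_ident lessThan_iff less_irrefl subsetD)
  moreover have "Pow {..<n} \<inter> insert n ` Pow {..<n} = {}" by auto
  ultimately show ?thesis by (simp add: sum.union_disjoint sum.reindex sum.distrib)
qed

lemma rademacher_sum_insert:
  assumes "A \<subseteq> {..<n}"
  shows "(\<Sum>i<Suc n. rsign A i * b i) = (\<Sum>i<n. rsign A i * b i) + b n"
    "(\<Sum>i<Suc n. rsign (insert n A) i * b i) = (\<Sum>i<n. rsign A i * b i) - b n"
proof -
  have "n \<notin> A" using assms by auto
  then show "(\<Sum>i<Suc n. rsign A i * b i) = (\<Sum>i<n. rsign A i * b i) + b n" by (simp add: rsign_def)
  have "(\<Sum>i<n. rsign (insert n A) i * b i) = (\<Sum>i<n. rsign A i * b i)"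
    by (rule sum.cong) (auto simp: rsign_def)
  then show "(\<Sum>i<Suc n. rsign (insert n A) i * b i) = (\<Sum>i<n. rsign A i * b i) - b n" by (simp add: rsign_def)
qed

lemma rademacher_second_moment:
  "(\<Sum>A\<in>Pow {..<n}. (\<Sum>i<n. rsign A i * b i)\<^sup>2) = 2 ^ n * (\<Sum>i<n. (b i)\<^sup>2)"
proof (induction n)
  case (Suc n)
  have "(\<Sum>A\<in>Pow {..<Suc n}. (\<Sum>i<Suc n. rsign A i * b i)\<^sup>2)
      = (\<Sum>A\<in>Pow {..<n}. 2 * (\<Sum>i<n. rsign A i * b i)\<^sup>2 + 2 * (b n)\<^sup>2)"
    unfolding sum_Pow_lessThan_Suc
    by (rule sum.cong) (auto simp only: Pow_iff rademacher_sum_insert power2_sum power2_diff)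
  also have "\<dots> = 2 * (2 ^ n * (\<Sum>i<n. (b i)\<^sup>2)) + 2 ^ n * (2 * (b n)\<^sup>2)"
    by (simp add: sum.distrib sum_distrib_left[symmetric] Suc card_Pow)
  finally show ?case by (simp add: algebra_simps)
qed simp

lemma rademacher_fourth_moment:
  "(\<Sum>A\<in>Pow {..<n}. (\<Sum>i<n. rsign A i * b i) ^ 4) \<le> 2 ^ n * (3 * (\<Sum>i<n. (b i)\<^sup>2)\<^sup>2)"
proof (induction n)
  case (Suc n)
  let ?q = "\<Sum>i<n. (b i)\<^sup>2"
  have p4: "(x + y) ^ 4 + (x - y) ^ 4 = 2 * x ^ 4 + 12 * y\<^sup>2 * x\<^sup>2 + 2 * y ^ 4" for x y :: real
    by (simp add: power2_eq_square power4_eq_xxxx algebra_simps)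
  have "(\<Sum>A\<in>Pow {..<Suc n}. (\<Sum>i<Suc n. rsign A i * b i) ^ 4)
      = (\<Sum>A\<in>Pow {..<n}. 2 * (\<Sum>i<n. rsign A i * b i) ^ 4 + 12 * (b n)\<^sup>2 * (\<Sum>i<n. rsign A i * b i)\<^sup>2 + 2 * (b n) ^ 4)"
    unfolding sum_Pow_lessThan_Suc
    by (rule sum.cong) (auto simp only: Pow_iff rademacher_sum_insert p4)
  also have "\<dots> = 2 * (\<Sum>A\<in>Pow {..<n}. (\<Sum>i<n. rsign A i * b i) ^ 4)
      + 12 * (b n)\<^sup>2 * (2 ^ n * ?q) + 2 ^ n * (2 * (b n) ^ 4)"
    by (simp add: sum.distrib sum_distrib_left[symmetric] rademacher_second_moment card_Pow)
  also have "\<dots> \<le> 2 * (2 ^ n * (3 * ?q\<^sup>2)) + 12 * (b n)\<^sup>2 * (2 ^ n * ?q) + 2 ^ n * (6 * (b n) ^ 4)"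
    by (intro add_mono mult_left_mono Suc order_refl) auto
  also have "\<dots> = 2 ^ Suc n * (3 * (?q + (b n)\<^sup>2)\<^sup>2)"
    by (simp add: power2_eq_square power4_eq_xxxx algebra_simps)
  finally show ?case by simp
qed simp

text \<open>Reflecting all signs after the first passage over the level \<open>c\<close> is an involution that preserves
  the passage time; one of the two final sums then exceeds the level.\<close>

lemma levy_reflection_count:
  fixes b :: "nat \<Rightarrow> real" and J :: "real \<Rightarrow> nat set"
  assumes T: "finite T" and mono: "\<And>t t'. t \<in> T \<Longrightarrow> t' \<in> T \<Longrightarrow> t \<le> t' \<Longrightarrow> J t \<subseteq> J t'"
    and U: "\<And>t. t \<in> T \<Longrightarrow> J t \<subseteq> U" "U \<subseteq> {..<n}"
  shows "card {A \<in> Pow {..<n}. \<exists>t\<in>T. \<bar>\<Sum>i\<in>J t. rsign A i * b i\<bar> > c}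
       \<le> 2 * card {A \<in> Pow {..<n}. \<bar>\<Sum>i\<in>U. rsign A i * b i\<bar> > c}"
proof -
  define S where "S A t = (\<Sum>i\<in>J t. rsign A i * b i)" for A t
  define SU where "SU A = (\<Sum>i\<in>U. rsign A i * b i)" for A
  define H where "H A = {t\<in>T. \<bar>S A t\<bar> > c}" for A
  define \<tau> where "\<tau> A = Min (H A)" for A
  define flip where "flip A = sym_diff A ({..<n} - J (\<tau> A))" for A
  define B where "B = {A \<in> Pow {..<n}. \<exists>t\<in>T. \<bar>S A t\<bar> > c}"
  define G where "G = {A \<in> Pow {..<n}. \<bar>SU A\<bar> > c}"
  have finH: "finite (H A)" for A using T by (simp add: H_def)
  have \<tau>_in: "\<tau> A \<in> T" "\<bar>S A (\<tau> A)\<bar> > c" if "A \<in> B" for A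
  proof -
    have "H A \<noteq> {}" using that by (auto simp: B_def H_def)
    then have "\<tau> A \<in> H A" unfolding \<tau>_def using finH by simp
    then show "\<tau> A \<in> T" "\<bar>S A (\<tau> A)\<bar> > c" by (auto simp: H_def)
  qed
  have S_flip: "S (flip A) t = S A t" if "A \<in> B" "t \<in> T" "t \<le> \<tau> A" for A t
    unfolding S_def
  proof (rule sum.cong)
    fix i assume "i \<in> J t"
    then have "i \<in> J (\<tau> A)" using mono \<tau>_in that by blast
    then show "rsign (flip A) i * b i = rsign A i * b i" by (auto simp: rsign_def flip_def)
  qed simp
  have flip_B: "flip A \<in> B" if "A \<in> B" for A
  proof -
    have "\<bar>S (flip A) (\<tau> A)\<bar> > c" using S_flip[OF that] \<tau>_in[OF that] by simp
    moreover have "flip A \<subseteq> {..<n}" using that by (auto simp: flip_def B_def)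
    ultimately show ?thesis using \<tau>_in[OF that] by (auto simp: B_def)
  qed
  have \<tau>_flip: "\<tau> (flip A) = \<tau> A" if "A \<in> B" for A
  proof (rule antisym)
    have "\<tau> A \<in> H (flip A)" using S_flip[OF that] \<tau>_in[OF that] by (simp add: H_def)
    then show 1: "\<tau> (flip A) \<le> \<tau> A" unfolding \<tau>_def[of "flip A"] using finH by simp
    have "\<tau> (flip A) \<in> H A"
      using S_flip[OF that, of "\<tau> (flip A)"] \<tau>_in[OF flip_B[OF that]] 1 by (simp add: H_def)
    then show "\<tau> A \<le> \<tau> (flip A)" unfolding \<tau>_def[of A] using finH by simp
  qed
  have flip_flip: "flip (flip A) = A" if "A \<in> B" for A
    using \<tau>_flip[OF that] unfolding flip_def[of "flip A"] by (auto simp: flip_def)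
  have refl: "SU A + SU (flip A) = 2 * S A (\<tau> A)" if "A \<in> B" for A
  proof -
    have sub: "J (\<tau> A) \<subseteq> U" using U(1) \<tau>_in[OF that] by auto
    have "SU A + SU (flip A) = (\<Sum>i\<in>U. (rsign A i + rsign (flip A) i) * b i)"
      by (simp add: SU_def sum.distrib distrib_right)
    also have "\<dots> = (\<Sum>i\<in>J (\<tau> A). 2 * (rsign A i * b i))"
    proof (rule sum.mono_neutral_cong_right)
      show "finite U" using U(2) finite_subset by blast
    qed (use sub U(2) in \<open>auto simp: rsign_def flip_def\<close>)
    finally show ?thesis by (simp add: S_def sum_distrib_left)
  qed
  have sub: "B \<subseteq> (B \<inter> G) \<union> flip ` (B \<inter> G)"
  proof
    fix A assume A: "A \<in> B"
    have "\<bar>SU A\<bar> > c \<or> \<bar>SU (flip A)\<bar> > c"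
      using refl[OF A] \<tau>_in(2)[OF A] by linarith
    then have "A \<in> G \<or> flip A \<in> G" using A flip_B[OF A] by (auto simp: G_def B_def)
    then show "A \<in> (B \<inter> G) \<union> flip ` (B \<inter> G)"
      using A flip_B[OF A] flip_flip[OF A] by (auto intro!: image_eqI[of _ _ "flip A"])
  qed
  have finG: "finite G" by (simp add: G_def)
  have "card B \<le> card ((B \<inter> G) \<union> flip ` (B \<inter> G))" using sub finG by (intro card_mono) auto
  also have "\<dots> \<le> card (B \<inter> G) + card (flip ` (B \<inter> G))" by (rule card_Un_le)
  also have "\<dots> \<le> card (B \<inter> G) + card (B \<inter> G)" using finG by (simp add: card_image_le)
  also have "\<dots> \<le> 2 * card G" using card_mono[OF finG, of "B \<inter> G"] by simp
  finally show ?thesis by (simp add: B_def G_def S_def SU_def)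
qed

lemma rademacher_maximal_count:
  fixes x y :: "nat \<Rightarrow> real"
  assumes T: "finite T" "T \<subseteq> {..u}" and c: "c > 0"
  shows "real (card {A \<in> Pow {..<n}. \<exists>t\<in>T. \<bar>\<Sum>i<n. rsign A i * (y i * of_bool (s < x i \<and> x i \<le> t))\<bar> > c})
     \<le> 2 ^ n * (6 * (\<Sum>i<n. (y i * of_bool (s < x i \<and> x i \<le> u))\<^sup>2)\<^sup>2 / c ^ 4)"
proof -
  define J where "J t = {i\<in>{..<n}. s < x i \<and> x i \<le> t}" for t
  define b where "b i = y i * of_bool (s < x i \<and> x i \<le> u)" for i
  have eq: "(\<Sum>i<n. rsign A i * (y i * of_bool (s < x i \<and> x i \<le> t))) = (\<Sum>i\<in>J t. rsign A i * y i)" for A t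
    by (rule sum.mono_neutral_cong_right) (auto simp: J_def)
  have "card {A \<in> Pow {..<n}. \<exists>t\<in>T. \<bar>\<Sum>i\<in>J t. rsign A i * y i\<bar> > c}
       \<le> 2 * card {A \<in> Pow {..<n}. \<bar>\<Sum>i\<in>J u. rsign A i * y i\<bar> > c}"
    by (rule levy_reflection_count) (use T in \<open>auto simp: J_def\<close>)
  then have 1: "real (card {A \<in> Pow {..<n}. \<exists>t\<in>T. \<bar>\<Sum>i<n. rsign A i * (y i * of_bool (s < x i \<and> x i \<le> t))\<bar> > c})
       \<le> 2 * real (card {A \<in> Pow {..<n}. \<bar>\<Sum>i<n. rsign A i * b i\<bar> > c})"
    unfolding eq b_def by linarith
  let ?G = "{A \<in> Pow {..<n}. \<bar>\<Sum>i<n. rsign A i * b i\<bar> > c}"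
  have "c ^ 4 * real (card ?G) = (\<Sum>A\<in>?G. c ^ 4)" by simp
  also have "\<dots> \<le> (\<Sum>A\<in>?G. (\<Sum>i<n. rsign A i * b i) ^ 4)"
  proof (rule sum_mono)
    fix A assume "A \<in> ?G"
    then have "c ^ 4 \<le> \<bar>\<Sum>i<n. rsign A i * b i\<bar> ^ 4" using c by (intro power_mono) auto
    then show "c ^ 4 \<le> (\<Sum>i<n. rsign A i * b i) ^ 4" by (simp add: power_even_abs)
  qed
  also have "\<dots> \<le> (\<Sum>A\<in>Pow {..<n}. (\<Sum>i<n. rsign A i * b i) ^ 4)"
    by (rule sum_mono2) auto
  also have "\<dots> \<le> 2 ^ n * (3 * (\<Sum>i<n. (b i)\<^sup>2)\<^sup>2)" by (rule rademacher_fourth_moment)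
  finally have "real (card ?G) \<le> 2 ^ n * (3 * (\<Sum>i<n. (b i)\<^sup>2)\<^sup>2) / c ^ 4"
    using c by (simp add: field_simps)
  then have "2 * real (card ?G) \<le> 2 * (2 ^ n * (3 * (\<Sum>i<n. (b i)\<^sup>2)\<^sup>2) / c ^ 4)" by simp
  with 1 show ?thesis unfolding b_def by (simp add: mult_ac)
qed

section \<open>Samples of independent marked points\<close>

locale marked_sample = prob_space M for M :: "'a measure" +
  fixes X Y :: "nat \<Rightarrow> 'a \<Rightarrow> real"
  assumes indep: "indep_vars (\<lambda>_. borel :: (real \<times> real) measure) (\<lambda>i \<omega>. (X i \<omega>, Y i \<omega>)) UNIV"
    and ident: "\<And>i. distr M (borel :: (real \<times> real) measure) (\<lambda>\<omega>. (X i \<omega>, Y i \<omega>))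
                  = distr M borel (\<lambda>\<omega>. (X 0 \<omega>, Y 0 \<omega>))"
    and sq_int: "integrable M (\<lambda>\<omega>. (Y 0 \<omega>)\<^sup>2)"
    and no_atoms: "\<And>t. prob {\<omega> \<in> space M. X 0 \<omega> = t} = 0"
begin

definition W :: "nat \<Rightarrow> 'a \<Rightarrow> real \<times> real" where
  "W i \<omega> = (X i \<omega>, Y i \<omega>)"

lemma W_meas [measurable]: "W i \<in> borel_measurable M"
  using indep unfolding indep_vars_def2 W_def by simp

lemma X_meas [measurable]: "X i \<in> borel_measurable M"
  using measurable_compose[OF W_meas[of i] borel_measurable_continuous_onI[OF continuous_on_fst[OF continuous_on_id]]]
  by (simp add: W_def)

lemma Y_meas [measurable]: "Y i \<in> borel_measurable M"
  using measurable_compose[OF W_meas[of i] borel_measurable_continuous_onI[OF continuous_on_snd[OF continuous_on_id]]]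
  by (simp add: W_def)

lemma indep_W: "indep_vars (\<lambda>_. borel) W UNIV"
  using indep by (simp add: W_def[abs_def])

lemma distr_W: "distr M borel (W i) = distr M borel (W 0)"
  using ident[of i] by (simp add: W_def[abs_def])

lemma integral_W:
  fixes \<phi> :: "real \<times> real \<Rightarrow> real"
  assumes [measurable]: "\<phi> \<in> borel_measurable borel"
  shows "(\<integral>\<omega>. \<phi> (W i \<omega>) \<partial>M) = (\<integral>\<omega>. \<phi> (W 0 \<omega>) \<partial>M)"
    "integrable M (\<lambda>\<omega>. \<phi> (W i \<omega>)) \<longleftrightarrow> integrable M (\<lambda>\<omega>. \<phi> (W 0 \<omega>))"
proof -
  have "(\<integral>\<omega>. \<phi> (W i \<omega>) \<partial>M) = (\<integral>x. \<phi> x \<partial>distr M borel (W i))" for i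
    by (simp add: integral_distr)
  then show "(\<integral>\<omega>. \<phi> (W i \<omega>) \<partial>M) = (\<integral>\<omega>. \<phi> (W 0 \<omega>) \<partial>M)" using distr_W[of i] by simp
  have "integrable M (\<lambda>\<omega>. \<phi> (W i \<omega>)) \<longleftrightarrow> integrable (distr M borel (W i)) \<phi>" for i
    by (simp add: integrable_distr_eq)
  then show "integrable M (\<lambda>\<omega>. \<phi> (W i \<omega>)) \<longleftrightarrow> integrable M (\<lambda>\<omega>. \<phi> (W 0 \<omega>))" using distr_W[of i] by simp
qed

lemma prob_reindex:
  fixes Q :: "(nat \<Rightarrow> real \<times> real) \<Rightarrow> bool"
  assumes \<tau>: "inj \<tau>" and [measurable]: "Measurable.pred (PiM UNIV (\<lambda>_::nat. borel)) Q"
  shows "prob {\<omega> \<in> space M. Q (\<lambda>i. W (\<tau> i) \<omega>)} = prob {\<omega> \<in> space M. Q (\<lambda>i. W i \<omega>)}"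
proof -
  let ?P = "PiM (UNIV :: nat set) (\<lambda>_. borel :: (real \<times> real) measure)"
  have *: "prob {\<omega> \<in> space M. Q (\<lambda>i. W (\<sigma> i) \<omega>)} = measure (PiM UNIV (\<lambda>_::nat. distr M borel (W 0))) {w \<in> space ?P. Q w}"
    if "inj \<sigma>" for \<sigma>
  proof -
    let ?D = "distr M borel (W 0)"
    interpret D: prob_space ?D by (rule prob_space_distr) simp
    have m: "(\<lambda>\<omega> i. W (\<rho> i) \<omega>) \<in> measurable M ?P" for \<rho>
      using measurable_restrict[of UNIV "\<lambda>i. W (\<rho> i)" M "\<lambda>_. borel"] by (simp add: restrict_UNIV)
    have "distr M ?P (\<lambda>\<omega>. \<lambda>i\<in>UNIV. W i \<omega>) = PiM UNIV (\<lambda>i. distr M borel (W i))"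
      by (rule iffD1[OF indep_vars_iff_distr_eq_PiM indep_W]) auto
    then have 1: "distr M ?P (\<lambda>\<omega> i. W i \<omega>) = PiM UNIV (\<lambda>_::nat. ?D)"
      unfolding ext[where f="\<lambda>i. distr M borel (W i)" and g="\<lambda>_. ?D", OF distr_W] by (simp add: restrict_UNIV)
    have sets_eq: "sets (PiM UNIV (\<lambda>_::nat. ?D)) = sets ?P" by (rule sets_PiM_cong) auto
    have "(\<lambda>w. \<lambda>i\<in>UNIV. w (\<sigma> i)) \<in> measurable ?P ?P" by (rule measurable_restrict) measurable
    then have m2: "(\<lambda>w i. w (\<sigma> i)) \<in> measurable ?P ?P" by (simp add: restrict_UNIV)
    have "distr M ?P (\<lambda>\<omega> i. W (\<sigma> i) \<omega>) = distr (distr M ?P (\<lambda>\<omega> i. W i \<omega>)) ?P (\<lambda>w i. w (\<sigma> i))"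
      by (subst distr_distr[OF m2 m]) (simp add: comp_def)
    also have "\<dots> = distr (PiM UNIV (\<lambda>_. ?D)) (PiM UNIV (\<lambda>_. ?D)) (\<lambda>w i. w (\<sigma> i))"
      unfolding 1 by (rule distr_cong) (auto simp: sets_eq)
    also have "\<dots> = PiM UNIV (\<lambda>_::nat. ?D)"
      using distr_PiM_reindex[of UNIV "\<lambda>_. ?D" \<sigma> UNIV] that D.prob_space_axioms by (simp add: restrict_UNIV)
    finally have 2: "distr M ?P (\<lambda>\<omega> i. W (\<sigma> i) \<omega>) = PiM UNIV (\<lambda>_::nat. ?D)" .
    have "measure (distr M ?P (\<lambda>\<omega> i. W (\<sigma> i) \<omega>)) {w \<in> space ?P. Q w} =
        prob ((\<lambda>\<omega> i. W (\<sigma> i) \<omega>) -` {w \<in> space ?P. Q w} \<inter> space M)"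
      by (rule measure_distr[OF m]) measurable
    also have "(\<lambda>\<omega> i. W (\<sigma> i) \<omega>) -` {w \<in> space ?P. Q w} \<inter> space M = {\<omega> \<in> space M. Q (\<lambda>i. W (\<sigma> i) \<omega>)}"
      using measurable_space[OF m] by auto
    finally show ?thesis by (simp add: 2)
  qed
  show ?thesis using *[OF \<tau>] *[OF inj_on_id] by simp
qed

lemma prob_indep_blocks:
  assumes "A \<inter> B = {}" and [measurable]: "Measurable.pred (PiM A (\<lambda>_. borel)) Q" "Measurable.pred (PiM B (\<lambda>_. borel)) R"
  shows "prob {\<omega> \<in> space M. Q (\<lambda>i\<in>A. W i \<omega>) \<and> R (\<lambda>i\<in>B. W i \<omega>)}
       = prob {\<omega> \<in> space M. Q (\<lambda>i\<in>A. W i \<omega>)} * prob {\<omega> \<in> space M. R (\<lambda>i\<in>B. W i \<omega>)}"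
proof -
  let ?S = "\<lambda>A Q. {w \<in> space (PiM A (\<lambda>_::nat. borel :: (real \<times> real) measure)). Q w}"
  have m: "(\<lambda>\<omega>. \<lambda>i\<in>C. W i \<omega>) \<in> measurable M (PiM C (\<lambda>_. borel))" for C
    by (rule measurable_restrict) simp
  have eq: "(\<lambda>\<omega>. \<lambda>i\<in>C. W i \<omega>) -` ?S C Q' \<inter> space M = {\<omega> \<in> space M. Q' (\<lambda>i\<in>C. W i \<omega>)}" for C Q'
    using measurable_space[OF m[of C]] by auto
  have "prob ((\<lambda>\<omega>. (\<lambda>i\<in>A. W i \<omega>, \<lambda>i\<in>B. W i \<omega>)) -` (?S A Q \<times> ?S B R) \<inter> space M)
      = prob ((\<lambda>\<omega>. \<lambda>i\<in>A. W i \<omega>) -` ?S A Q \<inter> space M) * prob ((\<lambda>\<omega>. \<lambda>i\<in>B. W i \<omega>) -` ?S B R \<inter> space M)"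
    by (rule indep_varD[OF indep_var_restrict[OF indep_W assms(1)]]) auto
  moreover have "(\<lambda>\<omega>. (\<lambda>i\<in>A. W i \<omega>, \<lambda>i\<in>B. W i \<omega>)) -` (?S A Q \<times> ?S B R) \<inter> space M
      = {\<omega> \<in> space M. Q (\<lambda>i\<in>A. W i \<omega>) \<and> R (\<lambda>i\<in>B. W i \<omega>)}"
    using measurable_space[OF m[of A]] measurable_space[OF m[of B]] by auto
  ultimately show ?thesis by (simp only: eq)
qed

lemma sum_second_moment:
  fixes \<phi> :: "real \<times> real \<Rightarrow> real"
  assumes [measurable]: "\<phi> \<in> borel_measurable borel" and sq: "integrable M (\<lambda>\<omega>. (\<phi> (W 0 \<omega>))\<^sup>2)"
    and I: "finite I"
  defines "m \<equiv> (\<integral>\<omega>. \<phi> (W 0 \<omega>) \<partial>M)"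
  shows "integrable M (\<lambda>\<omega>. (\<Sum>i\<in>I. \<phi> (W i \<omega>) - m)\<^sup>2)"
    "(\<integral>\<omega>. (\<Sum>i\<in>I. \<phi> (W i \<omega>) - m)\<^sup>2 \<partial>M) \<le> card I * (\<integral>\<omega>. (\<phi> (W 0 \<omega>))\<^sup>2 \<partial>M)"
proof -
  define D where "D i \<omega> = \<phi> (W i \<omega>) - m" for i \<omega>
  have int0: "integrable M (\<lambda>\<omega>. \<phi> (W 0 \<omega>))"
    by (rule square_integrable_imp_integrable[OF _ sq]) simp
  have sq2: "integrable M (\<lambda>\<omega>. (\<phi> (W 0 \<omega>) - m)\<^sup>2)"
    using sq int0 by (simp add: power2_diff)
  have i1: "integrable M (\<lambda>\<omega>. \<phi> (W i \<omega>))" "integrable M (\<lambda>\<omega>. (\<phi> (W i \<omega>) - m)\<^sup>2)" for i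
    using integral_W(2)[of \<phi> i] integral_W(2)[of "\<lambda>x. (\<phi> x - m)\<^sup>2" i] int0 sq2 by auto
  have mean: "(\<integral>\<omega>. D i \<omega> \<partial>M) = 0" for i
    using i1 integral_W(1)[of \<phi> i] by (simp add: D_def m_def prob_space)
  have Dint: "integrable M (D i)" "integrable M (\<lambda>\<omega>. (D i \<omega>)\<^sup>2)" for i using i1 by (auto simp: D_def[abs_def])
  have var: "(\<integral>\<omega>. (D i \<omega>)\<^sup>2 \<partial>M) \<le> (\<integral>\<omega>. (\<phi> (W 0 \<omega>))\<^sup>2 \<partial>M)" for i
  proof -
    have "(\<integral>\<omega>. (D i \<omega>)\<^sup>2 \<partial>M) = (\<integral>\<omega>. (\<phi> (W 0 \<omega>) - m)\<^sup>2 \<partial>M)"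
      using integral_W(1)[of "\<lambda>x. (\<phi> x - m)\<^sup>2" i] by (simp add: D_def)
    also have "\<dots> = (\<integral>\<omega>. (\<phi> (W 0 \<omega>))\<^sup>2 \<partial>M) - m\<^sup>2"
      using variance_eq[OF int0 sq] by (simp add: m_def)
    finally show ?thesis by simp
  qed
  have cross: "integrable M (\<lambda>\<omega>. D i \<omega> * D j \<omega>)" "(\<integral>\<omega>. D i \<omega> * D j \<omega> \<partial>M) = 0" if "i \<noteq> j" for i j
  proof -
    have "indep_var (PiM {i} (\<lambda>_. borel)) (\<lambda>\<omega>. \<lambda>i\<in>{i}. W i \<omega>) (PiM {j} (\<lambda>_. borel)) (\<lambda>\<omega>. \<lambda>i\<in>{j}. W i \<omega>)"
      by (rule indep_var_restrict[OF indep_W]) (use that in auto)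
    then have "indep_var borel ((\<lambda>w. \<phi> (w i) - m) \<circ> (\<lambda>\<omega>. \<lambda>i\<in>{i}. W i \<omega>)) borel ((\<lambda>w. \<phi> (w j) - m) \<circ> (\<lambda>\<omega>. \<lambda>i\<in>{j}. W i \<omega>))"
      by (rule indep_var_compose) auto
    then have id: "indep_var borel (D i) borel (D j)" by (simp add: comp_def D_def[abs_def])
    show "integrable M (\<lambda>\<omega>. D i \<omega> * D j \<omega>)" by (rule indep_var_integrable[OF id Dint(1) Dint(1)])
    show "(\<integral>\<omega>. D i \<omega> * D j \<omega> \<partial>M) = 0" using indep_var_lebesgue_integral[OF id Dint(1) Dint(1)] mean by simp
  qed
  have sqsum: "(\<Sum>i\<in>I. \<phi> (W i \<omega>) - m)\<^sup>2 = (\<Sum>i\<in>I. \<Sum>j\<in>I. D i \<omega> * D j \<omega>)" for \<omega>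
    by (simp add: D_def power2_eq_square sum_product)
  have int: "integrable M (\<lambda>\<omega>. D i \<omega> * D j \<omega>)" for i j
    using cross(1)[of i j] Dint(2)[of i] by (cases "i = j") (auto simp: power2_eq_square)
  then show "integrable M (\<lambda>\<omega>. (\<Sum>i\<in>I. \<phi> (W i \<omega>) - m)\<^sup>2)" unfolding sqsum by simp
  have "(\<integral>\<omega>. (\<Sum>i\<in>I. \<phi> (W i \<omega>) - m)\<^sup>2 \<partial>M) = (\<Sum>i\<in>I. \<Sum>j\<in>I. (\<integral>\<omega>. D i \<omega> * D j \<omega> \<partial>M))"
    unfolding sqsum using int by (simp add: Bochner_Integration.integral_sum)
  also have "\<dots> = (\<Sum>i\<in>I. \<Sum>j\<in>I. if j = i then (\<integral>\<omega>. (D i \<omega>)\<^sup>2 \<partial>M) else 0)"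
    by (intro sum.cong) (auto simp: cross power2_eq_square)
  also have "\<dots> = (\<Sum>i\<in>I. (\<integral>\<omega>. (D i \<omega>)\<^sup>2 \<partial>M))" using I by simp
  also have "\<dots> \<le> (\<Sum>i\<in>I. (\<integral>\<omega>. (\<phi> (W 0 \<omega>))\<^sup>2 \<partial>M))" by (rule sum_mono[OF var])
  finally show "(\<integral>\<omega>. (\<Sum>i\<in>I. \<phi> (W i \<omega>) - m)\<^sup>2 \<partial>M) \<le> card I * (\<integral>\<omega>. (\<phi> (W 0 \<omega>))\<^sup>2 \<partial>M)" by simp
qed

lemma sum_chebyshev:
  fixes \<phi> :: "real \<times> real \<Rightarrow> real"
  assumes [measurable]: "\<phi> \<in> borel_measurable borel" and sq: "integrable M (\<lambda>\<omega>. (\<phi> (W 0 \<omega>))\<^sup>2)"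
    and I: "finite I" and x: "x > 0"
  shows "prob {\<omega> \<in> space M. \<bar>\<Sum>i\<in>I. \<phi> (W i \<omega>) - (\<integral>\<omega>. \<phi> (W 0 \<omega>) \<partial>M)\<bar> \<ge> x}
     \<le> card I * (\<integral>\<omega>. (\<phi> (W 0 \<omega>))\<^sup>2 \<partial>M) / x\<^sup>2"
proof -
  let ?Z = "\<lambda>\<omega>. \<Sum>i\<in>I. \<phi> (W i \<omega>) - (\<integral>\<omega>. \<phi> (W 0 \<omega>) \<partial>M)"
  have "prob {\<omega> \<in> space M. \<bar>?Z \<omega>\<bar> \<ge> x} = prob {\<omega> \<in> space M. (?Z \<omega>)\<^sup>2 \<ge> x\<^sup>2}"
    using x by (intro arg_cong[where f=prob] Collect_cong conj_cong refl) (auto simp: abs_le_square_iff[symmetric])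
  also have "\<dots> \<le> (\<integral>\<omega>. (?Z \<omega>)\<^sup>2 \<partial>M) / x\<^sup>2"
    by (rule integral_Markov_inequality_measure[where A="{}"]) (use x sum_second_moment(1)[OF assms(1-3)] in auto)
  also have "\<dots> \<le> card I * (\<integral>\<omega>. (\<phi> (W 0 \<omega>))\<^sup>2 \<partial>M) / x\<^sup>2"
    by (intro divide_right_mono sum_second_moment(2)[OF assms(1-3)]) auto
  finally show ?thesis .
qed

end

section \<open>The maximal inequality\<close>

definition cell_mark :: "real \<Rightarrow> real \<Rightarrow> real \<times> real \<Rightarrow> real" where
  "cell_mark s t w = snd w * of_bool (s < fst w \<and> fst w \<le> t)"

lemma cell_mark_meas [measurable]: "cell_mark s t \<in> borel_measurable borel"
  unfolding cell_mark_def[abs_def] borel_prod[symmetric] by measurable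

lemma cell_mark_sq_mono: "t \<le> u \<Longrightarrow> (cell_mark s t w)\<^sup>2 \<le> (cell_mark s u w)\<^sup>2"
  by (auto simp: cell_mark_def)

context marked_sample
begin

lemma cell_mark_sq_int: "integrable M (\<lambda>\<omega>. (cell_mark s t (W 0 \<omega>))\<^sup>2)"
  by (rule Bochner_Integration.integrable_bound[OF sq_int]) (auto simp: cell_mark_def W_def)

lemma symmetrization:
  assumes T: "finite T" "T \<subseteq> {..u}" and x: "x > 0"
    and small: "8 * (real n * (\<integral>\<omega>. (cell_mark s u (W 0 \<omega>))\<^sup>2 \<partial>M)) \<le> x\<^sup>2"
  shows "prob {\<omega> \<in> space M. \<exists>t\<in>T. \<bar>\<Sum>i<n. cell_mark s t (W i \<omega>) - (\<integral>\<omega>. cell_mark s t (W 0 \<omega>) \<partial>M)\<bar> > x}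
    \<le> 2 * prob {\<omega> \<in> space M. \<exists>t\<in>T. \<bar>\<Sum>i<n. cell_mark s t (W i \<omega>) - cell_mark s t (W (n + i) \<omega>)\<bar> > x / 2}"
proof -
  define e where "e t = (\<integral>\<omega>. cell_mark s t (W 0 \<omega>) \<partial>M)" for t
  define z where "z I t w = (\<Sum>i\<in>I. cell_mark s t (w i) - e t)" for I :: "nat set" and t and w :: "nat \<Rightarrow> real \<times> real"
  have z_meas[measurable]: "z I t \<in> borel_measurable (PiM I (\<lambda>_. borel))" for I t
    unfolding z_def[abs_def] by measurable
  define A where "A = {..<n}"
  define B where "B = {n..<2*n}"
  define first where "first t w \<longleftrightarrow> \<bar>z A t w\<bar> > x \<and> (\<forall>t'\<in>T. t' < t \<longrightarrow> \<bar>z A t' w\<bar> \<le> x)" for t w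
  have first_meas[measurable]: "Measurable.pred (PiM A (\<lambda>_. borel)) (first t)" for t
    unfolding first_def[abs_def] using T(1) by measurable
  have z_restrict: "z I t (\<lambda>i\<in>I. W i \<omega>) = z I t (\<lambda>i. W i \<omega>)" for I t \<omega>
    by (simp add: z_def)
  have first_restrict: "first t (\<lambda>i\<in>A. W i \<omega>) = first t (\<lambda>i. W i \<omega>)" for t \<omega>
    by (simp add: first_def z_restrict)
  have Wm: "(\<lambda>\<omega>. \<lambda>i\<in>C. W i \<omega>) \<in> measurable M (PiM C (\<lambda>_. borel))" for C
    by (rule measurable_restrict) simp
  have zW[measurable]: "(\<lambda>\<omega>. z I t (\<lambda>i. W i \<omega>)) \<in> borel_measurable M" for I t
    using measurable_compose[OF Wm z_meas] by (simp add: z_restrict)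
  have firstW[measurable]: "Measurable.pred M (\<lambda>\<omega>. first t (\<lambda>i. W i \<omega>))" for t
    using measurable_compose[OF Wm first_meas] by (simp add: first_restrict)
  let ?E = "\<lambda>t. {\<omega> \<in> space M. first t (\<lambda>i. W i \<omega>)}"
  let ?D = "{\<omega> \<in> space M. \<exists>t\<in>T. \<bar>z A t (\<lambda>i. W i \<omega>) - z B t (\<lambda>i. W i \<omega>)\<bar> > x / 2}"
  have half: "prob {\<omega> \<in> space M. \<bar>z B t (\<lambda>i. W i \<omega>)\<bar> \<le> x / 2} \<ge> 1 / 2" if "t \<in> T" for t
  proof -
    have "prob {\<omega> \<in> space M. \<bar>z B t (\<lambda>i. W i \<omega>)\<bar> \<ge> x / 2} \<le> card B * (\<integral>\<omega>. (cell_mark s t (W 0 \<omega>))\<^sup>2 \<partial>M) / (x/2)\<^sup>2"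
      unfolding z_def e_def by (rule sum_chebyshev) (use x in \<open>auto simp: B_def cell_mark_sq_int\<close>)
    also have "\<dots> \<le> card B * (\<integral>\<omega>. (cell_mark s u (W 0 \<omega>))\<^sup>2 \<partial>M) / (x/2)\<^sup>2"
      using that T(2) by (intro divide_right_mono mult_left_mono integral_mono cell_mark_sq_int cell_mark_sq_mono) auto
    also have "\<dots> \<le> 1 / 2" using small x by (simp add: B_def field_simps power2_eq_square)
    finally have *: "prob {\<omega> \<in> space M. \<bar>z B t (\<lambda>i. W i \<omega>)\<bar> \<ge> x / 2} \<le> 1 / 2" .
    have "prob {\<omega> \<in> space M. \<not> \<bar>z B t (\<lambda>i. W i \<omega>)\<bar> \<ge> x / 2} = 1 - prob {\<omega> \<in> space M. \<bar>z B t (\<lambda>i. W i \<omega>)\<bar> \<ge> x / 2}"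
      by (rule prob_neg) measurable
    moreover have "prob {\<omega> \<in> space M. \<not> \<bar>z B t (\<lambda>i. W i \<omega>)\<bar> \<ge> x / 2} \<le> prob {\<omega> \<in> space M. \<bar>z B t (\<lambda>i. W i \<omega>)\<bar> \<le> x / 2}"
      by (rule finite_measure_mono) auto
    ultimately show ?thesis using * by linarith
  qed
  have "prob {\<omega> \<in> space M. \<exists>t\<in>T. \<bar>z A t (\<lambda>i. W i \<omega>)\<bar> > x} \<le> prob (\<Union>t\<in>T. ?E t)"
  proof (rule finite_measure_mono)
    show "(\<Union>t\<in>T. ?E t) \<in> events" by (intro sets.finite_UN T(1)) measurable
    show "{\<omega> \<in> space M. \<exists>t\<in>T. \<bar>z A t (\<lambda>i. W i \<omega>)\<bar> > x} \<subseteq> (\<Union>t\<in>T. ?E t)"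
    proof clarify
      fix \<omega> t assume \<omega>: "\<omega> \<in> space M" and t: "t \<in> T" "\<bar>z A t (\<lambda>i. W i \<omega>)\<bar> > x"
      define H where "H = {t\<in>T. \<bar>z A t (\<lambda>i. W i \<omega>)\<bar> > x}"
      have H: "finite H" "H \<noteq> {}" using T t by (auto simp: H_def)
      have "Min H \<in> H" by (rule Min_in[OF H])
      moreover have "\<bar>z A t' (\<lambda>i. W i \<omega>)\<bar> \<le> x" if "t' \<in> T" "t' < Min H" for t'
      proof (rule ccontr)
        assume "\<not> ?thesis"
        then have "t' \<in> H" using that by (auto simp: H_def)
        then show False using Min_le[OF H(1)] that(2) by force
      qed
      ultimately show "\<omega> \<in> (\<Union>t\<in>T. ?E t)" using \<omega> by (auto simp: first_def H_def)
    qed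
  qed
  also have "\<dots> = (\<Sum>t\<in>T. prob (?E t))"
  proof (rule finite_measure_finite_Union)
    show "disjoint_family_on ?E T"
    unfolding disjoint_family_on_def
    proof (intro ballI impI)
      fix t t' assume tt: "t \<in> T" "t' \<in> T" "t \<noteq> t'"
      have "\<not> (first t w \<and> first t' w)" for w
        using tt by (cases "t < t'") (force simp: first_def)+
      then show "?E t \<inter> ?E t' = {}" by auto
    qed
  qed (use T(1) in auto)
  also have "\<dots> \<le> (\<Sum>t\<in>T. 2 * prob (?E t \<inter> ?D))"
  proof (rule sum_mono)
    fix t assume t: "t \<in> T"
    have "prob (?E t) * (1/2) \<le> prob (?E t) * prob {\<omega> \<in> space M. \<bar>z B t (\<lambda>i. W i \<omega>)\<bar> \<le> x / 2}"
      by (intro mult_left_mono half t) simp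
    also have "\<dots> = prob {\<omega> \<in> space M. first t (\<lambda>i. W i \<omega>) \<and> \<bar>z B t (\<lambda>i. W i \<omega>)\<bar> \<le> x / 2}"
    proof -
      have "A \<inter> B = {}" by (auto simp: A_def B_def)
      then show ?thesis using prob_indep_blocks[of A B "first t" "\<lambda>w. \<bar>z B t w\<bar> \<le> x / 2"]
        by (simp add: first_restrict z_restrict)
    qed
    also have "\<dots> \<le> prob (?E t \<inter> ?D)"
    proof (rule finite_measure_mono)
      show "?E t \<inter> ?D \<in> events" using T(1) by measurable
      show "{\<omega> \<in> space M. first t (\<lambda>i. W i \<omega>) \<and> \<bar>z B t (\<lambda>i. W i \<omega>)\<bar> \<le> x / 2} \<subseteq> ?E t \<inter> ?D"
      proof clarify
        fix \<omega> assume \<omega>: "\<omega> \<in> space M" "first t (\<lambda>i. W i \<omega>)" and b: "\<bar>z B t (\<lambda>i. W i \<omega>)\<bar> \<le> x / 2"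
        have a: "\<bar>z A t (\<lambda>i. W i \<omega>)\<bar> > x" using \<omega>(2) by (simp add: first_def)
        have "\<bar>z A t (\<lambda>i. W i \<omega>) - z B t (\<lambda>i. W i \<omega>)\<bar> > x / 2" using a b by linarith
        then show "\<omega> \<in> ?E t \<inter> ?D" using \<omega> t by blast
      qed
    qed
    finally show "prob (?E t) \<le> 2 * prob (?E t \<inter> ?D)" by simp
  qed
  also have "\<dots> = 2 * (\<Sum>t\<in>T. prob (?E t \<inter> ?D))" by (simp add: sum_distrib_left)
  also have "(\<Sum>t\<in>T. prob (?E t \<inter> ?D)) = prob (\<Union>t\<in>T. ?E t \<inter> ?D)"
  proof (rule finite_measure_finite_Union[symmetric])
    show "disjoint_family_on (\<lambda>t. ?E t \<inter> ?D) T"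
    unfolding disjoint_family_on_def
    proof (intro ballI impI)
      fix t t' assume tt: "t \<in> T" "t' \<in> T" "t \<noteq> t'"
      have "\<not> (first t w \<and> first t' w)" for w
        using tt by (cases "t < t'") (force simp: first_def)+
      then show "(?E t \<inter> ?D) \<inter> (?E t' \<inter> ?D) = {}" by auto
    qed
    show "(\<lambda>t. ?E t \<inter> ?D) ` T \<subseteq> events" using T(1) by auto
  qed (use T(1) in auto)
  also have "prob (\<Union>t\<in>T. ?E t \<inter> ?D) \<le> prob ?D"
    by (rule finite_measure_mono) (use T(1) in auto)
  finally have main: "prob {\<omega> \<in> space M. \<exists>t\<in>T. \<bar>z A t (\<lambda>i. W i \<omega>)\<bar> > x} \<le> 2 * prob ?D" by simp
  have "z A t w - z B t w = (\<Sum>i<n. cell_mark s t (w i) - cell_mark s t (w (n + i)))" for t w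
  proof -
    have "z B t w = (\<Sum>i<n. cell_mark s t (w (n + i)) - e t)"
      unfolding z_def B_def by (rule sum.reindex_bij_witness[of _ "\<lambda>i. n + i" "\<lambda>i. i - n"]) auto
    then show ?thesis by (simp add: z_def A_def sum_subtractf)
  qed
  with main show ?thesis by (simp add: z_def A_def e_def)
qed

text \<open>Exchanging the observations \<open>i\<close> and \<open>n + i\<close> for all \<open>i \<in> A\<close> preserves the joint law and
  flips the signs of the corresponding summands.\<close>

lemma sign_randomization:
  assumes T: "finite T"
  shows "prob {\<omega> \<in> space M. \<exists>t\<in>T. \<bar>\<Sum>i<n. cell_mark s t (W i \<omega>) - cell_mark s t (W (n + i) \<omega>)\<bar> > c}
    \<le> 2 * prob {\<omega> \<in> space M. \<exists>t\<in>T. \<bar>\<Sum>i<n. rsign A i * cell_mark s t (W i \<omega>)\<bar> > c / 2}"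
proof -
  define \<tau> where "\<tau> i = (if i < n \<and> i \<in> A then n + i else if n \<le> i \<and> i < 2 * n \<and> i - n \<in> A then i - n else i)" for i
  have "inj \<tau>"
  proof (rule inj_on_inverseI[where g=\<tau>])
    show "\<tau> (\<tau> i) = i" for i by (auto simp: \<tau>_def)
  qed
  note [measurable] = T
  let ?Q = "\<lambda>w. \<exists>t\<in>T. \<bar>\<Sum>i<n. cell_mark s t (w i) - cell_mark s t (w (n + i))\<bar> > c"
  let ?R = "\<lambda>w. \<exists>t\<in>T. \<bar>\<Sum>i<n. rsign A i * cell_mark s t (w i)\<bar> > c / 2"
  have "prob {\<omega> \<in> space M. ?Q (\<lambda>i. W i \<omega>)} = prob {\<omega> \<in> space M. ?Q (\<lambda>i. W (\<tau> i) \<omega>)}"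
    by (rule prob_reindex[symmetric, OF \<open>inj \<tau>\<close>]) (use T in measurable)
  also have "\<dots> \<le> prob ({\<omega> \<in> space M. ?R (\<lambda>i. W i \<omega>)} \<union> {\<omega> \<in> space M. ?R (\<lambda>i. W (n + i) \<omega>)})"
  proof (rule finite_measure_mono)
    show "{\<omega> \<in> space M. ?R (\<lambda>i. W i \<omega>)} \<union> {\<omega> \<in> space M. ?R (\<lambda>i. W (n + i) \<omega>)} \<in> events"
      using T by measurable
    show "{\<omega> \<in> space M. ?Q (\<lambda>i. W (\<tau> i) \<omega>)} \<subseteq> {\<omega> \<in> space M. ?R (\<lambda>i. W i \<omega>)} \<union> {\<omega> \<in> space M. ?R (\<lambda>i. W (n + i) \<omega>)}"
    proof clarify
      fix \<omega> t assume \<omega>: "\<omega> \<in> space M" "\<not> ?R (\<lambda>i. W (n + i) \<omega>)" and t: "t \<in> T"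
        and gt: "\<bar>\<Sum>i<n. cell_mark s t (W (\<tau> i) \<omega>) - cell_mark s t (W (\<tau> (n + i)) \<omega>)\<bar> > c"
      have "(\<Sum>i<n. cell_mark s t (W (\<tau> i) \<omega>) - cell_mark s t (W (\<tau> (n + i)) \<omega>))
         = (\<Sum>i<n. rsign A i * cell_mark s t (W i \<omega>) - rsign A i * cell_mark s t (W (n + i) \<omega>))"
        by (rule sum.cong) (auto simp: \<tau>_def rsign_def)
      then have "c < \<bar>(\<Sum>i<n. rsign A i * cell_mark s t (W i \<omega>)) - (\<Sum>i<n. rsign A i * cell_mark s t (W (n + i) \<omega>))\<bar>"
        using gt by (simp add: sum_subtractf)
      moreover have "\<bar>\<Sum>i<n. rsign A i * cell_mark s t (W (n + i) \<omega>)\<bar> \<le> c / 2" using \<omega>(2) t by force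
      ultimately have "\<bar>\<Sum>i<n. rsign A i * cell_mark s t (W i \<omega>)\<bar> > c / 2" by linarith
      then show "\<exists>t\<in>T. \<bar>\<Sum>i<n. rsign A i * cell_mark s t (W i \<omega>)\<bar> > c / 2" using t by blast
    qed
  qed
  also have "\<dots> \<le> prob {\<omega> \<in> space M. ?R (\<lambda>i. W i \<omega>)} + prob {\<omega> \<in> space M. ?R (\<lambda>i. W (n + i) \<omega>)}"
    by (rule measure_Un_le) (use T in measurable)
  also have "prob {\<omega> \<in> space M. ?R (\<lambda>i. W (n + i) \<omega>)} = prob {\<omega> \<in> space M. ?R (\<lambda>i. W i \<omega>)}"
    by (rule prob_reindex) (use T in \<open>auto intro: injI\<close>)
  finally show ?thesis by simp
qed

lemma maximal_inequality:
  assumes T: "finite T" "T \<subseteq> {..u}" and x: "x > 0" and K: "K \<ge> 0"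
    and small: "8 * (real n * (\<integral>\<omega>. (cell_mark s u (W 0 \<omega>))\<^sup>2 \<partial>M)) \<le> x\<^sup>2"
  shows "prob {\<omega> \<in> space M. \<exists>t\<in>T. \<bar>\<Sum>i<n. cell_mark s t (W i \<omega>) - (\<integral>\<omega>. cell_mark s t (W 0 \<omega>) \<partial>M)\<bar> > x}
    \<le> 4 * prob {\<omega> \<in> space M. (\<Sum>i<n. (cell_mark s u (W i \<omega>))\<^sup>2) > K} + 6144 * K\<^sup>2 / x ^ 4"
proof -
  let ?D = "{\<omega> \<in> space M. \<exists>t\<in>T. \<bar>\<Sum>i<n. cell_mark s t (W i \<omega>) - cell_mark s t (W (n + i) \<omega>)\<bar> > x / 2}"
  define E where "E A = {\<omega> \<in> space M. \<exists>t\<in>T. \<bar>\<Sum>i<n. rsign A i * cell_mark s t (W i \<omega>)\<bar> > x / 4}" for A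
  let ?B = "{\<omega> \<in> space M. (\<Sum>i<n. (cell_mark s u (W i \<omega>))\<^sup>2) > K}"
  have [measurable]: "E A \<in> events" for A unfolding E_def using T by measurable
  have "2 ^ n * prob ?D = (\<Sum>A\<in>Pow {..<n}. prob ?D)" by (simp add: card_Pow)
  also have "\<dots> \<le> (\<Sum>A\<in>Pow {..<n}. 2 * prob (E A))"
    using sign_randomization[OF T(1), where c="x / 2" and n=n and s=s] by (intro sum_mono) (simp add: E_def)
  also have "\<dots> = 2 * (\<integral>\<omega>. (\<Sum>A\<in>Pow {..<n}. indicator (E A) \<omega>) \<partial>M)"
    by (subst Bochner_Integration.integral_sum) (auto simp: sum_distrib_left emeasure_eq_measure sets.Int_space_eq2)
  also have "\<dots> \<le> 2 * (\<integral>\<omega>. 2 ^ n * indicator ?B \<omega> + 2 ^ n * (6 * K\<^sup>2 / (x / 4) ^ 4) \<partial>M)"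
  proof (intro mult_left_mono integral_mono)
    fix \<omega> assume \<omega>: "\<omega> \<in> space M"
    let ?G = "{A \<in> Pow {..<n}. \<exists>t\<in>T. \<bar>\<Sum>i<n. rsign A i * cell_mark s t (W i \<omega>)\<bar> > x / 4}"
    have eq: "(\<Sum>A\<in>Pow {..<n}. indicator (E A) \<omega>) = real (card ?G)"
      using \<omega> by (simp add: E_def indicator_def sum.If_cases Int_def)
    show "(\<Sum>A\<in>Pow {..<n}. indicator (E A) \<omega>) \<le> 2 ^ n * indicator ?B \<omega> + 2 ^ n * (6 * K\<^sup>2 / (x / 4) ^ 4)"
    proof (cases "\<omega> \<in> ?B")
      case True
      have "card ?G \<le> card (Pow {..<n})" by (rule card_mono) auto
      then have "real (card ?G) \<le> 2 ^ n" by (simp add: card_Pow)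
      moreover have "(0::real) \<le> 2 ^ n * (6 * K\<^sup>2 / (x / 4) ^ 4)" by simp
      moreover have "indicator ?B \<omega> = (1::real)" using True by simp
      ultimately show ?thesis unfolding eq by (simp only:)
    next
      case False
      have "real (card ?G) \<le> 2 ^ n * (6 * (\<Sum>i<n. (cell_mark s u (W i \<omega>))\<^sup>2)\<^sup>2 / (x / 4) ^ 4)"
        unfolding cell_mark_def by (rule rademacher_maximal_count) (use T x in auto)
      also have "\<dots> \<le> 2 ^ n * (6 * K\<^sup>2 / (x / 4) ^ 4)"
        using False \<omega> by (intro mult_left_mono divide_right_mono power_mono) (auto intro: sum_nonneg)
      finally show ?thesis unfolding eq using False by simp
    qed
  qed (auto simp: emeasure_eq_measure)
  also have "\<dots> = 2 ^ n * (2 * prob ?B + 2 * (6 * K\<^sup>2 / (x / 4) ^ 4))"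
    by (subst Bochner_Integration.integral_add) (auto simp: prob_space emeasure_eq_measure algebra_simps)
  finally have "prob ?D \<le> 2 * prob ?B + 2 * (6 * K\<^sup>2 / (x / 4) ^ 4)" by simp
  then have "prob {\<omega> \<in> space M. \<exists>t\<in>T. \<bar>\<Sum>i<n. cell_mark s t (W i \<omega>) - (\<integral>\<omega>. cell_mark s t (W 0 \<omega>) \<partial>M)\<bar> > x}
     \<le> 2 * (2 * prob ?B + 2 * (6 * K\<^sup>2 / (x / 4) ^ 4))"
    by (intro order_trans[OF symmetrization[OF T x small]] mult_left_mono) auto
  then show ?thesis by (simp add: power_divide)
qed

end

context marked_sample
begin

lemma truncated_law_of_large_numbers:
  fixes \<phi> :: "real \<times> real \<Rightarrow> real"
  assumes [measurable]: "\<phi> \<in> borel_measurable borel" and nonneg: "\<And>w. \<phi> w \<ge> 0"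
    and int: "integrable M (\<lambda>\<omega>. \<phi> (W 0 \<omega>))" and \<kappa>: "(\<integral>\<omega>. \<phi> (W 0 \<omega>) \<partial>M) \<le> \<kappa>" "\<kappa> > 0" and \<eta>: "\<eta> > 0"
  shows "\<exists>n0. \<forall>n\<ge>n0. prob {\<omega> \<in> space M. (\<Sum>i<n. \<phi> (W i \<omega>)) > 2 * \<kappa> * real n} \<le> \<eta>"
proof -
  define \<psi> where "\<psi> c w = \<phi> w * of_bool (\<phi> w \<le> c)" for c w
  have [measurable]: "\<psi> c \<in> borel_measurable borel" for c unfolding \<psi>_def[abs_def] by measurable
  have \<psi>_le: "0 \<le> \<psi> c w" "\<psi> c w \<le> \<phi> w" for c w using nonneg by (auto simp: \<psi>_def)
  have "(\<lambda>k. \<integral>\<omega>. \<phi> (W 0 \<omega>) - \<psi> (real k) (W 0 \<omega>) \<partial>M) \<longlonglongrightarrow> (\<integral>\<omega>. 0 \<partial>M)"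
  proof (rule integral_dominated_convergence)
    show "integrable M (\<lambda>\<omega>. \<phi> (W 0 \<omega>))" by fact
    show "AE \<omega> in M. (\<lambda>k. \<phi> (W 0 \<omega>) - \<psi> (real k) (W 0 \<omega>)) \<longlonglongrightarrow> 0"
    proof (rule AE_I2)
      fix \<omega>
      obtain k0 :: nat where "\<phi> (W 0 \<omega>) \<le> real k0" using real_arch_simple by blast
      then have "eventually (\<lambda>k. \<phi> (W 0 \<omega>) - \<psi> (real k) (W 0 \<omega>) = 0) sequentially"
        by (auto simp: eventually_sequentially \<psi>_def intro!: exI[of _ k0])
      then show "(\<lambda>k. \<phi> (W 0 \<omega>) - \<psi> (real k) (W 0 \<omega>)) \<longlonglongrightarrow> 0" by (rule tendsto_eventually)
    qed
    show "AE \<omega> in M. norm (\<phi> (W 0 \<omega>) - \<psi> (real k) (W 0 \<omega>)) \<le> \<phi> (W 0 \<omega>)" for k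
      using \<psi>_le by (intro AE_I2) (auto simp: abs_le_iff intro: order_trans[OF _ add_increasing2] )
  qed auto
  then have "eventually (\<lambda>k. (\<integral>\<omega>. \<phi> (W 0 \<omega>) - \<psi> (real k) (W 0 \<omega>) \<partial>M) < \<eta> * \<kappa> / 4) sequentially"
    by (rule order_tendstoD) (use \<eta> \<kappa> in simp)
  then obtain k where k: "(\<integral>\<omega>. \<phi> (W 0 \<omega>) - \<psi> (real k) (W 0 \<omega>) \<partial>M) < \<eta> * \<kappa> / 4"
    by (auto simp: eventually_sequentially)
  define c where "c = real k"
  have \<psi>_c: "\<psi> c w \<le> c" for w by (auto simp: \<psi>_def c_def)
  have int\<psi>: "integrable M (\<lambda>\<omega>. \<psi> c (W 0 \<omega>))"
    by (rule Bochner_Integration.integrable_bound[OF int]) (use \<psi>_le nonneg in auto)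
  have sq\<psi>: "(\<psi> c w)\<^sup>2 \<le> c\<^sup>2" for w using \<psi>_le \<psi>_c by (intro power_mono) auto
  have intsq: "integrable M (\<lambda>\<omega>. (\<psi> c (W 0 \<omega>))\<^sup>2)"
    by (rule integrable_const_bound[where B="c\<^sup>2"]) (use sq\<psi> in auto)
  have E\<psi>: "(\<integral>\<omega>. \<psi> c (W 0 \<omega>) \<partial>M) \<le> \<kappa>"
    using integral_mono[OF int\<psi> int] \<psi>_le \<kappa>(1) by fastforce
  have intd: "integrable M (\<lambda>\<omega>. \<phi> (W i \<omega>) - \<psi> c (W i \<omega>))" for i
    using integral_W(2)[of "\<lambda>w. \<phi> w - \<psi> c w" i] int int\<psi> by simp
  have bound: "prob {\<omega> \<in> space M. (\<Sum>i<n. \<phi> (W i \<omega>)) > 2 * \<kappa> * real n} \<le> \<eta> / 2 + 4 * c\<^sup>2 / \<kappa>\<^sup>2 / real n" if n: "n > 0" for n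
  proof -
    let ?x = "\<kappa> * real n / 2"
    have x: "?x > 0" using \<kappa> n by simp
    let ?A = "{\<omega> \<in> space M. (\<Sum>i<n. \<phi> (W i \<omega>) - \<psi> c (W i \<omega>)) \<ge> ?x}"
    let ?B = "{\<omega> \<in> space M. \<bar>\<Sum>i\<in>{..<n}. \<psi> c (W i \<omega>) - (\<integral>\<omega>. \<psi> c (W 0 \<omega>) \<partial>M)\<bar> \<ge> ?x}"
    have nn: "0 \<le> (\<Sum>i<n. \<phi> (W i \<omega>) - \<psi> c (W i \<omega>))" for \<omega>
      by (intro sum_nonneg) (simp add: \<psi>_le)
    have "prob ?A \<le> (\<integral>\<omega>. (\<Sum>i<n. \<phi> (W i \<omega>) - \<psi> c (W i \<omega>)) \<partial>M) / ?x"
      by (rule integral_Markov_inequality_measure[where A="{}"]) (use x intd nn in auto)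
    also have "(\<integral>\<omega>. (\<Sum>i<n. \<phi> (W i \<omega>) - \<psi> c (W i \<omega>)) \<partial>M) = real n * (\<integral>\<omega>. \<phi> (W 0 \<omega>) - \<psi> c (W 0 \<omega>) \<partial>M)"
    proof -
      have "(\<integral>\<omega>. \<phi> (W i \<omega>) - \<psi> c (W i \<omega>) \<partial>M) = (\<integral>\<omega>. \<phi> (W 0 \<omega>) - \<psi> c (W 0 \<omega>) \<partial>M)" for i
        using integral_W(1)[of "\<lambda>w. \<phi> w - \<psi> c w" i] by simp
      then have "(\<Sum>i<n. \<integral>\<omega>. \<phi> (W i \<omega>) - \<psi> c (W i \<omega>) \<partial>M) = (\<Sum>i<n. \<integral>\<omega>. \<phi> (W 0 \<omega>) - \<psi> c (W 0 \<omega>) \<partial>M)"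
        by (intro sum.cong refl)
      then show ?thesis using intd by (subst Bochner_Integration.integral_sum) (simp_all only: sum_constant card_lessThan)
    qed
    also have "\<dots> / ?x \<le> real n * (\<eta> * \<kappa> / 4) / ?x"
      using k x by (intro divide_right_mono mult_left_mono) (auto simp: c_def)
    also have "\<dots> = \<eta> / 2" using n \<kappa> by (simp add: field_simps)
    finally have PA: "prob ?A \<le> \<eta> / 2" .
    have "prob {\<omega> \<in> space M. (\<Sum>i<n. \<phi> (W i \<omega>)) > 2 * \<kappa> * real n} \<le> prob (?A \<union> ?B)"
    proof (rule finite_measure_mono)
      show "{\<omega> \<in> space M. (\<Sum>i<n. \<phi> (W i \<omega>)) > 2 * \<kappa> * real n} \<subseteq> ?A \<union> ?B"
      proof clarify
        fix \<omega> assume gt: "(\<Sum>i<n. \<phi> (W i \<omega>)) > 2 * \<kappa> * real n" and \<omega>: "\<omega> \<in> space M" "\<not> \<bar>\<Sum>i<n. \<psi> c (W i \<omega>) - (\<integral>\<omega>. \<psi> c (W 0 \<omega>) \<partial>M)\<bar> \<ge> ?x"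
        have "(\<Sum>i<n. \<phi> (W i \<omega>)) = (\<Sum>i<n. \<phi> (W i \<omega>) - \<psi> c (W i \<omega>)) + (\<Sum>i<n. \<psi> c (W i \<omega>) - (\<integral>\<omega>. \<psi> c (W 0 \<omega>) \<partial>M))
            + real n * (\<integral>\<omega>. \<psi> c (W 0 \<omega>) \<partial>M)"
          by (simp add: sum_subtractf)
        moreover have "real n * (\<integral>\<omega>. \<psi> c (W 0 \<omega>) \<partial>M) \<le> real n * \<kappa>" using E\<psi> by (intro mult_left_mono) auto
        ultimately show "(\<Sum>i<n. \<phi> (W i \<omega>) - \<psi> c (W i \<omega>)) \<ge> ?x" using gt \<omega>(2)
          by (simp add: mult.commute[of \<kappa>] mult.assoc)
      qed
    qed measurable
    also have "\<dots> \<le> prob ?A + prob ?B" by (rule measure_Un_le) measurable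
    also have "prob ?A \<le> \<eta> / 2" by (rule PA)
    also have "prob ?B \<le> card {..<n} * (\<integral>\<omega>. (\<psi> c (W 0 \<omega>))\<^sup>2 \<partial>M) / ?x\<^sup>2"
      by (rule sum_chebyshev) (use intsq x in auto)
    also have "\<dots> \<le> card {..<n} * c\<^sup>2 / ?x\<^sup>2"
    proof (intro divide_right_mono mult_left_mono)
      have "(\<integral>\<omega>. (\<psi> c (W 0 \<omega>))\<^sup>2 \<partial>M) \<le> (\<integral>\<omega>. c\<^sup>2 \<partial>M)" using intsq sq\<psi> by (intro integral_mono) auto
      then show "(\<integral>\<omega>. (\<psi> c (W 0 \<omega>))\<^sup>2 \<partial>M) \<le> c\<^sup>2" by (simp add: prob_space)
    qed auto
    also have "\<dots> = 4 * c\<^sup>2 / \<kappa>\<^sup>2 / real n" using n \<kappa> by (simp add: field_simps power2_eq_square)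
    finally show ?thesis by simp
  qed
  obtain n0 :: nat where n0: "real n0 \<ge> 4 * c\<^sup>2 / \<kappa>\<^sup>2 / (\<eta> / 2)" using real_arch_simple by blast
  show ?thesis
  proof (intro exI[of _ "Suc n0"] allI impI)
    fix n assume n: "Suc n0 \<le> n"
    then have "4 * c\<^sup>2 / \<kappa>\<^sup>2 / (\<eta> / 2) \<le> real n" using n0 by linarith
    moreover have "real n > 0" "\<eta> / 2 > 0" using n \<eta> by auto
    ultimately have "4 * c\<^sup>2 / \<kappa>\<^sup>2 / real n \<le> \<eta> / 2"
      by (simp only: pos_divide_le_eq mult.commute)
    then show "prob {\<omega> \<in> space M. (\<Sum>i<n. \<phi> (W i \<omega>)) > 2 * \<kappa> * real n} \<le> \<eta>"
      using bound[of n] n by linarith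
  qed
qed

lemma cell_mark_right_continuous:
  assumes "q \<longlonglongrightarrow> t" "\<And>k. q k \<ge> t"
  shows "(\<lambda>k. cell_mark s (q k) w) \<longlonglongrightarrow> cell_mark s t w"
proof (cases "fst w \<le> t")
  case True
  then have "cell_mark s (q k) w = cell_mark s t w" for k
    using assms(2)[of k] by (simp add: cell_mark_def)
  then show ?thesis by simp
next
  case False
  then have "eventually (\<lambda>k. q k < fst w) sequentially" using assms(1) by (intro order_tendstoD) auto
  then have "eventually (\<lambda>k. cell_mark s (q k) w = cell_mark s t w) sequentially"
    by eventually_elim (use False in \<open>simp add: cell_mark_def\<close>)
  then show ?thesis by (rule tendsto_eventually)
qed

lemma mark_integrable: "integrable M (\<lambda>\<omega>. \<bar>Y 0 \<omega>\<bar>)"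
  using square_integrable_imp_integrable[OF Y_meas sq_int] by simp

lemma cell_oscillation:
  assumes su: "s < u" and e: "e > 0" and \<kappa>: "\<kappa> > 0" "(\<integral>\<omega>. (cell_mark s u (W 0 \<omega>))\<^sup>2 \<partial>M) \<le> \<kappa>" "8 * \<kappa> \<le> e\<^sup>2" and \<eta>: "\<eta> > 0"
  shows "\<exists>n0. \<forall>n\<ge>n0. \<exists>E\<in>events. prob E \<le> \<eta> + 24576 * \<kappa>\<^sup>2 / e ^ 4 \<and>
    (\<forall>\<omega>\<in>space M - E. \<forall>t\<in>{s..u}. \<bar>\<Sum>i<n. cell_mark s t (W i \<omega>) - (\<integral>\<omega>. cell_mark s t (W 0 \<omega>) \<partial>M)\<bar> \<le> e * sqrt (real n))"
proof -
  have "\<exists>n0. \<forall>n\<ge>n0. prob {\<omega> \<in> space M. (\<Sum>i<n. (cell_mark s u (W i \<omega>))\<^sup>2) > 2 * \<kappa> * real n} \<le> \<eta> / 4"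
    by (rule truncated_law_of_large_numbers[where \<phi>="\<lambda>w. (cell_mark s u w)\<^sup>2"]) (use \<kappa> \<eta> cell_mark_sq_int in auto)
  then obtain n0 where n0: "\<And>n. n \<ge> n0 \<Longrightarrow> prob {\<omega> \<in> space M. (\<Sum>i<n. (cell_mark s u (W i \<omega>))\<^sup>2) > 2 * \<kappa> * real n} \<le> \<eta> / 4"
    by blast
  define z where "z n t \<omega> = (\<Sum>i<n. cell_mark s t (W i \<omega>) - (\<integral>\<omega>. cell_mark s t (W 0 \<omega>) \<partial>M))" for n t \<omega>
  have [measurable]: "z n t \<in> borel_measurable M" for n t unfolding z_def[abs_def] by measurable
  have z_s: "z n s \<omega> = 0" for n \<omega>
  proof -
    have "cell_mark s s w = 0" for w by (auto simp: cell_mark_def)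
    then show ?thesis by (simp add: z_def)
  qed
  define D where "D = insert u (\<rat> \<inter> {s<..<u})"
  have D: "countable D" "D \<noteq> {}" by (auto simp: D_def countable_rat)
  define d where "d = from_nat_into D"
  have d: "range d = D" unfolding d_def by (rule range_from_nat_into[OF D(2,1)])
  have z_right: "(\<lambda>k. z n (q k) \<omega>) \<longlonglongrightarrow> z n t \<omega>" if q: "q \<longlonglongrightarrow> t" "\<And>k. q k \<ge> t" for q t n \<omega>
    unfolding z_def
  proof (intro tendsto_sum tendsto_diff cell_mark_right_continuous q)
    show "(\<lambda>k. \<integral>\<omega>. cell_mark s (q k) (W 0 \<omega>) \<partial>M) \<longlonglongrightarrow> (\<integral>\<omega>. cell_mark s t (W 0 \<omega>) \<partial>M)"
    proof (rule integral_dominated_convergence[OF _ _ mark_integrable])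
      show "AE \<omega> in M. (\<lambda>k. cell_mark s (q k) (W 0 \<omega>)) \<longlonglongrightarrow> cell_mark s t (W 0 \<omega>)"
        by (intro AE_I2 cell_mark_right_continuous q)
      show "AE \<omega> in M. norm (cell_mark s (q k) (W 0 \<omega>)) \<le> \<bar>Y 0 \<omega>\<bar>" for k
        by (intro AE_I2) (auto simp: cell_mark_def W_def)
    qed auto
  qed
  show ?thesis
  proof (intro exI[of _ "Suc n0"] allI impI)
    fix n assume n: "Suc n0 \<le> n"
    define x where "x = e * sqrt (real n)"
    have x: "x > 0" using e n by (simp add: x_def)
    have x2: "x\<^sup>2 = e\<^sup>2 * real n" by (simp add: x_def power_mult_distrib)
    have x4: "x ^ 4 = e ^ 4 * (real n)\<^sup>2"
    proof -
      have "x ^ 4 = (x\<^sup>2)\<^sup>2" by (simp add: power2_eq_square power4_eq_xxxx)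
      then show ?thesis unfolding x2 by (simp add: power2_eq_square power4_eq_xxxx)
    qed
    define E where "E p = {\<omega> \<in> space M. \<exists>t\<in>d ` {..p}. \<bar>z n t \<omega>\<bar> > x}" for p :: nat
    have E[measurable]: "E p \<in> events" for p unfolding E_def by measurable
    have dle: "d p \<le> u" for p
    proof -
      have "d p \<in> D" using d by blast
      then show ?thesis using su by (auto simp: D_def)
    qed
    have small: "8 * (real n * (\<integral>\<omega>. (cell_mark s u (W 0 \<omega>))\<^sup>2 \<partial>M)) \<le> x\<^sup>2"
    proof -
      have "real n * (8 * (\<integral>\<omega>. (cell_mark s u (W 0 \<omega>))\<^sup>2 \<partial>M)) \<le> real n * e\<^sup>2"
        using \<kappa> by (intro mult_left_mono) auto
      then show ?thesis unfolding x2 by (simp add: algebra_simps)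
    qed
    have bound: "prob (E p) \<le> \<eta> + 24576 * \<kappa>\<^sup>2 / e ^ 4" for p
    proof -
      have "prob (E p) \<le> 4 * prob {\<omega> \<in> space M. (\<Sum>i<n. (cell_mark s u (W i \<omega>))\<^sup>2) > 2 * \<kappa> * real n}
          + 6144 * (2 * \<kappa> * real n)\<^sup>2 / x ^ 4"
        unfolding E_def z_def by (rule maximal_inequality) (use dle x \<kappa> small in auto)
      also have "\<dots> \<le> 4 * (\<eta> / 4) + 6144 * (2 * \<kappa> * real n)\<^sup>2 / x ^ 4"
        using n0[of n] n by (intro add_mono mult_left_mono) auto
      also have "6144 * (2 * \<kappa> * real n)\<^sup>2 / x ^ 4 = 24576 * \<kappa>\<^sup>2 / e ^ 4"
        using n e by (simp add: x4 power_mult_distrib)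
      finally show ?thesis by simp
    qed
    have "(\<lambda>p. prob (E p)) \<longlonglongrightarrow> prob (\<Union>p. E p)"
    proof (rule finite_Lim_measure_incseq)
      show "incseq E"
      proof (rule incseq_SucI)
        show "E p \<subseteq> E (Suc p)" for p by (auto simp: E_def atMost_Suc)
      qed
    qed auto
    then have PE: "prob (\<Union>p. E p) \<le> \<eta> + 24576 * \<kappa>\<^sup>2 / e ^ 4"
      using bound by (intro LIMSEQ_le_const2) auto
    show "\<exists>E\<in>events. prob E \<le> \<eta> + 24576 * \<kappa>\<^sup>2 / e ^ 4 \<and>
      (\<forall>\<omega>\<in>space M - E. \<forall>t\<in>{s..u}. \<bar>\<Sum>i<n. cell_mark s t (W i \<omega>) - (\<integral>\<omega>. cell_mark s t (W 0 \<omega>) \<partial>M)\<bar> \<le> e * sqrt (real n))"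
    proof (intro bexI[of _ "\<Union>p. E p"] conjI PE ballI)
      fix \<omega> t assume \<omega>: "\<omega> \<in> space M - (\<Union>p. E p)" and t: "t \<in> {s..u}"
      have good: "\<bar>z n t' \<omega>\<bar> \<le> x" if t': "t' \<in> D" for t'
      proof -
        obtain p where "t' = d p" using d t' by blast
        then show ?thesis using \<omega> by (force simp: E_def not_less)
      qed
      have "\<bar>z n t \<omega>\<bar> \<le> x"
      proof (cases "t = s \<or> t = u")
        case True
        then show ?thesis using z_s x good[of u] by (auto simp: D_def)
      next
        case False
        then have t': "s < t" "t < u" using t by auto
        have "\<exists>q. \<forall>k. q k \<in> \<rat> \<and> t < q k \<and> q k < min u (t + 1 / real (Suc k))"
        proof (intro choice allI)
          fix k :: nat
          show "\<exists>q. q \<in> \<rat> \<and> t < q \<and> q < min u (t + 1 / real (Suc k))"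
            using Rats_dense_in_real[of t "min u (t + 1 / real (Suc k))"] t' by auto
        qed
        then obtain q where q: "\<And>k. q k \<in> \<rat> \<and> t < q k \<and> q k < min u (t + 1 / real (Suc k))" by blast
        have qt: "q \<longlonglongrightarrow> t"
        proof (rule real_tendsto_sandwich)
          show "(\<lambda>k. t) \<longlonglongrightarrow> t" by simp
          show "(\<lambda>k. t + 1 / real (Suc k)) \<longlonglongrightarrow> t"
            using tendsto_add[OF tendsto_const[of t] LIMSEQ_inverse_real_of_nat] by (simp add: inverse_eq_divide)
          show "eventually (\<lambda>k. t \<le> q k) sequentially" "eventually (\<lambda>k. q k \<le> t + 1 / real (Suc k)) sequentially"
            using q by (auto intro!: always_eventually simp: less_imp_le)
        qed
        have "(\<lambda>k. z n (q k) \<omega>) \<longlonglongrightarrow> z n t \<omega>" by (rule z_right[OF qt]) (use q in \<open>auto intro: less_imp_le\<close>)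
        then have "(\<lambda>k. \<bar>z n (q k) \<omega>\<bar>) \<longlonglongrightarrow> \<bar>z n t \<omega>\<bar>" by (rule tendsto_rabs)
        moreover have "\<bar>z n (q k) \<omega>\<bar> \<le> x" for k
          using q[of k] t' by (intro good) (auto simp: D_def)
        ultimately show ?thesis by (intro LIMSEQ_le_const2) auto
      qed
      then show "\<bar>\<Sum>i<n. cell_mark s t (W i \<omega>) - (\<integral>\<omega>. cell_mark s t (W 0 \<omega>) \<partial>M)\<bar> \<le> e * sqrt (real n)"
        by (simp add: z_def x_def)
    qed auto
  qed
qed

end

section \<open>The marked empirical process\<close>

definition mark :: "real \<Rightarrow> real \<times> real \<Rightarrow> real" where
  "mark t w = snd w * of_bool (fst w \<le> t)"

lemma mark_meas [measurable]: "mark t \<in> borel_measurable borel"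
  unfolding mark_def[abs_def] borel_prod[symmetric] by measurable

lemma cell_mark_eq: "s \<le> t \<Longrightarrow> cell_mark s t w = mark t w - mark s w"
  by (auto simp: cell_mark_def mark_def)

context marked_sample
begin

definition mean_mark :: "real \<Rightarrow> real" where
  "mean_mark t = (\<integral>\<omega>. mark t (W 0 \<omega>) \<partial>M)"

definition emp_process :: "nat \<Rightarrow> 'a \<Rightarrow> real \<Rightarrow> real" where
  "emp_process n \<omega> t = 1 / sqrt (real n) * (\<Sum>i<n. mark t (W i \<omega>) - mean_mark t)"

lemma emp_process_meas [measurable]: "(\<lambda>\<omega>. emp_process n \<omega> t) \<in> borel_measurable M"
  unfolding emp_process_def by measurable

lemma mark_sq_int: "integrable M (\<lambda>\<omega>. (mark t (W 0 \<omega>))\<^sup>2)"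
  by (rule Bochner_Integration.integrable_bound[OF sq_int]) (auto simp: mark_def W_def)

lemma mark_int: "integrable M (\<lambda>\<omega>. mark t (W 0 \<omega>))"
  by (rule square_integrable_imp_integrable[OF _ mark_sq_int]) simp

lemma emp_process_increment:
  assumes "s \<le> t"
  shows "emp_process n \<omega> t - emp_process n \<omega> s
    = 1 / sqrt (real n) * (\<Sum>i<n. cell_mark s t (W i \<omega>) - (\<integral>\<omega>. cell_mark s t (W 0 \<omega>) \<partial>M))"
proof -
  have "(\<integral>\<omega>. cell_mark s t (W 0 \<omega>) \<partial>M) = mean_mark t - mean_mark s"
    unfolding cell_mark_eq[OF assms] mean_mark_def using mark_int by simp
  then show ?thesis
    unfolding emp_process_def cell_mark_eq[OF assms]
    by (simp only: right_diff_distrib[symmetric] sum_subtractf[symmetric]) (simp add: algebra_simps)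
qed

lemma emp_process_tail:
  assumes "R > 0"
  shows "prob {\<omega> \<in> space M. \<bar>emp_process n \<omega> t\<bar> \<ge> R} \<le> (\<integral>\<omega>. (Y 0 \<omega>)\<^sup>2 \<partial>M) / R\<^sup>2"
proof (cases "n = 0")
  case True
  then show ?thesis using assms by (simp add: emp_process_def)
next
  case False
  then have n: "sqrt (real n) > 0" by simp
  have "{\<omega> \<in> space M. \<bar>emp_process n \<omega> t\<bar> \<ge> R} =
      {\<omega> \<in> space M. \<bar>\<Sum>i\<in>{..<n}. mark t (W i \<omega>) - (\<integral>\<omega>. mark t (W 0 \<omega>) \<partial>M)\<bar> \<ge> R * sqrt (real n)}"
    using n by (auto simp: emp_process_def mean_mark_def abs_mult field_simps)
  also have "prob \<dots> \<le> card {..<n} * (\<integral>\<omega>. (mark t (W 0 \<omega>))\<^sup>2 \<partial>M) / (R * sqrt (real n))\<^sup>2"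
    by (rule sum_chebyshev) (use assms n mark_sq_int in auto)
  also have "\<dots> = (\<integral>\<omega>. (mark t (W 0 \<omega>))\<^sup>2 \<partial>M) / R\<^sup>2" using False assms by (simp add: power_mult_distrib)
  also have "\<dots> \<le> (\<integral>\<omega>. (Y 0 \<omega>)\<^sup>2 \<partial>M) / R\<^sup>2"
    by (intro divide_right_mono integral_mono mark_sq_int sq_int) (auto simp: mark_def W_def)
  finally show ?thesis .
qed

lemma variance_function_continuous:
  "continuous_on S (\<lambda>t. \<integral>\<omega>. (mark t (W 0 \<omega>))\<^sup>2 \<partial>M)"
  unfolding continuous_on_sequentially comp_def
proof (intro allI ballI impI, elim conjE)
  fix q :: "nat \<Rightarrow> real" and t assume q: "q \<longlonglongrightarrow> t"
  show "(\<lambda>k. \<integral>\<omega>. (mark (q k) (W 0 \<omega>))\<^sup>2 \<partial>M) \<longlonglongrightarrow> (\<integral>\<omega>. (mark t (W 0 \<omega>))\<^sup>2 \<partial>M)"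
  proof (rule integral_dominated_convergence[OF _ _ sq_int])
    have "{\<omega> \<in> space M. X 0 \<omega> = t} \<in> null_sets M"
      using no_atoms[of t] by (auto simp: null_sets_def emeasure_eq_measure)
    then have "AE \<omega> in M. X 0 \<omega> \<noteq> t" by (rule AE_I') auto
    then show "AE \<omega> in M. (\<lambda>k. (mark (q k) (W 0 \<omega>))\<^sup>2) \<longlonglongrightarrow> (mark t (W 0 \<omega>))\<^sup>2"
    proof eventually_elim
      case (elim \<omega>)
      have "eventually (\<lambda>k. mark (q k) (W 0 \<omega>) = mark t (W 0 \<omega>)) sequentially"
      proof (cases "X 0 \<omega> < t")
        case True
        show ?thesis using order_tendstoD(1)[OF q True] by (rule eventually_mono) (use True in \<open>simp add: mark_def W_def\<close>)
      next
        case False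
        then have *: "t < X 0 \<omega>" using elim by simp
        show ?thesis using order_tendstoD(2)[OF q *] by (rule eventually_mono) (use * in \<open>simp add: mark_def W_def\<close>)
      qed
      then show ?case by (intro tendsto_power tendsto_eventually)
    qed
    show "AE \<omega> in M. norm ((mark (q k) (W 0 \<omega>))\<^sup>2) \<le> (Y 0 \<omega>)\<^sup>2" for k
      by (intro AE_I2) (auto simp: mark_def W_def)
  qed auto
qed

lemma asymptotic_equicontinuity:
  assumes e: "e > 0" and \<eta>: "\<eta> > 0"
  shows "\<exists>k0. \<forall>k\<ge>k0. \<exists>n0. \<forall>n\<ge>n0. \<exists>E\<in>events. prob E \<le> \<eta> \<and>
    (\<forall>\<omega>\<in>space M - E. \<forall>t\<in>{0..1}. \<bar>emp_process n \<omega> t - emp_process n \<omega> (of_int \<lfloor>2 ^ k * t\<rfloor> / 2 ^ k)\<bar> \<le> e)"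
proof -
  define G where "G t = (\<integral>\<omega>. (mark t (W 0 \<omega>))\<^sup>2 \<partial>M)" for t
  define C where "C = (\<integral>\<omega>. (Y 0 \<omega>)\<^sup>2 \<partial>M)"
  have G_bd: "0 \<le> G t" "G t \<le> C" for t
    unfolding G_def C_def by (auto intro!: integral_mono[OF mark_sq_int sq_int]) (auto simp: mark_def W_def)
  have C0: "C \<ge> 0" by (simp add: C_def)
  have cell: "(\<integral>\<omega>. (cell_mark s u (W 0 \<omega>))\<^sup>2 \<partial>M) = G u - G s" if "s \<le> u" for s u
  proof -
    have "(cell_mark s u w)\<^sup>2 = (mark u w)\<^sup>2 - (mark s w)\<^sup>2" for w
      using that by (auto simp: cell_mark_def mark_def)
    then show ?thesis using mark_sq_int by (simp add: G_def)
  qed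
  define \<beta> where "\<beta> = min (e\<^sup>2 / 8) (\<eta> * e ^ 4 / (49152 * (C + 1)))"
  have \<beta>: "\<beta> > 0" using e \<eta> C0 by (simp add: \<beta>_def)
  have "uniformly_continuous_on {0..1} G"
    unfolding G_def by (intro compact_uniformly_continuous variance_function_continuous) simp
  then obtain \<delta> where \<delta>: "\<delta> > 0" "\<And>s t. s \<in> {0..1} \<Longrightarrow> t \<in> {0..1} \<Longrightarrow> dist t s < \<delta> \<Longrightarrow> dist (G t) (G s) < \<beta> / 2"
    unfolding uniformly_continuous_on_def using \<beta> by (metis half_gt_zero)
  obtain k0 where k0: "(1/2::real) ^ k0 < min \<delta> (\<beta> / 2)"
    using real_arch_pow_inv[of "min \<delta> (\<beta> / 2)" "1/2"] \<delta> \<beta> by auto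
  show ?thesis
  proof (rule exI[of _ k0], intro allI impI)
    fix k assume k: "k0 \<le> k"
    have "(1/2::real) ^ k \<le> (1/2) ^ k0" using k by (intro power_decreasing) auto
    then have k': "1 / 2 ^ k < \<delta>" "1 / 2 ^ k < \<beta> / 2" using k0 by (auto simp: power_divide)
    define s where "s j = real j / 2 ^ k" for j :: nat
    define \<kappa> where "\<kappa> j = G (s (Suc j)) - G (s j) + 1 / 2 ^ k" for j
    define N where "N = (2::nat) ^ k"
    have s_Suc: "s (Suc j) = s j + 1 / 2 ^ k" for j by (simp add: s_def field_simps)
    have s_le: "s j < s (Suc j)" for j by (simp add: s_Suc)
    have s_in: "s j \<in> {0..1}" if "j \<le> N" for j
    proof -
      have "real j \<le> real N" using that by simp
      then show ?thesis by (simp add: s_def N_def)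
    qed
    have G_mono: "G (s j) \<le> G (s (Suc j))" for j
      unfolding G_def using s_le[of j] by (intro integral_mono mark_sq_int) (auto simp: mark_def)
    have \<kappa>: "\<kappa> j > 0" "\<kappa> j \<le> \<beta>" if "j < N" for j
    proof -
      show "\<kappa> j > 0" using G_mono[of j] by (simp add: \<kappa>_def add_nonneg_pos)
      have "dist (G (s (Suc j))) (G (s j)) < \<beta> / 2"
        using that s_in[of j] s_in[of "Suc j"] k'(1) by (intro \<delta>(2)) (auto simp: s_Suc dist_real_def)
      then show "\<kappa> j \<le> \<beta>" using k'(2) by (simp add: \<kappa>_def dist_real_def abs_if split: if_splits)
    qed
    have sum_\<kappa>: "(\<Sum>j<N. \<kappa> j) \<le> C + 1"
    proof -
      have "(\<Sum>j<N. \<kappa> j) = (\<Sum>j<N. G (s (Suc j)) - G (s j)) + real N * (1 / 2 ^ k)"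
        by (simp add: \<kappa>_def sum.distrib)
      also have "(\<Sum>j<N. G (s (Suc j)) - G (s j)) = G (s N) - G (s 0)"
        by (rule sum_lessThan_telescope)
      also have "real N * (1 / 2 ^ k) = 1" by (simp add: N_def)
      finally show ?thesis using G_bd(2)[of "s N"] G_bd(1)[of "s 0"] by linarith
    qed
    have osc: "\<exists>n0. \<forall>n\<ge>n0. \<exists>E\<in>events. prob E \<le> \<eta> / (2 * real N) + 24576 * (\<kappa> j)\<^sup>2 / e ^ 4 \<and>
      (\<forall>\<omega>\<in>space M - E. \<forall>t\<in>{s j..s (Suc j)}. \<bar>\<Sum>i<n. cell_mark (s j) t (W i \<omega>) - (\<integral>\<omega>. cell_mark (s j) t (W 0 \<omega>) \<partial>M)\<bar> \<le> e * sqrt (real n))"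
      if j: "j < N" for j
    proof (rule cell_oscillation[OF s_le e \<kappa>(1)[OF j]])
      show "(\<integral>\<omega>. (cell_mark (s j) (s (Suc j)) (W 0 \<omega>))\<^sup>2 \<partial>M) \<le> \<kappa> j"
        using s_le[of j] by (simp add: cell \<kappa>_def)
      have "\<beta> \<le> e\<^sup>2 / 8" unfolding \<beta>_def by (rule min.cobounded1)
      then show "8 * \<kappa> j \<le> e\<^sup>2" using \<kappa>(2)[OF j] by simp
      show "\<eta> / (2 * real N) > 0" using \<eta> by (simp add: N_def)
    qed
    then obtain n1 where n1: "\<And>j n. j < N \<Longrightarrow> n \<ge> n1 j \<Longrightarrow> \<exists>E\<in>events. prob E \<le> \<eta> / (2 * real N) + 24576 * (\<kappa> j)\<^sup>2 / e ^ 4 \<and>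
      (\<forall>\<omega>\<in>space M - E. \<forall>t\<in>{s j..s (Suc j)}. \<bar>\<Sum>i<n. cell_mark (s j) t (W i \<omega>) - (\<integral>\<omega>. cell_mark (s j) t (W 0 \<omega>) \<partial>M)\<bar> \<le> e * sqrt (real n))"
      by metis
    show "\<exists>n0. \<forall>n\<ge>n0. \<exists>E\<in>events. prob E \<le> \<eta> \<and>
      (\<forall>\<omega>\<in>space M - E. \<forall>t\<in>{0..1}. \<bar>emp_process n \<omega> t - emp_process n \<omega> (of_int \<lfloor>2 ^ k * t\<rfloor> / 2 ^ k)\<bar> \<le> e)"
    proof (intro exI[of _ "\<Sum>j<N. n1 j"] allI impI)
      fix n assume n: "(\<Sum>j<N. n1 j) \<le> n"
      have "n1 j \<le> n" if "j < N" for j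
        using member_le_sum[of j "{..<N}" n1] that n by auto
      then have "\<forall>j\<in>{..<N}. \<exists>E. E \<in> events \<and> prob E \<le> \<eta> / (2 * real N) + 24576 * (\<kappa> j)\<^sup>2 / e ^ 4 \<and>
        (\<forall>\<omega>\<in>space M - E. \<forall>t\<in>{s j..s (Suc j)}. \<bar>\<Sum>i<n. cell_mark (s j) t (W i \<omega>) - (\<integral>\<omega>. cell_mark (s j) t (W 0 \<omega>) \<partial>M)\<bar> \<le> e * sqrt (real n))"
        using n1 by blast
      from bchoice[OF this] obtain E where E: "\<And>j. j < N \<Longrightarrow> E j \<in> events"
        "\<And>j. j < N \<Longrightarrow> prob (E j) \<le> \<eta> / (2 * real N) + 24576 * (\<kappa> j)\<^sup>2 / e ^ 4"
        "\<And>j \<omega> t. j < N \<Longrightarrow> \<omega> \<in> space M - E j \<Longrightarrow> t \<in> {s j..s (Suc j)} \<Longrightarrow>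
           \<bar>\<Sum>i<n. cell_mark (s j) t (W i \<omega>) - (\<integral>\<omega>. cell_mark (s j) t (W 0 \<omega>) \<partial>M)\<bar> \<le> e * sqrt (real n)"
        by blast
      have "prob (\<Union>j<N. E j) \<le> (\<Sum>j<N. prob (E j))"
        by (rule measure_UNION_le) (use E in auto)
      also have "\<dots> \<le> (\<Sum>j<N. \<eta> / (2 * real N) + 24576 * (\<kappa> j)\<^sup>2 / e ^ 4)"
        by (intro sum_mono E) simp
      also have "\<dots> = \<eta> / 2 + 24576 / e ^ 4 * (\<Sum>j<N. (\<kappa> j)\<^sup>2)"
        by (simp add: sum.distrib sum_distrib_left sum_divide_distrib N_def)
      also have "\<dots> \<le> \<eta> / 2 + 24576 / e ^ 4 * (\<beta> * (C + 1))"
      proof (intro add_left_mono mult_left_mono)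
        have "(\<Sum>j<N. (\<kappa> j)\<^sup>2) \<le> (\<Sum>j<N. \<beta> * \<kappa> j)"
          using \<kappa> by (intro sum_mono) (auto simp: power2_eq_square intro!: mult_right_mono less_imp_le)
        also have "\<dots> = \<beta> * (\<Sum>j<N. \<kappa> j)" by (simp add: sum_distrib_left)
        also have "\<dots> \<le> \<beta> * (C + 1)" using \<beta> sum_\<kappa> by (intro mult_left_mono) auto
        finally show "(\<Sum>j<N. (\<kappa> j)\<^sup>2) \<le> \<beta> * (C + 1)" .
      qed simp
      also have "24576 / e ^ 4 * (\<beta> * (C + 1)) \<le> 24576 / e ^ 4 * ((\<eta> * e ^ 4 / (49152 * (C + 1))) * (C + 1))"
        using C0 by (intro mult_left_mono mult_right_mono) (auto simp: \<beta>_def)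
      also have "\<dots> = \<eta> / 2"
      proof -
        have "24576 / x * ((\<eta> * x / (49152 * d)) * d) = \<eta> / 2" if "d \<noteq> 0" "x \<noteq> 0" for d x :: real
          using that by (simp add: field_simps)
        from this[of "C + 1" "e ^ 4"] show ?thesis using C0 e by simp
      qed
      finally have PE: "prob (\<Union>j<N. E j) \<le> \<eta>" by simp
      show "\<exists>E\<in>events. prob E \<le> \<eta> \<and>
        (\<forall>\<omega>\<in>space M - E. \<forall>t\<in>{0..1}. \<bar>emp_process n \<omega> t - emp_process n \<omega> (of_int \<lfloor>2 ^ k * t\<rfloor> / 2 ^ k)\<bar> \<le> e)"
      proof (intro bexI[of _ "\<Union>j<N. E j"] conjI PE ballI)
        show "(\<Union>j<N. E j) \<in> events" using E(1) by auto
        fix \<omega> t assume \<omega>: "\<omega> \<in> space M - (\<Union>j<N. E j)" and t: "t \<in> {0..1::real}"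
        define j where "j = nat \<lfloor>2 ^ k * t\<rfloor>"
        have j_int: "of_int \<lfloor>2 ^ k * t\<rfloor> = real j" using t by (simp add: j_def)
        have jt: "real j \<le> 2 ^ k * t" "2 ^ k * t < real j + 1" unfolding j_int[symmetric] by linarith+
        show "\<bar>emp_process n \<omega> t - emp_process n \<omega> (of_int \<lfloor>2 ^ k * t\<rfloor> / 2 ^ k)\<bar> \<le> e"
        proof (cases "t = 1")
          case True
          then show ?thesis using e by simp
        next
          case False
          then have "2 ^ k * t < 2 ^ k" using t by simp
          moreover have "real N = 2 ^ k" by (simp add: N_def)
          ultimately have "real j < real N" using jt(1) by linarith
          then have j: "j < N" by simp
          have tj: "t \<in> {s j..s (Suc j)}"
            using jt by (auto simp: s_def field_simps)
          have b: "\<bar>\<Sum>i<n. cell_mark (s j) t (W i \<omega>) - (\<integral>\<omega>. cell_mark (s j) t (W 0 \<omega>) \<partial>M)\<bar> \<le> e * sqrt (real n)"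
            using \<omega> j by (intro E(3)[OF j _ tj]) auto
          have "\<bar>emp_process n \<omega> t - emp_process n \<omega> (s j)\<bar> \<le> e"
          proof (cases "n = 0")
            case True then show ?thesis using e by (simp add: emp_process_def)
          next
            case False
            then show ?thesis using b tj
              by (subst emp_process_increment) (auto simp: abs_mult field_simps)
          qed
          then show ?thesis by (simp add: s_def j_int)
        qed
      qed
    qed
  qed
qed

lemma finite_dim_convergence:
  fixes t a :: "'i \<Rightarrow> real"
  assumes I: "finite I"
  defines "\<sigma> \<equiv> sqrt (\<integral>\<omega>. (\<Sum>j\<in>I. a j * (mark (t j) (W 0 \<omega>) - mean_mark (t j)))\<^sup>2 \<partial>M)"
  shows "(\<lambda>n. \<integral>\<omega>. cos ((\<Sum>j\<in>I. a j * emp_process n \<omega> (t j)) + b) \<partial>M)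
      \<longlonglongrightarrow> (\<integral>x. cos (x + b) \<partial>normal_law 0 \<sigma>)"
proof -
  define \<phi> where "\<phi> w = (\<Sum>j\<in>I. a j * (mark (t j) w - mean_mark (t j)))" for w
  have \<phi>m[measurable]: "\<phi> \<in> borel_measurable borel" unfolding \<phi>_def[abs_def] by measurable
  have lin: "(\<Sum>j\<in>I. a j * emp_process n \<omega> (t j)) = (\<Sum>i<n. \<phi> (W i \<omega>)) / sqrt (real n)" for n \<omega>
  proof -
    have "(\<Sum>j\<in>I. a j * emp_process n \<omega> (t j)) = (\<Sum>j\<in>I. \<Sum>i<n. a j * (mark (t j) (W i \<omega>) - mean_mark (t j))) / sqrt (real n)"
      by (simp add: emp_process_def sum_distrib_left sum_divide_distrib)
    also have "\<dots> = (\<Sum>i<n. \<phi> (W i \<omega>)) / sqrt (real n)" unfolding \<phi>_def by (subst sum.swap) simp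
    finally show ?thesis .
  qed
  have int0: "integrable M (\<lambda>\<omega>. \<phi> (W 0 \<omega>))" unfolding \<phi>_def using mark_int by simp
  have mean0: "(\<integral>\<omega>. \<phi> (W 0 \<omega>) \<partial>M) = 0"
    unfolding \<phi>_def using mark_int by (simp add: Bochner_Integration.integral_sum mean_mark_def prob_space)
  have sq0: "integrable M (\<lambda>\<omega>. (\<phi> (W 0 \<omega>))\<^sup>2)"
  proof -
    have "integrable M (\<lambda>\<omega>. (\<Sum>j\<in>J. a j * (mark (t j) (W 0 \<omega>) - mean_mark (t j)))\<^sup>2)" if "finite J" for J
      using that
    proof induction
      case (insert i J)
      let ?f = "\<lambda>\<omega>. a i * (mark (t i) (W 0 \<omega>) - mean_mark (t i))"
      let ?g = "\<lambda>\<omega>. \<Sum>j\<in>J. a j * (mark (t j) (W 0 \<omega>) - mean_mark (t j))"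
      have f: "integrable M (\<lambda>\<omega>. (?f \<omega>)\<^sup>2)"
        using mark_sq_int mark_int by (simp add: power_mult_distrib power2_diff)
      show ?case
      proof (rule Bochner_Integration.integrable_bound)
        show "integrable M (\<lambda>\<omega>. 2 * (?f \<omega>)\<^sup>2 + 2 * (?g \<omega>)\<^sup>2)" using f insert by simp
        have "(x + y)\<^sup>2 \<le> 2 * x\<^sup>2 + 2 * y\<^sup>2" for x y :: real
          using sum_squares_bound[of x y] by (simp add: power2_sum)
        then show "AE \<omega> in M. norm ((\<Sum>j\<in>insert i J. a j * (mark (t j) (W 0 \<omega>) - mean_mark (t j)))\<^sup>2) \<le> norm (2 * (?f \<omega>)\<^sup>2 + 2 * (?g \<omega>)\<^sup>2)"
          using insert by (intro AE_I2) simp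
      qed measurable
    qed simp
    from this[OF I] show ?thesis unfolding \<phi>_def .
  qed
  have \<sigma>2: "\<sigma>\<^sup>2 = (\<integral>\<omega>. (\<phi> (W 0 \<omega>))\<^sup>2 \<partial>M)" unfolding \<sigma>_def \<phi>_def by simp
  have normal: "(\<integral>x. cos (x + b) \<partial>normal_law 0 \<sigma>) = (\<integral>x. cos (\<sigma> * x + b) \<partial>std_normal_distribution)"
    unfolding normal_law_def by (subst integral_distr) auto
  show ?thesis
  proof (cases "\<sigma> = 0")
    case True
    then have "(\<integral>\<omega>. (\<phi> (W 0 \<omega>))\<^sup>2 \<partial>M) = 0" using \<sigma>2 by simp
    then have sqi0: "(\<integral>\<omega>. (\<phi> (W i \<omega>))\<^sup>2 \<partial>M) = 0" for i
      using integral_W(1)[of "\<lambda>w. (\<phi> w)\<^sup>2" i] by simp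
    have "AE \<omega> in M. \<phi> (W i \<omega>) = 0" for i
    proof -
      have "integrable M (\<lambda>\<omega>. (\<phi> (W i \<omega>))\<^sup>2)" using sq0 integral_W(2)[of "\<lambda>w. (\<phi> w)\<^sup>2" i] by simp
      then have "AE \<omega> in M. (\<phi> (W i \<omega>))\<^sup>2 = 0"
        using sqi0[of i] by (subst integral_nonneg_eq_0_iff_AE[symmetric]) auto
      then show ?thesis by simp
    qed
    then have AE: "AE \<omega> in M. \<forall>i. \<phi> (W i \<omega>) = 0" by (simp add: AE_all_countable)
    have "(\<integral>\<omega>. cos ((\<Sum>j\<in>I. a j * emp_process n \<omega> (t j)) + b) \<partial>M) = (\<integral>\<omega>. cos b \<partial>M)" for n
    proof (rule integral_cong_AE)
      show "AE \<omega> in M. cos ((\<Sum>j\<in>I. a j * emp_process n \<omega> (t j)) + b) = cos b"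
        using AE by eventually_elim (simp add: lin)
    qed measurable
    moreover have "(\<integral>x. cos (\<sigma> * x + b) \<partial>std_normal_distribution) = cos b"
    proof -
      interpret N: prob_space std_normal_distribution by (rule prob_space_normal_density) simp
      show ?thesis using True N.prob_space by simp
    qed
    ultimately show ?thesis unfolding normal by (simp add: prob_space)
  next
    case False
    have "\<sigma> \<ge> 0" unfolding \<sigma>_def by simp
    then have \<sigma>: "\<sigma> > 0" using False by simp
    define S where "S n \<omega> = (\<Sum>i<n. \<phi> (W i \<omega>))" for n \<omega>
    have [measurable]: "S n \<in> borel_measurable M" for n unfolding S_def[abs_def] by measurable
    have mean_i: "(\<integral>\<omega>. \<phi> (W i \<omega>) \<partial>M) = 0" for i using integral_W(1)[of \<phi> i] mean0 by simp
    have "weak_conv_m (\<lambda>n. distr M borel (\<lambda>\<omega>. (\<Sum>i<n. \<phi> (W i \<omega>)) / sqrt (real n * \<sigma>\<^sup>2))) std_normal_distribution"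
    proof (rule central_limit_theorem_zero_mean[where \<mu>="distr M borel (\<lambda>\<omega>. \<phi> (W 0 \<omega>))"])
      show "indep_vars (\<lambda>i. borel) (\<lambda>i \<omega>. \<phi> (W i \<omega>)) UNIV"
        by (rule indep_vars_compose2[OF indep_W]) simp
      show "(\<integral>\<omega>. \<phi> (W i \<omega>) \<partial>M) = 0" for i by (rule mean_i)
      show "integrable M (\<lambda>\<omega>. (\<phi> (W i \<omega>))\<^sup>2)" for i using sq0 integral_W(2)[of "\<lambda>w. (\<phi> w)\<^sup>2" i] by simp
      show "variance (\<lambda>\<omega>. \<phi> (W i \<omega>)) = \<sigma>\<^sup>2" for i
        unfolding mean_i using integral_W(1)[of "\<lambda>w. (\<phi> w)\<^sup>2" i] \<sigma>2 by simp
      show "distr M borel (\<lambda>\<omega>. \<phi> (W i \<omega>)) = distr M borel (\<lambda>\<omega>. \<phi> (W 0 \<omega>))" for i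
      proof -
        have "distr M borel (\<lambda>\<omega>. \<phi> (W i \<omega>)) = distr (distr M borel (W i)) borel \<phi>" for i
          by (subst distr_distr) (auto simp: comp_def)
        then show ?thesis using distr_W[of i] by simp
      qed
    qed (rule \<sigma>)
    then have wc: "weak_conv_m (\<lambda>n. distr M borel (\<lambda>\<omega>. S n \<omega> / sqrt (real n * \<sigma>\<^sup>2))) std_normal_distribution"
      by (simp add: S_def)
    have "(\<lambda>n. \<integral>x. cos (\<sigma> * x + b) \<partial>distr M borel (\<lambda>\<omega>. S n \<omega> / sqrt (real n * \<sigma>\<^sup>2)))
       \<longlonglongrightarrow> (\<integral>x. cos (\<sigma> * x + b) \<partial>std_normal_distribution)"
      by (rule weak_conv_imp_integral_bdd_continuous_conv[OF _ real_dist_normal_dist wc, where B=1])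
         (auto intro!: real_distribution_distr continuous_intros)
    moreover have "(\<integral>x. cos (\<sigma> * x + b) \<partial>distr M borel (\<lambda>\<omega>. S n \<omega> / sqrt (real n * \<sigma>\<^sup>2)))
       = (\<integral>\<omega>. cos ((\<Sum>j\<in>I. a j * emp_process n \<omega> (t j)) + b) \<partial>M)" for n
      using \<sigma> by (subst integral_distr) (auto simp: lin S_def[symmetric] real_sqrt_mult)
    ultimately show ?thesis unfolding normal by simp
  qed
qed

end

section \<open>Bounded functions and outer expectations\<close>

lemma linf_space: "z \<in> mspace (linf T) \<longleftrightarrow> z \<in> extensional T \<and> bounded (z ` T)"
  by (auto simp: linf_def Met_TC.fspace_def)

lemma linf_dist_le:
  assumes "z \<in> mspace (linf T)" "z' \<in> mspace (linf T)" "T \<noteq> {}" "\<And>t. t \<in> T \<Longrightarrow> \<bar>z t - z' t\<bar> \<le> c"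
  shows "mdist (linf T) z z' \<le> c"
  using assms by (auto simp: linf_def Met_TC.fdist_def dist_real_def intro!: cSUP_least)

lemma linf_le_dist:
  assumes "z \<in> mspace (linf T)" "z' \<in> mspace (linf T)" "t \<in> T"
  shows "\<bar>z t - z' t\<bar> \<le> mdist (linf T) z z'"
proof -
  have "bdd_above ((\<lambda>u. dist (z u) (z' u)) ` T)"
    using assms by (intro Met_TC.bdd_above_dist) (auto simp: linf_def)
  then have "dist (z t) (z' t) \<le> (SUP u\<in>T. dist (z u) (z' u))" using assms(3) by (intro cSUP_upper)
  then show ?thesis using assms by (auto simp: linf_def Met_TC.fdist_def dist_real_def)
qed

text \<open>Moreau--Yosida regularisation: the largest \<open>j\<close>-Lipschitz minorant.\<close>

definition lip_env :: "'b metric \<Rightarrow> ('b \<Rightarrow> real) \<Rightarrow> nat \<Rightarrow> 'b \<Rightarrow> real" where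
  "lip_env m h j z = (INF w\<in>mspace m. h w + real j * mdist m z w)"

lemma lip_env_bdd_below:
  assumes "\<And>w. w \<in> mspace m \<Longrightarrow> \<bar>h w\<bar> \<le> B"
  shows "bdd_below ((\<lambda>w. h w + real j * mdist m z w) ` mspace m)"
proof (rule bdd_belowI2[where m="- B"])
  fix w assume "w \<in> mspace m"
  then have "- B \<le> h w" using assms[of w] by linarith
  then show "- B \<le> h w + real j * mdist m z w" by (simp add: add_increasing2)
qed

lemma lip_env_le:
  assumes "\<And>w. w \<in> mspace m \<Longrightarrow> \<bar>h w\<bar> \<le> B" "z \<in> mspace m"
  shows "lip_env m h j z \<le> h z"
proof -
  have "lip_env m h j z \<le> h z + real j * mdist m z z"
    unfolding lip_env_def by (rule cINF_lower[OF lip_env_bdd_below[OF assms(1)] assms(2)])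
  then show ?thesis using mdist_zero[OF assms(2,2)] by simp
qed

lemma lip_env_ge:
  assumes "\<And>w. w \<in> mspace m \<Longrightarrow> \<bar>h w\<bar> \<le> B" "z \<in> mspace m"
  shows "- B \<le> lip_env m h j z"
  unfolding lip_env_def
proof (rule cINF_greatest)
  show "mspace m \<noteq> {}" using assms(2) by auto
  fix w assume "w \<in> mspace m"
  then have "- B \<le> h w" using assms(1)[of w] by linarith
  then show "- B \<le> h w + real j * mdist m z w" by (simp add: add_increasing2)
qed

lemma lip_env_lipschitz:
  assumes h: "\<And>w. w \<in> mspace m \<Longrightarrow> \<bar>h w\<bar> \<le> B" and z: "z \<in> mspace m" "z' \<in> mspace m"
  shows "\<bar>lip_env m h j z - lip_env m h j z'\<bar> \<le> real j * mdist m z z'"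
proof -
  have *: "lip_env m h j z \<le> lip_env m h j z' + real j * mdist m z z'"
    if z: "z \<in> mspace m" "z' \<in> mspace m" for z z'
  proof -
    have "lip_env m h j z - real j * mdist m z z' \<le> lip_env m h j z'"
      unfolding lip_env_def[of m h j z']
    proof (rule cINF_greatest)
      show "mspace m \<noteq> {}" using z by auto
      fix w assume w: "w \<in> mspace m"
      have "lip_env m h j z \<le> h w + real j * mdist m z w"
        unfolding lip_env_def by (rule cINF_lower[OF lip_env_bdd_below[OF h] w])
      also have "\<dots> \<le> h w + real j * (mdist m z z' + mdist m z' w)"
        using z w by (intro add_left_mono mult_left_mono mdist_triangle) auto
      finally show "lip_env m h j z - real j * mdist m z z' \<le> h w + real j * mdist m z' w"
        by (simp add: algebra_simps)
    qed
    then show ?thesis by simp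
  qed
  show ?thesis using *[OF z] *[OF z(2,1)] by (simp add: mdist_commute abs_le_iff)
qed

lemma lip_env_tendsto:
  assumes h: "\<And>w. w \<in> mspace m \<Longrightarrow> \<bar>h w\<bar> \<le> B" and z: "z \<in> mspace m"
    and lsc: "\<And>e. e > 0 \<Longrightarrow> \<exists>\<delta>>0. \<forall>w\<in>mspace m. mdist m z w < \<delta> \<longrightarrow> h w > h z - e"
  shows "(\<lambda>j. lip_env m h j z) \<longlonglongrightarrow> h z"
proof (rule LIMSEQ_I)
  fix e :: real assume "e > 0"
  then have e2: "e / 2 > 0" by simp
  obtain \<delta> where \<delta>: "\<delta> > 0" "\<And>w. w \<in> mspace m \<Longrightarrow> mdist m z w < \<delta> \<Longrightarrow> h w > h z - e / 2"
    using lsc[OF e2] by blast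
  obtain j0 :: nat where j0: "real j0 \<ge> 2 * B / \<delta>" using real_arch_simple by blast
  show "\<exists>j0. \<forall>j\<ge>j0. norm (lip_env m h j z - h z) < e"
  proof (intro exI[of _ j0] allI impI)
    fix j assume j: "j0 \<le> j"
    have "2 * B / \<delta> \<le> real j" using j0 j by linarith
    then have "real j * \<delta> \<ge> 2 * B" using \<delta>(1) by (simp add: pos_divide_le_eq)
    have "h z - e / 2 \<le> lip_env m h j z"
      unfolding lip_env_def
    proof (rule cINF_greatest)
      show "mspace m \<noteq> {}" using z by auto
      fix w assume w: "w \<in> mspace m"
      show "h z - e / 2 \<le> h w + real j * mdist m z w"
      proof (cases "mdist m z w < \<delta>")
        case True
        then show ?thesis using \<delta>(2)[OF w True] by (simp add: add_increasing2)
      next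
        case False
        then have "real j * \<delta> \<le> real j * mdist m z w" by (intro mult_left_mono) auto
        then show ?thesis using \<open>real j * \<delta> \<ge> 2 * B\<close> h[OF w] h[OF z] \<open>e > 0\<close> by linarith
      qed
    qed
    then show "norm (lip_env m h j z - h z) < e"
      using lip_env_le[where h=h and m=m and B=B and j=j, OF h z] \<open>e > 0\<close> by simp
  qed
qed

lemma continuous_real_nbhd:
  assumes h: "continuous_map (mtopology_of m) euclideanreal h" and z: "z \<in> mspace m" and e: "e > 0"
  shows "\<exists>\<delta>>0. \<forall>w\<in>mspace m. mdist m z w < \<delta> \<longrightarrow> \<bar>h w - h z\<bar> < e"
proof -
  interpret Metric_space "mspace m" "mdist m" by simp
  have "openin mtopology {w \<in> topspace mtopology. h w \<in> {h z - e<..<h z + e}}"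
    using openin_continuous_map_preimage[OF h, of "{h z - e<..<h z + e}"] by (simp add: mtopology_of_def)
  then obtain \<delta> where "\<delta> > 0" "mball z \<delta> \<subseteq> {w \<in> topspace mtopology. h w \<in> {h z - e<..<h z + e}}"
    unfolding openin_mtopology using z e by (auto simp: subset_iff)
  then show ?thesis using z by (intro exI[of _ \<delta>]) (force simp: in_mball abs_less_iff)
qed

lemma openin_metric_nbhd:
  assumes U: "openin (mtopology_of m) U" and z: "z \<in> U"
  shows "\<exists>\<delta>>0. \<forall>w\<in>mspace m. mdist m z w < \<delta> \<longrightarrow> w \<in> U"
proof -
  interpret Metric_space "mspace m" "mdist m" by simp
  obtain \<delta> where \<delta>: "\<delta> > 0" "mball z \<delta> \<subseteq> U" and sub: "U \<subseteq> mspace m"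
    using U z unfolding mtopology_of_def openin_mtopology by blast
  have "w \<in> U" if "w \<in> mspace m" "mdist m z w < \<delta>" for w
    using that z sub by (intro subsetD[OF \<delta>(2)]) (simp add: in_mball subsetD)
  then show ?thesis using \<delta>(1) by blast
qed

lemma space_borel_metric [simp]: "space (borel_metric m) = mspace m"
  unfolding borel_metric_def by (rule space_measure_of) (use openin_subset in fastforce)

lemma open_in_borel_metric: "openin (mtopology_of m) U \<Longrightarrow> U \<in> sets (borel_metric m)"
  unfolding borel_metric_def by (subst sets_measure_of) (use openin_subset in fastforce, simp add: sigma_sets.Basic)

lemma continuous_borel_metric:
  assumes "continuous_map (mtopology_of m) euclideanreal h"
  shows "h \<in> borel_measurable (borel_metric m)"
proof (rule borel_measurableI)
  fix S :: "real set" assume "open S"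
  then have "openin (mtopology_of m) {w \<in> topspace (mtopology_of m). h w \<in> S}"
    by (intro openin_continuous_map_preimage[OF assms]) simp
  moreover have "h -` S \<inter> space (borel_metric m) = {w \<in> topspace (mtopology_of m). h w \<in> S}" by auto
  ultimately show "h -` S \<inter> space (borel_metric m) \<in> sets (borel_metric m)" by (simp add: open_in_borel_metric)
qed

lemma lipschitz_continuous_map:
  assumes "\<And>z z'. z \<in> mspace m \<Longrightarrow> z' \<in> mspace m \<Longrightarrow> \<bar>h z - h z'\<bar> \<le> c * mdist m z z'"
  shows "continuous_map (mtopology_of m) euclideanreal h"
proof -
  have "Lipschitz_continuous_map m euclidean_metric h"
    unfolding Lipschitz_continuous_map_def using assms by (auto simp: dist_real_def)
  then show ?thesis using Lipschitz_continuous_imp_continuous_map by fastforce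
qed

context prob_space
begin

lemma outer_expectation_bounds:
  assumes "integrable M U1" "integrable M U2" "\<And>\<omega>. \<omega> \<in> space M \<Longrightarrow> U1 \<omega> \<le> T \<omega>" "\<And>\<omega>. \<omega> \<in> space M \<Longrightarrow> T \<omega> \<le> U2 \<omega>"
  shows "(\<integral>\<omega>. U1 \<omega> \<partial>M) \<le> outer_expectation M T" "outer_expectation M T \<le> (\<integral>\<omega>. U2 \<omega> \<partial>M)"
proof -
  let ?S = "{(\<integral>\<omega>. U \<omega> \<partial>M) | U. integrable M U \<and> (\<forall>\<omega>\<in>space M. T \<omega> \<le> U \<omega>)}"
  have lb: "(\<integral>\<omega>. U1 \<omega> \<partial>M) \<le> x" if "x \<in> ?S" for x
    using that assms(1,3) by (auto intro!: integral_mono intro: order_trans)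
  have mem: "(\<integral>\<omega>. U2 \<omega> \<partial>M) \<in> ?S" using assms by blast
  show "(\<integral>\<omega>. U1 \<omega> \<partial>M) \<le> outer_expectation M T"
    unfolding outer_expectation_def by (rule cInf_greatest) (use mem lb in blast)+
  show "outer_expectation M T \<le> (\<integral>\<omega>. U2 \<omega> \<partial>M)"
    unfolding outer_expectation_def by (rule cInf_lower[OF mem]) (rule bdd_belowI[OF lb])
qed

lemma outer_expectation_eq:
  "integrable M T \<Longrightarrow> outer_expectation M T = (\<integral>\<omega>. T \<omega> \<partial>M)"
  using outer_expectation_bounds[of T T T] by force

lemma outer_expectation_mono:
  assumes "\<And>\<omega>. \<omega> \<in> space M \<Longrightarrow> S \<omega> \<le> T \<omega>" "\<And>\<omega>. \<omega> \<in> space M \<Longrightarrow> \<bar>S \<omega>\<bar> \<le> B" "\<And>\<omega>. \<omega> \<in> space M \<Longrightarrow> T \<omega> \<le> C"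
  shows "outer_expectation M S \<le> outer_expectation M T"
  unfolding outer_expectation_def
proof (rule cInf_superset_mono)
  have "integrable M (\<lambda>_. C)" by simp
  then show "{(\<integral>\<omega>. U \<omega> \<partial>M) | U. integrable M U \<and> (\<forall>\<omega>\<in>space M. T \<omega> \<le> U \<omega>)} \<noteq> {}" using assms(3) by blast
  show "bdd_below {(\<integral>\<omega>. U \<omega> \<partial>M) | U. integrable M U \<and> (\<forall>\<omega>\<in>space M. S \<omega> \<le> U \<omega>)}"
  proof (rule bdd_belowI[where m="- B"])
    fix x assume "x \<in> {(\<integral>\<omega>. U \<omega> \<partial>M) | U. integrable M U \<and> (\<forall>\<omega>\<in>space M. S \<omega> \<le> U \<omega>)}"
    then obtain U where U: "x = (\<integral>\<omega>. U \<omega> \<partial>M)" "integrable M U" "\<forall>\<omega>\<in>space M. S \<omega> \<le> U \<omega>" by blast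
    have "(\<integral>\<omega>. - B \<partial>M) \<le> (\<integral>\<omega>. U \<omega> \<partial>M)"
    proof (rule integral_mono)
      fix \<omega> assume "\<omega> \<in> space M"
      then show "- B \<le> U \<omega>" using U(3) assms(2)[of \<omega>] by (force simp: abs_le_iff)
    qed (use U in auto)
    then show "- B \<le> x" by (simp add: U prob_space)
  qed
  show "{(\<integral>\<omega>. U \<omega> \<partial>M) | U. integrable M U \<and> (\<forall>\<omega>\<in>space M. T \<omega> \<le> U \<omega>)}
     \<subseteq> {(\<integral>\<omega>. U \<omega> \<partial>M) | U. integrable M U \<and> (\<forall>\<omega>\<in>space M. S \<omega> \<le> U \<omega>)}"
    using assms(1) by (auto intro: order_trans)
qed

end

theorem hj_weak_conv_of_lipschitz:
  assumes M: "prob_space M" and Z: "\<And>n. Z n \<in> space M \<rightarrow> mspace m"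
    and L: "prob_space L" "sets L = sets (borel_metric m)"
    and lip: "\<And>h B c. (\<And>z. z \<in> mspace m \<Longrightarrow> \<bar>h z\<bar> \<le> B) \<Longrightarrow>
      (\<And>z z'. z \<in> mspace m \<Longrightarrow> z' \<in> mspace m \<Longrightarrow> \<bar>h z - h z'\<bar> \<le> c * mdist m z z') \<Longrightarrow>
      (\<lambda>n. outer_expectation M (\<lambda>\<omega>. h (Z n \<omega>))) \<longlonglongrightarrow> (\<integral>z. h z \<partial>L)"
  shows "hj_weak_conv m M Z L"
  unfolding hj_weak_conv_def
proof (intro conjI allI impI Z L)
  interpret M: prob_space M by fact
  interpret L: prob_space L by fact
  have spL: "space L = mspace m" using sets_eq_imp_space_eq[OF L(2)] by simp
  show "space L = mspace m" by (fact spL)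
  fix h assume h: "continuous_map (mtopology_of m) euclideanreal h \<and> bounded (h ` mspace m)"
  obtain B where B: "\<And>z. z \<in> mspace m \<Longrightarrow> \<bar>h z\<bar> \<le> B"
    using h by (auto simp: bounded_iff)
  have Zin: "Z n \<omega> \<in> mspace m" if "\<omega> \<in> space M" for n \<omega> using Z[of n] that by auto
  have approx: "\<exists>f c. (\<forall>z\<in>mspace m. \<bar>f z\<bar> \<le> B \<and> f z \<le> g z) \<and>
      (\<forall>z\<in>mspace m. \<forall>z'\<in>mspace m. \<bar>f z - f z'\<bar> \<le> c * mdist m z z') \<and> (\<integral>z. f z \<partial>L) > (\<integral>z. g z \<partial>L) - e"
    if g: "continuous_map (mtopology_of m) euclideanreal g" "\<And>z. z \<in> mspace m \<Longrightarrow> \<bar>g z\<bar> \<le> B" and e: "e > 0" for g e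
  proof -
    have gm: "f \<in> borel_measurable L" if "continuous_map (mtopology_of m) euclideanreal f" for f
      using continuous_borel_metric[OF that] by (simp add: measurable_cong_sets[OF L(2) refl])
    have env_cont: "continuous_map (mtopology_of m) euclideanreal (lip_env m g j)" for j
    proof (rule lipschitz_continuous_map)
      show "\<bar>lip_env m g j z - lip_env m g j z'\<bar> \<le> real j * mdist m z z'" if "z \<in> mspace m" "z' \<in> mspace m" for z z'
        by (rule lip_env_lipschitz[where B=B]) (use g(2) that in auto)
    qed
    have env_bd: "\<bar>lip_env m g j z\<bar> \<le> B" if "z \<in> mspace m" for j z
      using lip_env_le[where h=g and m=m and B=B and j=j, OF g(2) that] lip_env_ge[where h=g and m=m and B=B and j=j, OF g(2) that] g(2)[OF that] by linarith
    have "(\<lambda>j. \<integral>z. lip_env m g j z \<partial>L) \<longlonglongrightarrow> (\<integral>z. g z \<partial>L)"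
    proof (rule integral_dominated_convergence[where w="\<lambda>_. B"])
      show "AE z in L. (\<lambda>j. lip_env m g j z) \<longlonglongrightarrow> g z"
      proof (rule AE_I2)
        fix z assume "z \<in> space L"
        then have z: "z \<in> mspace m" by (simp add: spL)
        show "(\<lambda>j. lip_env m g j z) \<longlonglongrightarrow> g z"
        proof (rule lip_env_tendsto[where h=g and m=m and B=B, OF g(2) z])
          fix e :: real assume "e > 0"
          then obtain \<delta> where \<delta>: "\<delta> > 0" "\<And>w. w \<in> mspace m \<Longrightarrow> mdist m z w < \<delta> \<Longrightarrow> \<bar>g w - g z\<bar> < e"
            using continuous_real_nbhd[OF g(1) z] by blast
          show "\<exists>\<delta>>0. \<forall>w\<in>mspace m. mdist m z w < \<delta> \<longrightarrow> g z - e < g w"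
          proof (intro exI[of _ \<delta>] conjI \<delta>(1) ballI impI)
            fix w assume "w \<in> mspace m" "mdist m z w < \<delta>"
            then show "g z - e < g w" using \<delta>(2)[of w] by linarith
          qed
        qed
      qed
      show "g \<in> borel_measurable L" by (rule gm[OF g(1)])
      show "lip_env m g j \<in> borel_measurable L" for j by (rule gm[OF env_cont])
      show "AE z in L. norm (lip_env m g j z) \<le> B" for j using env_bd spL by (intro AE_I2) simp
    qed simp
    then have "eventually (\<lambda>j. (\<integral>z. lip_env m g j z \<partial>L) > (\<integral>z. g z \<partial>L) - e) sequentially"
      by (rule order_tendstoD) (use e in simp)
    then obtain j where j: "(\<integral>z. lip_env m g j z \<partial>L) > (\<integral>z. g z \<partial>L) - e"
      by (auto simp: eventually_sequentially)
    show ?thesis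
    proof (intro exI[of _ "lip_env m g j"] exI[of _ "real j"] conjI ballI j env_bd)
      show "lip_env m g j z \<le> g z" if "z \<in> mspace m" for z
        by (rule lip_env_le[where B=B]) (use g(2) that in auto)
      show "\<bar>lip_env m g j z - lip_env m g j z'\<bar> \<le> real j * mdist m z z'" if "z \<in> mspace m" "z' \<in> mspace m" for z z'
        by (rule lip_env_lipschitz[where B=B]) (use g(2) that in auto)
    qed
  qed
  show "(\<lambda>n. outer_expectation M (\<lambda>\<omega>. h (Z n \<omega>))) \<longlonglongrightarrow> (\<integral>z. h z \<partial>L)"
  proof (rule order_tendstoI)
    fix a assume a: "a < (\<integral>z. h z \<partial>L)"
    then have a': "(\<integral>z. h z \<partial>L) - a > 0" by simp
    have "\<exists>f c. (\<forall>z\<in>mspace m. \<bar>f z\<bar> \<le> B \<and> f z \<le> h z) \<and>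
      (\<forall>z\<in>mspace m. \<forall>z'\<in>mspace m. \<bar>f z - f z'\<bar> \<le> c * mdist m z z') \<and>
      (\<integral>z. f z \<partial>L) > (\<integral>z. h z \<partial>L) - ((\<integral>z. h z \<partial>L) - a)"
      by (rule approx[OF conjunct1[OF h] _ a']) (rule B)
    then obtain f c where f: "\<And>z. z \<in> mspace m \<Longrightarrow> \<bar>f z\<bar> \<le> B" "\<And>z. z \<in> mspace m \<Longrightarrow> f z \<le> h z"
      "\<And>z z'. z \<in> mspace m \<Longrightarrow> z' \<in> mspace m \<Longrightarrow> \<bar>f z - f z'\<bar> \<le> c * mdist m z z'"
      "(\<integral>z. f z \<partial>L) > (\<integral>z. h z \<partial>L) - ((\<integral>z. h z \<partial>L) - a)"
      by (elim exE conjE) (rule that, auto)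
    have ev: "eventually (\<lambda>n. outer_expectation M (\<lambda>\<omega>. f (Z n \<omega>)) > a) sequentially"
      using f(4) by (intro order_tendstoD(1)[OF lip[where h=f and B=B and c=c, OF f(1) f(3)]]) auto
    have le: "outer_expectation M (\<lambda>\<omega>. f (Z n \<omega>)) \<le> outer_expectation M (\<lambda>\<omega>. h (Z n \<omega>))" for n
    proof (rule M.outer_expectation_mono[where B=B and C=B])
      fix \<omega> assume \<omega>: "\<omega> \<in> space M"
      show "f (Z n \<omega>) \<le> h (Z n \<omega>)" "\<bar>f (Z n \<omega>)\<bar> \<le> B" "h (Z n \<omega>) \<le> B"
        using f(1,2)[OF Zin[OF \<omega>, of n]] B[OF Zin[OF \<omega>, of n]] by linarith+
    qed
    show "eventually (\<lambda>n. outer_expectation M (\<lambda>\<omega>. h (Z n \<omega>)) > a) sequentially"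
      using ev by (rule eventually_mono) (erule less_le_trans[OF _ le])
  next
    fix a assume a: "(\<integral>z. h z \<partial>L) < a"
    have h': "continuous_map (mtopology_of m) euclideanreal (\<lambda>z. - h z)"
      using h by (intro continuous_map_minus) simp
    have B': "\<bar>- h z\<bar> \<le> B" if "z \<in> mspace m" for z using B[OF that] by simp
    have a': "a - (\<integral>z. h z \<partial>L) > 0" using a by simp
    have "\<exists>f c. (\<forall>z\<in>mspace m. \<bar>f z\<bar> \<le> B \<and> f z \<le> - h z) \<and>
      (\<forall>z\<in>mspace m. \<forall>z'\<in>mspace m. \<bar>f z - f z'\<bar> \<le> c * mdist m z z') \<and>
      (\<integral>z. f z \<partial>L) > (\<integral>z. - h z \<partial>L) - (a - (\<integral>z. h z \<partial>L))"
      by (rule approx[OF h' _ a']) (rule B')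
    then obtain f c where f: "\<And>z. z \<in> mspace m \<Longrightarrow> \<bar>f z\<bar> \<le> B" "\<And>z. z \<in> mspace m \<Longrightarrow> f z \<le> - h z"
      "\<And>z z'. z \<in> mspace m \<Longrightarrow> z' \<in> mspace m \<Longrightarrow> \<bar>f z - f z'\<bar> \<le> c * mdist m z z'"
      "(\<integral>z. f z \<partial>L) > (\<integral>z. - h z \<partial>L) - (a - (\<integral>z. h z \<partial>L))"
      by (elim exE conjE) (rule that, auto)
    have "(\<lambda>n. outer_expectation M (\<lambda>\<omega>. - f (Z n \<omega>))) \<longlonglongrightarrow> (\<integral>z. - f z \<partial>L)"
    proof (rule lip[where B=B and c=c])
      show "\<bar>- f z\<bar> \<le> B" if "z \<in> mspace m" for z using f(1)[OF that] by simp
      show "\<bar>- f z - - f z'\<bar> \<le> c * mdist m z z'" if "z \<in> mspace m" "z' \<in> mspace m" for z z'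
        using f(3)[OF that] by (simp add: abs_minus_commute)
    qed
    then have ev: "eventually (\<lambda>n. outer_expectation M (\<lambda>\<omega>. - f (Z n \<omega>)) < a) sequentially"
      using f(4) by (intro order_tendstoD(2)) auto
    have le: "outer_expectation M (\<lambda>\<omega>. h (Z n \<omega>)) \<le> outer_expectation M (\<lambda>\<omega>. - f (Z n \<omega>))" for n
    proof (rule M.outer_expectation_mono[where B=B and C=B])
      fix \<omega> assume \<omega>: "\<omega> \<in> space M"
      show "h (Z n \<omega>) \<le> - f (Z n \<omega>)" "\<bar>h (Z n \<omega>)\<bar> \<le> B" "- f (Z n \<omega>) \<le> B"
        using f(1,2)[OF Zin[OF \<omega>, of n]] B[OF Zin[OF \<omega>, of n]] by linarith+
    qed
    show "eventually (\<lambda>n. outer_expectation M (\<lambda>\<omega>. h (Z n \<omega>)) < a) sequentially"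
      using ev by (rule eventually_mono) (erule le_less_trans[OF le])
  qed
qed

section \<open>Paths determined by a grid\<close>

text \<open>Coordinate \<open>prod_encode (q, j)\<close> of a sequence stands for the value of a path at \<open>j / 2 ^ \<kappa> q\<close>;
  grid points are listed repeatedly.\<close>

definition grid_index :: "(nat \<Rightarrow> nat) \<Rightarrow> nat \<Rightarrow> real \<Rightarrow> nat" where
  "grid_index \<kappa> q t = prod_encode (q, nat \<lfloor>2 ^ \<kappa> q * t\<rfloor>)"

definition grid_point :: "(nat \<Rightarrow> nat) \<Rightarrow> nat \<Rightarrow> real" where
  "grid_point \<kappa> i = (case prod_decode i of (q, j) \<Rightarrow> min 1 (real j / 2 ^ \<kappa> q))"

definition step_path :: "(nat \<Rightarrow> nat) \<Rightarrow> nat \<Rightarrow> (nat \<Rightarrow> real) \<Rightarrow> real \<Rightarrow> real" where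
  "step_path \<kappa> q v = (\<lambda>t\<in>{0..1}. v (grid_index \<kappa> q t))"

definition step_gap :: "(nat \<Rightarrow> nat) \<Rightarrow> nat \<Rightarrow> (nat \<Rightarrow> real) \<Rightarrow> real" where
  "step_gap \<kappa> q v = mdist (linf {0..1}) (step_path \<kappa> (Suc q) v) (step_path \<kappa> q v)"

definition tame :: "(nat \<Rightarrow> nat) \<Rightarrow> nat \<Rightarrow> (nat \<Rightarrow> real) set" where
  "tame \<kappa> q0 = {v. \<forall>q\<ge>q0. step_gap \<kappa> q v \<le> 2 * (1/2) ^ q}"

definition limit_path :: "(nat \<Rightarrow> nat) \<Rightarrow> (nat \<Rightarrow> real) \<Rightarrow> real \<Rightarrow> real" where
  "limit_path \<kappa> v = (\<lambda>t\<in>{0..1}. if \<exists>q0. v \<in> tame \<kappa> q0 then lim (\<lambda>q. step_path \<kappa> q v t) else 0)"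

lemma grid_point_in: "grid_point \<kappa> i \<in> {0..1}"
  by (auto simp: grid_point_def split: prod.split)

lemma grid_point_index:
  assumes "t \<in> {0..1}"
  shows "grid_point \<kappa> (grid_index \<kappa> q t) = of_int \<lfloor>2 ^ \<kappa> q * t\<rfloor> / 2 ^ \<kappa> q"
proof -
  have nn: "0 \<le> 2 ^ \<kappa> q * t" using assms by simp
  have "of_int \<lfloor>2 ^ \<kappa> q * t\<rfloor> \<le> 2 ^ \<kappa> q * t" by simp
  also have "\<dots> \<le> 2 ^ \<kappa> q" using assms by simp
  finally have "of_int \<lfloor>2 ^ \<kappa> q * t\<rfloor> / 2 ^ \<kappa> q \<le> (1::real)" by simp
  then show ?thesis using nn by (simp add: grid_point_def grid_index_def)
qed

lemma grid_index_range:
  assumes "t \<in> {0..1}"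
  shows "grid_index \<kappa> q t \<in> (\<lambda>j. prod_encode (q, j)) ` {..2 ^ \<kappa> q}"
proof -
  have "2 ^ \<kappa> q * t \<le> 2 ^ \<kappa> q" using assms by simp
  then have "\<lfloor>2 ^ \<kappa> q * t\<rfloor> \<le> 2 ^ \<kappa> q" by (metis floor_mono floor_of_int of_int_numeral of_int_power)
  then have "nat \<lfloor>2 ^ \<kappa> q * t\<rfloor> \<le> 2 ^ \<kappa> q" by (simp add: nat_le_iff)
  then show ?thesis by (simp add: grid_index_def)
qed

lemma step_path_space: "step_path \<kappa> q v \<in> mspace (linf {0..1})"
proof -
  have sub: "step_path \<kappa> q v ` {0..1} \<subseteq> (\<lambda>j. v (prod_encode (q, j))) ` {..2 ^ \<kappa> q}"
  proof
    fix y assume "y \<in> step_path \<kappa> q v ` {0..1}"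
    then obtain t where t: "t \<in> {0..1}" "y = v (grid_index \<kappa> q t)" by (auto simp: step_path_def)
    then show "y \<in> (\<lambda>j. v (prod_encode (q, j))) ` {..2 ^ \<kappa> q}"
      using grid_index_range[OF t(1), of \<kappa> q] by auto
  qed
  have "bounded (step_path \<kappa> q v ` {0..1})"
    by (rule finite_imp_bounded, rule finite_subset[OF sub]) simp
  then show ?thesis by (simp add: linf_space step_path_def)
qed

lemma step_path_dist:
  "mdist (linf {0..1}) (step_path \<kappa> q v) (step_path \<kappa> q v')
     \<le> (\<Sum>j\<le>2 ^ \<kappa> q. \<bar>v (prod_encode (q, j)) - v' (prod_encode (q, j))\<bar>)"
proof (rule linf_dist_le)
  fix t :: real assume t: "t \<in> {0..1}"
  obtain j where j: "j \<le> 2 ^ \<kappa> q" "grid_index \<kappa> q t = prod_encode (q, j)"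
    using grid_index_range[OF t, of \<kappa> q] by auto
  have "\<bar>v (prod_encode (q, j)) - v' (prod_encode (q, j))\<bar>
     \<le> (\<Sum>j\<le>2 ^ \<kappa> q. \<bar>v (prod_encode (q, j)) - v' (prod_encode (q, j))\<bar>)"
    using j(1) by (intro member_le_sum) auto
  then show "\<bar>step_path \<kappa> q v t - step_path \<kappa> q v' t\<bar> \<le> (\<Sum>j\<le>2 ^ \<kappa> q. \<bar>v (prod_encode (q, j)) - v' (prod_encode (q, j))\<bar>)"
    using t j(2) by (simp add: step_path_def)
qed (auto simp: step_path_space)

lemma isCont_coordinate: "isCont (\<lambda>x :: nat \<Rightarrow> real. x i) v"
proof -
  have "continuous_on UNIV (\<lambda>x :: nat \<Rightarrow> real. x i)" by (rule continuous_on_product_coordinates)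
  then show ?thesis unfolding continuous_on_eq_continuous_at[OF open_UNIV] by blast
qed

lemma continuous_on_coordinate_bound:
  fixes g :: "(nat \<Rightarrow> real) \<Rightarrow> real"
  assumes "finite I" "\<And>v v'. \<bar>g v - g v'\<bar> \<le> c * (\<Sum>i\<in>I. \<bar>v i - v' i\<bar>)"
  shows "continuous_on UNIV g"
  unfolding continuous_on_eq_continuous_at[OF open_UNIV]
proof
  fix v :: "nat \<Rightarrow> real"
  have "((\<lambda>v'. g v' - g v) \<longlongrightarrow> 0) (at v)"
  proof (rule Lim_null_comparison)
    show "\<forall>\<^sub>F v' in at v. norm (g v' - g v) \<le> c * (\<Sum>i\<in>I. \<bar>v' i - v i\<bar>)"
      using assms(2) by simp
    have "((\<lambda>v'. c * (\<Sum>i\<in>I. \<bar>v' i - v i\<bar>)) \<longlongrightarrow> c * (\<Sum>i\<in>I. \<bar>v i - v i\<bar>)) (at v)"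
      using isCont_coordinate by (intro tendsto_intros) (simp add: isCont_def)
    then show "((\<lambda>v'. c * (\<Sum>i\<in>I. \<bar>v' i - v i\<bar>)) \<longlongrightarrow> 0) (at v)" by simp
  qed
  then show "isCont g v" unfolding isCont_def by (rule LIM_zero_cancel)
qed

lemma lipschitz_step_continuous:
  assumes "\<And>z z'. z \<in> mspace (linf {0..1}) \<Longrightarrow> z' \<in> mspace (linf {0..1}) \<Longrightarrow> \<bar>h z - h z'\<bar> \<le> c * mdist (linf {0..1}) z z'"
  shows "continuous_on UNIV (\<lambda>v. h (step_path \<kappa> q v))"
proof (rule continuous_on_coordinate_bound)
  show "finite ((\<lambda>j. prod_encode (q, j)) ` {..2 ^ \<kappa> q})" by simp
  fix v v' :: "nat \<Rightarrow> real"
  have inj: "inj_on (\<lambda>j. prod_encode (q, j)) {..2 ^ \<kappa> q}" by (auto simp: inj_on_def)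
  have "\<bar>h (step_path \<kappa> q v) - h (step_path \<kappa> q v')\<bar> \<le> c * mdist (linf {0..1}) (step_path \<kappa> q v) (step_path \<kappa> q v')"
    by (rule assms) (rule step_path_space)+
  also have "\<dots> \<le> \<bar>c\<bar> * mdist (linf {0..1}) (step_path \<kappa> q v) (step_path \<kappa> q v')"
    by (intro mult_right_mono) auto
  also have "\<dots> \<le> \<bar>c\<bar> * (\<Sum>j\<le>2 ^ \<kappa> q. \<bar>v (prod_encode (q, j)) - v' (prod_encode (q, j))\<bar>)"
    by (intro mult_left_mono step_path_dist) auto
  finally show "\<bar>h (step_path \<kappa> q v) - h (step_path \<kappa> q v')\<bar>
     \<le> \<bar>c\<bar> * (\<Sum>i\<in>(\<lambda>j. prod_encode (q, j)) ` {..2 ^ \<kappa> q}. \<bar>v i - v' i\<bar>)"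
    by (simp add: sum.reindex[OF inj])
qed

lemma step_gap_continuous: "continuous_on UNIV (step_gap \<kappa> q)"
proof (rule continuous_on_coordinate_bound)
  let ?I = "(\<lambda>j. prod_encode (q, j)) ` {..2 ^ \<kappa> q}" and ?J = "(\<lambda>j. prod_encode (Suc q, j)) ` {..2 ^ \<kappa> (Suc q)}"
  let ?d = "mdist (linf {0..1})"
  show "finite (?I \<union> ?J)" by simp
  fix v v' :: "nat \<Rightarrow> real"
  have inj: "inj_on (\<lambda>j. prod_encode (q, j)) S" for q S by (auto simp: inj_on_def)
  have disj: "?I \<inter> ?J = {}" by (auto simp: prod_encode_eq)
  have tri: "\<bar>?d a b - ?d a' b'\<bar> \<le> ?d a a' + ?d b b'"
    if "a \<in> mspace (linf {0..1})" "b \<in> mspace (linf {0..1})" "a' \<in> mspace (linf {0..1})" "b' \<in> mspace (linf {0..1})"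
    for a b a' b' :: "real \<Rightarrow> real"
    using mdist_triangle[OF that(1,3,2)] mdist_triangle[OF that(3,4,2)] mdist_triangle[OF that(3,1,4)] mdist_triangle[OF that(1,2,4)]
      mdist_commute[of "linf {0..1}" a a'] mdist_commute[of "linf {0..1}" b b'] by linarith
  have "\<bar>step_gap \<kappa> q v - step_gap \<kappa> q v'\<bar> \<le> ?d (step_path \<kappa> (Suc q) v) (step_path \<kappa> (Suc q) v') + ?d (step_path \<kappa> q v) (step_path \<kappa> q v')"
    unfolding step_gap_def by (rule tri) (rule step_path_space)+
  also have "\<dots> \<le> (\<Sum>i\<in>?J. \<bar>v i - v' i\<bar>) + (\<Sum>i\<in>?I. \<bar>v i - v' i\<bar>)"
    by (intro add_mono) (auto simp: sum.reindex[OF inj] intro!: order_trans[OF step_path_dist])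
  also have "\<dots> = (\<Sum>i\<in>?I \<union> ?J. \<bar>v i - v' i\<bar>)"
    using disj by (subst sum.union_disjoint) auto
  finally show "\<bar>step_gap \<kappa> q v - step_gap \<kappa> q v'\<bar> \<le> 1 * (\<Sum>i\<in>?I \<union> ?J. \<bar>v i - v' i\<bar>)" by simp
qed

lemma closed_tame: "closed (tame \<kappa> q0)"
proof -
  have "tame \<kappa> q0 = (\<Inter>q\<in>{q0..}. {v. step_gap \<kappa> q v \<le> 2 * (1/2) ^ q})" by (auto simp: tame_def)
  then show ?thesis
    using step_gap_continuous by (auto intro!: closed_INT closed_Collect_le continuous_intros)
qed

lemma limit_path_approx:
  assumes v: "v \<in> tame \<kappa> q0" and q: "q \<ge> q0"
  shows "limit_path \<kappa> v \<in> mspace (linf {0..1})"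
    "mdist (linf {0..1}) (limit_path \<kappa> v) (step_path \<kappa> q v) \<le> 4 * (1/2) ^ q"
proof -
  have step: "\<bar>step_path \<kappa> (Suc r) v t - step_path \<kappa> r v t\<bar> \<le> 2 * (1/2) ^ r" if "r \<ge> q0" "t \<in> {0..1}" for r t
    using order_trans[OF linf_le_dist[OF step_path_space step_path_space that(2)]] v that(1)
    by (auto simp: tame_def step_gap_def)
  have far: "\<bar>step_path \<kappa> (r + p) v t - step_path \<kappa> r v t\<bar> \<le> 4 * (1/2) ^ r - 4 * (1/2) ^ (r + p)"
    if "r \<ge> q0" "t \<in> {0..1}" for r p t
  proof (induction p)
    case (Suc p)
    have "\<bar>step_path \<kappa> (Suc (r + p)) v t - step_path \<kappa> (r + p) v t\<bar> \<le> 2 * (1/2) ^ (r + p)"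
      using that by (intro step) auto
    moreover have "4 * (1/2::real) ^ Suc (r + p) = 2 * (1/2) ^ (r + p)" by simp
    ultimately show ?case using Suc by (simp only: add_Suc_right)
  qed simp
  have far': "\<bar>step_path \<kappa> r' v t - step_path \<kappa> r v t\<bar> \<le> 4 * (1/2) ^ r" if "r \<ge> q0" "r' \<ge> r" "t \<in> {0..1}" for r r' t
  proof -
    have "(0::real) \<le> 4 * (1/2) ^ (r + (r' - r))" and eq: "r + (r' - r) = r'" using that(2) by simp_all
    then show ?thesis using far[OF that(1,3), of "r' - r"] unfolding eq by linarith
  qed
  have conv: "(\<lambda>q. step_path \<kappa> q v t) \<longlonglongrightarrow> limit_path \<kappa> v t" if t: "t \<in> {0..1}" for t
  proof -
    have "Cauchy (\<lambda>q. step_path \<kappa> q v t)"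
    proof (rule metric_CauchyI)
      fix e :: real assume e: "e > 0"
      obtain r0 where r0: "(1/2::real) ^ r0 < e / 8" using real_arch_pow_inv[of "e / 8" "1/2"] e by auto
      define r where "r = max r0 q0"
      have "(1/2::real) ^ r \<le> (1/2) ^ r0" by (intro power_decreasing) (auto simp: r_def)
      then have r: "4 * (1/2::real) ^ r < e / 2" "r \<ge> q0" using r0 by (linarith, simp add: r_def)
      show "\<exists>K. \<forall>m\<ge>K. \<forall>n\<ge>K. dist (step_path \<kappa> m v t) (step_path \<kappa> n v t) < e"
      proof (intro exI[of _ r] allI impI)
        fix m n assume mn: "r \<le> m" "r \<le> n"
        show "dist (step_path \<kappa> m v t) (step_path \<kappa> n v t) < e"
          using far'[OF r(2) mn(1) t] far'[OF r(2) mn(2) t] r(1) by (simp add: dist_real_def)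
      qed
    qed
    then have "convergent (\<lambda>q. step_path \<kappa> q v t)" by (rule Cauchy_convergent)
    then show ?thesis using v t by (auto simp: limit_path_def convergent_LIMSEQ_iff)
  qed
  have close: "\<bar>limit_path \<kappa> v t - step_path \<kappa> r v t\<bar> \<le> 4 * (1/2) ^ r" if r: "r \<ge> q0" and t: "t \<in> {0..1}" for r t
  proof (rule LIMSEQ_le_const2)
    show "(\<lambda>q. \<bar>step_path \<kappa> q v t - step_path \<kappa> r v t\<bar>) \<longlonglongrightarrow> \<bar>limit_path \<kappa> v t - step_path \<kappa> r v t\<bar>"
      by (intro tendsto_intros conv t)
    show "\<exists>N. \<forall>n\<ge>N. \<bar>step_path \<kappa> n v t - step_path \<kappa> r v t\<bar> \<le> 4 * (1/2) ^ r"
      using far'[OF r _ t] by blast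
  qed
  have "\<exists>B. \<forall>t\<in>{0..1}. \<bar>step_path \<kappa> q v t\<bar> \<le> B"
    using step_path_space[of \<kappa> q v] by (simp add: linf_space bounded_iff)
  then obtain B where B: "\<And>t. t \<in> {0..1} \<Longrightarrow> \<bar>step_path \<kappa> q v t\<bar> \<le> B" by blast
  have "\<bar>limit_path \<kappa> v t\<bar> \<le> B + 4 * (1/2) ^ q" if "t \<in> {0..1}" for t
    using B[OF that] close[OF q that] by linarith
  then have "bounded (limit_path \<kappa> v ` {0..1})"
    by (intro boundedI[where B="B + 4 * (1/2) ^ q"]) (auto simp del: atLeastAtMost_iff)
  then show sp: "limit_path \<kappa> v \<in> mspace (linf {0..1})" by (simp add: linf_space limit_path_def)
  show "mdist (linf {0..1}) (limit_path \<kappa> v) (step_path \<kappa> q v) \<le> 4 * (1/2) ^ q"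
    by (rule linf_dist_le[OF sp step_path_space]) (use close[OF q] in auto)
qed

lemma limit_path_space: "limit_path \<kappa> v \<in> mspace (linf {0..1})"
proof (cases "\<exists>q0. v \<in> tame \<kappa> q0")
  case True
  then show ?thesis using limit_path_approx(1) by blast
next
  case False
  then have "limit_path \<kappa> v = (\<lambda>t\<in>{0..1}. 0)" by (simp add: limit_path_def)
  then show ?thesis by (auto simp: linf_space bounded_iff)
qed

lemma lipschitz_limit_path:
  assumes h: "\<And>z z'. z \<in> mspace (linf {0..1}) \<Longrightarrow> z' \<in> mspace (linf {0..1}) \<Longrightarrow> \<bar>h z - h z'\<bar> \<le> c * mdist (linf {0..1}) z z'"
    and v: "v \<in> tame \<kappa> q0"
  shows "(\<lambda>q. h (step_path \<kappa> q v)) \<longlonglongrightarrow> h (limit_path \<kappa> v)"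
proof (rule LIM_zero_cancel, rule Lim_null_comparison)
  have "(\<lambda>q. \<bar>c\<bar> * (4 * (1/2::real) ^ q)) \<longlonglongrightarrow> \<bar>c\<bar> * (4 * 0)"
    by (intro tendsto_intros LIMSEQ_power_zero) simp
  then show "(\<lambda>q. \<bar>c\<bar> * (4 * (1/2::real) ^ q)) \<longlonglongrightarrow> 0" by simp
  show "\<forall>\<^sub>F q in sequentially. norm (h (step_path \<kappa> q v) - h (limit_path \<kappa> v)) \<le> \<bar>c\<bar> * (4 * (1/2) ^ q)"
    unfolding eventually_sequentially
  proof (intro exI[of _ q0] allI impI)
    fix q assume q: "q0 \<le> q"
    have "\<bar>h (step_path \<kappa> q v) - h (limit_path \<kappa> v)\<bar> \<le> c * mdist (linf {0..1}) (step_path \<kappa> q v) (limit_path \<kappa> v)"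
      by (intro h step_path_space limit_path_space)
    also have "\<dots> \<le> \<bar>c\<bar> * mdist (linf {0..1}) (step_path \<kappa> q v) (limit_path \<kappa> v)"
      by (intro mult_right_mono) auto
    also have "\<dots> \<le> \<bar>c\<bar> * (4 * (1/2) ^ q)"
      using limit_path_approx(2)[OF v q] by (intro mult_left_mono) (auto simp: mdist_commute)
    finally show "norm (h (step_path \<kappa> q v) - h (limit_path \<kappa> v)) \<le> \<bar>c\<bar> * (4 * (1/2) ^ q)" by simp
  qed
qed

lemma limit_path_measurable: "limit_path \<kappa> \<in> measurable borel (borel_metric (linf {0..1}))"
  unfolding borel_metric_def
proof (rule measurable_measure_of)
  let ?m = "linf {0..1::real}"
  show "{U. openin (mtopology_of ?m) U} \<subseteq> Pow (mspace ?m)" using openin_subset by fastforce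
  show "limit_path \<kappa> \<in> space borel \<rightarrow> mspace ?m" using limit_path_space by auto
  fix U assume "U \<in> {U. openin (mtopology_of ?m) U}"
  then have U: "openin (mtopology_of ?m) U" by simp
  define h :: "(real \<Rightarrow> real) \<Rightarrow> real" where "h = indicator U"
  define G where "G = (\<Union>q0. tame \<kappa> q0)"
  have G[measurable]: "G \<in> sets borel" unfolding G_def by (intro sets.countable_UN) (auto intro: borel_closed closed_tame)
  have hB: "\<bar>h w\<bar> \<le> 1" for w by (simp add: h_def indicator_def)
  have lip: "\<bar>lip_env ?m h j z - lip_env ?m h j z'\<bar> \<le> real j * mdist ?m z z'" if "z \<in> mspace ?m" "z' \<in> mspace ?m" for j z z'
    by (rule lip_env_lipschitz[where B=1]) (use hB that in auto)
  have m[measurable]: "(\<lambda>v. lip_env ?m h j (step_path \<kappa> q v)) \<in> borel_measurable borel" for j q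
    by (rule borel_measurable_continuous_onI, rule lipschitz_step_continuous, rule lip)
  define g where "g v = lim (\<lambda>j. lim (\<lambda>q. lip_env ?m h j (step_path \<kappa> q v)))" for v
  have gm[measurable]: "g \<in> borel_measurable borel" unfolding g_def[abs_def] by measurable
  have gh: "g v = h (limit_path \<kappa> v)" if vG: "v \<in> G" for v
  proof -
    obtain q0 where v: "v \<in> tame \<kappa> q0" using vG by (auto simp: G_def)
    have "(\<lambda>q. lip_env ?m h j (step_path \<kappa> q v)) \<longlonglongrightarrow> lip_env ?m h j (limit_path \<kappa> v)" for j
      by (rule lipschitz_limit_path[OF lip v])
    then have "lim (\<lambda>q. lip_env ?m h j (step_path \<kappa> q v)) = lip_env ?m h j (limit_path \<kappa> v)" for j
      by (rule limI)
    then have "g v = lim (\<lambda>j. lip_env ?m h j (limit_path \<kappa> v))" by (simp add: g_def)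
    moreover have "(\<lambda>j. lip_env ?m h j (limit_path \<kappa> v)) \<longlonglongrightarrow> h (limit_path \<kappa> v)"
    proof (rule lip_env_tendsto[where B=1])
      fix e :: real assume e: "e > 0"
      show "\<exists>\<delta>>0. \<forall>w\<in>mspace ?m. mdist ?m (limit_path \<kappa> v) w < \<delta> \<longrightarrow> h w > h (limit_path \<kappa> v) - e"
      proof (cases "limit_path \<kappa> v \<in> U")
        case True
        obtain \<delta> where \<delta>: "\<delta> > 0" "\<forall>w\<in>mspace ?m. mdist ?m (limit_path \<kappa> v) w < \<delta> \<longrightarrow> w \<in> U"
          using openin_metric_nbhd[OF U True] by (elim exE conjE)
        then show ?thesis using e True by (intro exI[of _ \<delta>]) (simp add: h_def)
      next
        case False
        then show ?thesis using e by (intro exI[of _ 1]) (simp add: h_def indicator_def)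
      qed
    qed (use hB limit_path_space in auto)
    ultimately show ?thesis by (simp add: limI)
  qed
  have "limit_path \<kappa> -` U = {v. v \<in> G \<and> g v > 1/2} \<union> {v. v \<notin> G \<and> (\<lambda>t\<in>{0..1}. 0) \<in> U}"
  proof -
    have "limit_path \<kappa> v \<in> U \<longleftrightarrow> g v > 1/2" if "v \<in> G" for v
      using gh[OF that] by (simp add: h_def indicator_def)
    moreover have "limit_path \<kappa> v = (\<lambda>t\<in>{0..1}. 0)" if "v \<notin> G" for v
      using that by (simp add: limit_path_def G_def)
    ultimately have "limit_path \<kappa> v \<in> U \<longleftrightarrow> v \<in> G \<and> g v > 1/2 \<or> v \<notin> G \<and> (\<lambda>t\<in>{0..1}. 0) \<in> U" for v
      by (cases "v \<in> G") simp_all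
    then show ?thesis by blast
  qed
  also have "\<dots> \<in> sets borel" by measurable
  finally show "limit_path \<kappa> -` U \<inter> space borel \<in> sets borel" by simp
qed

section \<open>Tight limits of equicontinuous processes\<close>

lemma dyadic_floor_nested:
  fixes t :: real
  assumes "a \<le> b"
  shows "\<lfloor>2 ^ a * (of_int \<lfloor>2 ^ b * t\<rfloor> / 2 ^ b :: real)\<rfloor> = \<lfloor>2 ^ a * t\<rfloor>"
proof (rule floor_unique)
  let ?n = "\<lfloor>2 ^ a * t\<rfloor>"
  have split: "(2::real) ^ b = 2 ^ a * 2 ^ (b - a)" using assms by (simp flip: power_add)
  have "of_int (?n * 2 ^ (b - a)) \<le> (2 ^ a * t) * 2 ^ (b - a)"
    unfolding of_int_mult by (simp add: mult_right_mono)
  also have "\<dots> = 2 ^ b * t" by (simp add: split)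
  finally have "?n * 2 ^ (b - a) \<le> \<lfloor>2 ^ b * t\<rfloor>" by (simp only: le_floor_iff)
  then have "of_int (?n * 2 ^ (b - a)) \<le> (of_int \<lfloor>2 ^ b * t\<rfloor> :: real)" by (simp only: of_int_le_iff)
  then have "real_of_int ?n * 2 ^ (b - a) \<le> of_int \<lfloor>2 ^ b * t\<rfloor>" by simp
  then show "real_of_int ?n \<le> 2 ^ a * (of_int \<lfloor>2 ^ b * t\<rfloor> / 2 ^ b)"
    unfolding split by (simp add: field_simps)
  have "of_int \<lfloor>2 ^ b * t\<rfloor> / 2 ^ b \<le> t" by (simp add: pos_divide_le_eq mult.commute)
  then have "2 ^ a * (of_int \<lfloor>2 ^ b * t\<rfloor> / 2 ^ b) \<le> 2 ^ a * t" by (intro mult_left_mono) auto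
  then show "2 ^ a * (of_int \<lfloor>2 ^ b * t\<rfloor> / 2 ^ b) < real_of_int ?n + 1" by linarith
qed

locale equicontinuous_paths = prob_space M for M :: "'a measure" +
  fixes Z :: "nat \<Rightarrow> 'a \<Rightarrow> real \<Rightarrow> real" and \<kappa> :: "nat \<Rightarrow> nat" and N :: "(nat \<Rightarrow> real) measure"
  assumes \<kappa>_mono: "\<And>q. \<kappa> q \<le> \<kappa> (Suc q)"
    and Z_meas: "\<And>n t. (\<lambda>\<omega>. Z n \<omega> t) \<in> borel_measurable M"
    and Z_bounded: "\<And>n \<omega>. bounded (Z n \<omega> ` {0..1})"
    and oscillation: "\<And>q. \<exists>n0. \<forall>n\<ge>n0. \<exists>E\<in>events. prob E \<le> (1/2) ^ q \<and>
      (\<forall>\<omega>\<in>space M - E. \<forall>t\<in>{0..1}. \<bar>Z n \<omega> t - Z n \<omega> (of_int \<lfloor>2 ^ \<kappa> q * t\<rfloor> / 2 ^ \<kappa> q)\<bar> \<le> (1/2) ^ q)"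
    and prob_N: "prob_space N" and sets_N: "sets N = sets borel"
    and grid_conv: "\<And>(f :: (nat \<Rightarrow> real) \<Rightarrow> real) B. continuous_on UNIV f \<Longrightarrow> (\<And>x. \<bar>f x\<bar> \<le> B) \<Longrightarrow>
      (\<lambda>n. \<integral>\<omega>. f (\<lambda>i. Z n \<omega> (grid_point \<kappa> i)) \<partial>M) \<longlonglongrightarrow> (\<integral>v. f v \<partial>N)"
begin

sublocale N: prob_space N by (rule prob_N)

abbreviation V :: "nat \<Rightarrow> 'a \<Rightarrow> nat \<Rightarrow> real" where
  "V n \<omega> \<equiv> (\<lambda>i. Z n \<omega> (grid_point \<kappa> i))"

abbreviation sample_path :: "nat \<Rightarrow> 'a \<Rightarrow> real \<Rightarrow> real" where
  "sample_path n \<omega> \<equiv> (\<lambda>t\<in>{0..1}. Z n \<omega> t)"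

abbreviation limit_law :: "(real \<Rightarrow> real) measure" where
  "limit_law \<equiv> distr N (borel_metric (linf {0..1})) (limit_path \<kappa>)"

lemma space_N [simp]: "space N = UNIV"
  using sets_eq_imp_space_eq[OF sets_N] by simp

lemma V_meas [measurable]: "V n \<in> borel_measurable M"
  by (rule measurable_coordinatewise_then_product) (rule Z_meas)

lemma continuous_meas_N: "continuous_on UNIV (f :: (nat \<Rightarrow> real) \<Rightarrow> real) \<Longrightarrow> f \<in> borel_measurable N"
  using borel_measurable_continuous_onI by (simp add: measurable_cong_sets[OF sets_N refl])

lemma continuous_meas_V: "continuous_on UNIV (f :: (nat \<Rightarrow> real) \<Rightarrow> real) \<Longrightarrow> (\<lambda>\<omega>. f (V n \<omega>)) \<in> borel_measurable M"
  using measurable_compose[OF V_meas borel_measurable_continuous_onI] by simp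

lemma limit_path_meas_N: "limit_path \<kappa> \<in> measurable N (borel_metric (linf {0..1}))"
  using limit_path_measurable by (simp add: measurable_cong_sets[OF sets_N refl])

lemma sample_path_space: "sample_path n \<omega> \<in> mspace (linf {0..1})"
proof -
  have "sample_path n \<omega> ` {0..1} = Z n \<omega> ` {0..1}" by (rule image_cong) auto
  then show ?thesis using Z_bounded[of n \<omega>] by (simp add: linf_space)
qed

lemma step_V: "t \<in> {0..1} \<Longrightarrow> step_path \<kappa> q (V n \<omega>) t = Z n \<omega> (of_int \<lfloor>2 ^ \<kappa> q * t\<rfloor> / 2 ^ \<kappa> q)"
  by (simp add: step_path_def grid_point_index del: atLeastAtMost_iff)

lemma oscillation_event:
  "\<exists>n0. \<forall>n\<ge>n0. \<exists>E\<in>events. prob E \<le> (1/2) ^ q \<and> (\<forall>\<omega>\<in>space M - E.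
     mdist (linf {0..1}) (sample_path n \<omega>) (step_path \<kappa> q (V n \<omega>)) \<le> (1/2) ^ q \<and> step_gap \<kappa> q (V n \<omega>) \<le> (1/2) ^ q)"
proof -
  obtain n0 where n0: "\<And>n. n \<ge> n0 \<Longrightarrow> \<exists>E\<in>events. prob E \<le> (1/2) ^ q \<and>
      (\<forall>\<omega>\<in>space M - E. \<forall>t\<in>{0..1}. \<bar>Z n \<omega> t - Z n \<omega> (of_int \<lfloor>2 ^ \<kappa> q * t\<rfloor> / 2 ^ \<kappa> q)\<bar> \<le> (1/2) ^ q)"
    using oscillation[of q] by blast
  show ?thesis
  proof (intro exI[of _ n0] allI impI)
    fix n assume "n0 \<le> n"
    then obtain E where E: "E \<in> events" "prob E \<le> (1/2) ^ q"
      "\<And>\<omega> t. \<omega> \<in> space M - E \<Longrightarrow> t \<in> {0..1} \<Longrightarrow> \<bar>Z n \<omega> t - Z n \<omega> (of_int \<lfloor>2 ^ \<kappa> q * t\<rfloor> / 2 ^ \<kappa> q)\<bar> \<le> (1/2) ^ q"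
      using n0[of n] by blast
    show "\<exists>E\<in>events. prob E \<le> (1/2) ^ q \<and> (\<forall>\<omega>\<in>space M - E.
     mdist (linf {0..1}) (sample_path n \<omega>) (step_path \<kappa> q (V n \<omega>)) \<le> (1/2) ^ q \<and> step_gap \<kappa> q (V n \<omega>) \<le> (1/2) ^ q)"
    proof (intro bexI[of _ E] conjI ballI E)
      fix \<omega> assume \<omega>: "\<omega> \<in> space M - E"
      show "mdist (linf {0..1}) (sample_path n \<omega>) (step_path \<kappa> q (V n \<omega>)) \<le> (1/2) ^ q"
        by (rule linf_dist_le[OF sample_path_space step_path_space]) (use E(3)[OF \<omega>] step_V in auto)
      show "step_gap \<kappa> q (V n \<omega>) \<le> (1/2) ^ q"
        unfolding step_gap_def
      proof (rule linf_dist_le[OF step_path_space step_path_space])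
        fix t :: real assume t: "t \<in> {0..1}"
        define s where "s = grid_point \<kappa> (grid_index \<kappa> (Suc q) t)"
        have s: "s \<in> {0..1}" unfolding s_def by (rule grid_point_in)
        have s_eq: "s = of_int \<lfloor>2 ^ \<kappa> (Suc q) * t\<rfloor> / 2 ^ \<kappa> (Suc q)"
          unfolding s_def by (rule grid_point_index[OF t])
        have "\<lfloor>2 ^ \<kappa> q * s\<rfloor> = \<lfloor>2 ^ \<kappa> q * t\<rfloor>"
          unfolding s_eq by (rule dyadic_floor_nested[OF \<kappa>_mono])
        then show "\<bar>step_path \<kappa> (Suc q) (V n \<omega>) t - step_path \<kappa> q (V n \<omega>) t\<bar> \<le> (1/2) ^ q"
          using E(3)[OF \<omega> s] unfolding step_V[OF t] s_eq[symmetric] by simp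
      qed simp
    qed
  qed
qed

lemma step_gap_tail: "N.prob {v. step_gap \<kappa> q v > 2 * (1/2) ^ q} \<le> (1/2) ^ q"
proof -
  define e :: real where "e = (1/2) ^ q"
  have e: "e > 0" by (simp add: e_def)
  define \<phi> :: "(nat \<Rightarrow> real) \<Rightarrow> real" where "\<phi> v = max 0 (min 1 (step_gap \<kappa> q v / e - 1))" for v
  have \<phi>c: "continuous_on UNIV \<phi>"
    unfolding \<phi>_def[abs_def] using step_gap_continuous e by (intro continuous_intros) auto
  have \<phi>b: "0 \<le> \<phi> v" "\<phi> v \<le> 1" "\<bar>\<phi> v\<bar> \<le> 1" for v by (auto simp: \<phi>_def)
  have lim: "(\<lambda>n. \<integral>\<omega>. \<phi> (V n \<omega>) \<partial>M) \<longlonglongrightarrow> (\<integral>v. \<phi> v \<partial>N)" by (rule grid_conv[OF \<phi>c \<phi>b(3)])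
  note [measurable] = continuous_meas_N[OF \<phi>c] continuous_meas_V[OF \<phi>c] continuous_meas_N[OF step_gap_continuous]
  obtain n0 where n0: "\<And>n. n \<ge> n0 \<Longrightarrow> \<exists>E\<in>events. prob E \<le> e \<and> (\<forall>\<omega>\<in>space M - E.
     mdist (linf {0..1}) (sample_path n \<omega>) (step_path \<kappa> q (V n \<omega>)) \<le> e \<and> step_gap \<kappa> q (V n \<omega>) \<le> e)"
    using oscillation_event[of q] unfolding e_def by blast
  have bound: "(\<integral>\<omega>. \<phi> (V n \<omega>) \<partial>M) \<le> e" if n: "n \<ge> n0" for n
  proof -
    obtain E where E: "E \<in> events" "prob E \<le> e" "\<And>\<omega>. \<omega> \<in> space M - E \<Longrightarrow> step_gap \<kappa> q (V n \<omega>) \<le> e"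
      using n0[OF n] by blast
    have "(\<integral>\<omega>. \<phi> (V n \<omega>) \<partial>M) \<le> (\<integral>\<omega>. indicator E \<omega> \<partial>M)"
    proof (rule integral_mono)
      show "integrable M (\<lambda>\<omega>. \<phi> (V n \<omega>))" by (rule integrable_const_bound[where B=1]) (use \<phi>b in auto)
      show "integrable M (indicator E :: 'a \<Rightarrow> real)" using E(1) by (simp add: emeasure_eq_measure)
      fix \<omega> assume \<omega>: "\<omega> \<in> space M"
      show "\<phi> (V n \<omega>) \<le> indicator E \<omega>"
      proof (cases "\<omega> \<in> E")
        case False
        then have "step_gap \<kappa> q (V n \<omega>) / e - 1 \<le> 0" using E(3)[of \<omega>] \<omega> e by (simp add: pos_divide_le_eq)
        then show ?thesis using False by (simp add: \<phi>_def min_le_iff_disj)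
      qed (use \<phi>b in simp)
    qed
    also have "\<dots> = prob E" using E(1) by simp
    finally show ?thesis using E(2) by simp
  qed
  have "N.prob {v. step_gap \<kappa> q v > 2 * e} = (\<integral>v. indicator {v. step_gap \<kappa> q v > 2 * e} v \<partial>N)" by simp
  also have "\<dots> \<le> (\<integral>v. \<phi> v \<partial>N)"
  proof (rule integral_mono)
    have "{v \<in> space N. step_gap \<kappa> q v > 2 * e} \<in> sets N" by measurable
    then show "integrable N (indicator {v. step_gap \<kappa> q v > 2 * e} :: _ \<Rightarrow> real)" by (simp add: N.emeasure_eq_measure)
    show "integrable N \<phi>" by (rule N.integrable_const_bound[where B=1]) (use \<phi>b in auto)
    show "indicator {v. step_gap \<kappa> q v > 2 * e} v \<le> \<phi> v" for v
    proof (cases "step_gap \<kappa> q v > 2 * e")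
      case True
      then have "step_gap \<kappa> q v / e \<ge> 2" using e by (simp add: pos_le_divide_eq)
      then have "\<phi> v = 1" by (simp add: \<phi>_def)
      then show ?thesis by (simp add: indicator_def)
    qed (use \<phi>b in simp)
  qed
  also have "\<dots> \<le> e" using bound by (intro LIMSEQ_le_const2[OF lim]) blast
  finally show ?thesis by (simp add: e_def)
qed

lemma tame_sets: "tame \<kappa> q0 \<in> sets N"
  unfolding sets_N by (rule borel_closed[OF closed_tame])

lemma tame_prob: "N.prob (- tame \<kappa> q0) \<le> 2 * (1/2) ^ q0"
proof -
  let ?A = "\<lambda>p. {v. step_gap \<kappa> (q0 + p) v > 2 * (1/2) ^ (q0 + p)}"
  have A: "?A p \<in> sets N" for p
  proof -
    have "{v \<in> space N. step_gap \<kappa> (q0 + p) v > 2 * (1/2) ^ (q0 + p)} \<in> sets N"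
      using continuous_meas_N[OF step_gap_continuous] by measurable
    then show ?thesis by simp
  qed
  have "(\<lambda>p. (1/2::real) ^ p) sums 2" using geometric_sums[of "1/2::real"] by simp
  then have s: "(\<lambda>p. (1/2::real) ^ (q0 + p)) sums ((1/2) ^ q0 * 2)"
    unfolding power_add by (rule sums_mult)
  have sm: "summable (\<lambda>p. N.prob (?A p))"
    by (rule summable_comparison_test_ev[OF _ sums_summable[OF s]]) (use step_gap_tail in auto)
  have "- tame \<kappa> q0 = (\<Union>p. ?A p)"
  proof (intro set_eqI iffI)
    fix v assume "v \<in> - tame \<kappa> q0"
    then obtain q where q: "q \<ge> q0" "step_gap \<kappa> q v > 2 * (1/2) ^ q" by (auto simp: tame_def not_le)
    then have "v \<in> ?A (q - q0)" by simp
    then show "v \<in> (\<Union>p. ?A p)" by blast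
  next
    fix v assume "v \<in> (\<Union>p. ?A p)"
    then obtain p where "step_gap \<kappa> (q0 + p) v > 2 * (1/2) ^ (q0 + p)" by blast
    then show "v \<in> - tame \<kappa> q0" by (auto simp: tame_def not_le intro!: exI[of _ "q0 + p"])
  qed
  also have "N.prob \<dots> \<le> (\<Sum>p. N.prob (?A p))"
    by (rule N.finite_measure_subadditive_countably[OF _ sm]) (use A in auto)
  also have "\<dots> \<le> (\<Sum>p. (1/2) ^ (q0 + p))"
    by (rule suminf_le[OF step_gap_tail sm sums_summable[OF s]])
  also have "\<dots> = 2 * (1/2) ^ q0" using sums_unique[OF s] by simp
  finally show ?thesis .
qed

lemma AE_tame: "AE v in N. \<exists>q0. v \<in> tame \<kappa> q0"
proof -
  let ?B = "- (\<Union>q0. tame \<kappa> q0)"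
  have B: "?B \<in> sets N"
  proof -
    have "(\<Union>q0. tame \<kappa> q0) \<in> sets N" by (intro sets.countable_UN) (use tame_sets in auto)
    then show ?thesis using sets.compl_sets[of "\<Union>q0. tame \<kappa> q0" N] by (simp add: Compl_eq_Diff_UNIV)
  qed
  have "N.prob ?B \<le> 2 * (1/2) ^ q0" for q0
  proof -
    have "- tame \<kappa> q0 \<in> sets N" using sets.compl_sets[OF tame_sets[of q0]] by (simp add: Compl_eq_Diff_UNIV)
    then show ?thesis by (intro order_trans[OF N.finite_measure_mono tame_prob[of q0]]) auto
  qed
  moreover have lim: "(\<lambda>q0. 2 * (1/2::real) ^ q0) \<longlonglongrightarrow> 2 * 0"
    by (intro tendsto_intros LIMSEQ_power_zero) simp
  ultimately have "N.prob ?B \<le> 2 * 0" by (intro LIMSEQ_le_const[OF lim]) blast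
  then have "N.prob ?B = 0" by (simp add: measure_le_0_iff)
  then have "?B \<in> null_sets N" using B by (simp add: null_sets_def N.emeasure_eq_measure)
  then show ?thesis by (rule AE_I') auto
qed

lemma limit_law_conv: "hj_weak_conv (linf {0..1}) M sample_path limit_law"
proof (rule hj_weak_conv_of_lipschitz)
  let ?m = "linf {0..1::real}"
  show "prob_space M" by (rule prob_space_axioms)
  show "sample_path n \<in> space M \<rightarrow> mspace ?m" for n using sample_path_space by blast
  show "prob_space limit_law" by (rule N.prob_space_distr[OF limit_path_meas_N])
  show "sets limit_law = sets (borel_metric ?m)" by simp
  fix h :: "(real \<Rightarrow> real) \<Rightarrow> real" and B c
  assume hB: "\<And>z. z \<in> mspace ?m \<Longrightarrow> \<bar>h z\<bar> \<le> B"
    and hl: "\<And>z z'. z \<in> mspace ?m \<Longrightarrow> z' \<in> mspace ?m \<Longrightarrow> \<bar>h z - h z'\<bar> \<le> c * mdist ?m z z'"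
  have B0: "B \<ge> 0" using hB[OF sample_path_space[of 0 undefined]] by linarith
  have hstep: "continuous_on UNIV (\<lambda>v. h (step_path \<kappa> q v))" for q by (rule lipschitz_step_continuous[OF hl])
  have hm: "h \<in> borel_measurable (borel_metric ?m)"
    by (rule continuous_borel_metric, rule lipschitz_continuous_map, rule hl)
  have lawint: "(\<integral>z. h z \<partial>limit_law) = (\<integral>v. h (limit_path \<kappa> v) \<partial>N)"
    by (rule integral_distr[OF limit_path_meas_N hm])
  have lim1: "(\<lambda>q. \<integral>v. h (step_path \<kappa> q v) \<partial>N) \<longlonglongrightarrow> (\<integral>v. h (limit_path \<kappa> v) \<partial>N)"
  proof (rule integral_dominated_convergence[where w="\<lambda>_. B"])
    show "(\<lambda>v. h (limit_path \<kappa> v)) \<in> borel_measurable N" by (rule measurable_compose[OF limit_path_meas_N hm])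
    show "(\<lambda>v. h (step_path \<kappa> q v)) \<in> borel_measurable N" for q by (rule continuous_meas_N[OF hstep])
    show "AE v in N. (\<lambda>q. h (step_path \<kappa> q v)) \<longlonglongrightarrow> h (limit_path \<kappa> v)"
      using AE_tame by eventually_elim (auto intro: lipschitz_limit_path[OF hl])
    show "AE v in N. norm (h (step_path \<kappa> q v)) \<le> B" for q
      using hB[OF step_path_space] by (intro AE_I2) simp
  qed simp
  show "(\<lambda>n. outer_expectation M (\<lambda>\<omega>. h (sample_path n \<omega>))) \<longlonglongrightarrow> (\<integral>z. h z \<partial>limit_law)"
    unfolding lawint
  proof (rule LIMSEQ_I)
    fix r :: real assume r: "r > 0"
    define C where "C = \<bar>c\<bar> + 2 * B"
    have C0: "C \<ge> 0" using B0 by (simp add: C_def)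
    have "(\<lambda>q. C * (1/2::real) ^ q) \<longlonglongrightarrow> C * 0" by (intro tendsto_intros LIMSEQ_power_zero) simp
    then have "eventually (\<lambda>q. C * (1/2::real) ^ q < r / 3) sequentially" using r by (intro order_tendstoD(2)) auto
    moreover have "eventually (\<lambda>q. \<bar>(\<integral>v. h (step_path \<kappa> q v) \<partial>N) - (\<integral>v. h (limit_path \<kappa> v) \<partial>N)\<bar> < r / 3) sequentially"
      using tendstoD[OF lim1, of "r / 3"] r by (simp add: dist_real_def)
    ultimately obtain q where q: "C * (1/2::real) ^ q < r / 3"
      "\<bar>(\<integral>v. h (step_path \<kappa> q v) \<partial>N) - (\<integral>v. h (limit_path \<kappa> v) \<partial>N)\<bar> < r / 3"
      using eventually_happens[OF eventually_conj] by fastforce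
    have "(\<lambda>n. \<integral>\<omega>. h (step_path \<kappa> q (V n \<omega>)) \<partial>M) \<longlonglongrightarrow> (\<integral>v. h (step_path \<kappa> q v) \<partial>N)"
      by (rule grid_conv[OF hstep hB[OF step_path_space]])
    from LIMSEQ_D[OF this, of "r / 3"] r obtain n1 where n1: "\<And>n. n \<ge> n1 \<Longrightarrow>
        \<bar>(\<integral>\<omega>. h (step_path \<kappa> q (V n \<omega>)) \<partial>M) - (\<integral>v. h (step_path \<kappa> q v) \<partial>N)\<bar> < r / 3" by auto
    obtain n0 where n0: "\<And>n. n \<ge> n0 \<Longrightarrow> \<exists>E\<in>events. prob E \<le> (1/2) ^ q \<and> (\<forall>\<omega>\<in>space M - E.
     mdist (linf {0..1}) (sample_path n \<omega>) (step_path \<kappa> q (V n \<omega>)) \<le> (1/2) ^ q \<and> step_gap \<kappa> q (V n \<omega>) \<le> (1/2) ^ q)"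
      using oscillation_event[of q] by blast
    show "\<exists>no. \<forall>n\<ge>no. norm (outer_expectation M (\<lambda>\<omega>. h (sample_path n \<omega>)) - (\<integral>v. h (limit_path \<kappa> v) \<partial>N)) < r"
    proof (intro exI[of _ "max n0 n1"] allI impI)
      fix n assume n: "max n0 n1 \<le> n"
      obtain E where E[measurable]: "E \<in> events" and PE: "prob E \<le> (1/2) ^ q"
        and Ed: "\<And>\<omega>. \<omega> \<in> space M - E \<Longrightarrow> mdist ?m (sample_path n \<omega>) (step_path \<kappa> q (V n \<omega>)) \<le> (1/2) ^ q"
        using n0[of n] n by auto
      let ?g = "\<lambda>\<omega>. h (step_path \<kappa> q (V n \<omega>))"
      let ?d = "\<lambda>\<omega>. \<bar>c\<bar> * (1/2) ^ q + 2 * B * indicator E \<omega>"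
      have gint: "integrable M ?g"
        by (rule integrable_const_bound[where B=B])
           (use hB[OF step_path_space] continuous_meas_V[OF hstep] in auto)
      have dint: "integrable M ?d" by (simp add: emeasure_eq_measure)
      have dI: "(\<integral>\<omega>. ?d \<omega> \<partial>M) = \<bar>c\<bar> * (1/2) ^ q + 2 * B * prob E"
        by (subst Bochner_Integration.integral_add) (auto simp: prob_space emeasure_eq_measure)
      have "2 * B * prob E \<le> 2 * B * (1/2) ^ q" using B0 PE by (intro mult_left_mono) auto
      then have dC: "(\<integral>\<omega>. ?d \<omega> \<partial>M) \<le> C * (1/2) ^ q" unfolding dI C_def by (simp add: distrib_right)
      have diff: "\<bar>h (sample_path n \<omega>) - ?g \<omega>\<bar> \<le> ?d \<omega>" if "\<omega> \<in> space M" for \<omega>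
      proof (cases "\<omega> \<in> E")
        case True
        have "\<bar>h (sample_path n \<omega>) - ?g \<omega>\<bar> \<le> 2 * B"
          using hB[OF sample_path_space[of n \<omega>]] hB[OF step_path_space[of \<kappa> q "V n \<omega>"]] by linarith
        moreover have "0 \<le> \<bar>c\<bar> * (1/2) ^ q" by simp
        moreover have "indicator E \<omega> = (1::real)" using True by simp
        ultimately show ?thesis by (simp only:)
      next
        case False
        have "\<bar>h (sample_path n \<omega>) - ?g \<omega>\<bar> \<le> c * mdist ?m (sample_path n \<omega>) (step_path \<kappa> q (V n \<omega>))"
          by (rule hl[OF sample_path_space step_path_space])
        also have "\<dots> \<le> \<bar>c\<bar> * mdist ?m (sample_path n \<omega>) (step_path \<kappa> q (V n \<omega>))" by (intro mult_right_mono) auto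
        also have "\<dots> \<le> \<bar>c\<bar> * (1/2) ^ q" using Ed[of \<omega>] False that by (intro mult_left_mono) auto
        finally show ?thesis using False by simp
      qed
      have "(\<integral>\<omega>. ?g \<omega> - ?d \<omega> \<partial>M) \<le> outer_expectation M (\<lambda>\<omega>. h (sample_path n \<omega>))"
        "outer_expectation M (\<lambda>\<omega>. h (sample_path n \<omega>)) \<le> (\<integral>\<omega>. ?g \<omega> + ?d \<omega> \<partial>M)"
      proof (rule_tac [!] outer_expectation_bounds)
        fix \<omega> assume \<omega>: "\<omega> \<in> space M"
        show "?g \<omega> - ?d \<omega> \<le> h (sample_path n \<omega>)" "h (sample_path n \<omega>) \<le> ?g \<omega> + ?d \<omega>"
          "?g \<omega> - ?d \<omega> \<le> h (sample_path n \<omega>)" "h (sample_path n \<omega>) \<le> ?g \<omega> + ?d \<omega>"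
          using diff[OF \<omega>] by linarith+
      qed (use gint dint in simp_all)
      then have "\<bar>outer_expectation M (\<lambda>\<omega>. h (sample_path n \<omega>)) - (\<integral>\<omega>. ?g \<omega> \<partial>M)\<bar> \<le> (\<integral>\<omega>. ?d \<omega> \<partial>M)"
        unfolding Bochner_Integration.integral_diff[OF gint dint] Bochner_Integration.integral_add[OF gint dint] by linarith
      then show "norm (outer_expectation M (\<lambda>\<omega>. h (sample_path n \<omega>)) - (\<integral>v. h (limit_path \<kappa> v) \<partial>N)) < r"
        using dC q n1[of n] n unfolding real_norm_def by linarith
    qed
  qed
qed

text \<open>On a compact set of tame sequences the step paths converge uniformly, so that the image of that set
  under \<open>limit_path\<close> is compact.\<close>

lemma limit_law_tight: "tight_law (linf {0..1}) limit_law"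
  unfolding tight_law_def
proof (intro allI impI)
  let ?m = "linf {0..1::real}"
  interpret m: Metric_space "mspace ?m" "mdist ?m" by simp
  fix e :: real assume e: "e > 0"
  have coord: "(\<lambda>v. v i) \<in> borel_measurable N" for i by (rule continuous_meas_N[OF continuous_on_coordinate])
  have "\<exists>R. R > 0 \<and> N.prob {v \<in> space N. \<bar>v i\<bar> > R} \<le> e / 4 * (1/2) ^ Suc i" for i
  proof -
    have "e / 4 * (1/2) ^ Suc i > 0" using e by simp
    from N.random_variable_tight[OF coord this, of i] show ?thesis by blast
  qed
  then have "\<exists>R. \<forall>i. R i > 0 \<and> N.prob {v \<in> space N. \<bar>v i\<bar> > R i} \<le> e / 4 * (1/2) ^ Suc i" by (intro choice allI)
  then obtain R where R: "\<And>i. R i > 0" "\<And>i. N.prob {v \<in> space N. \<bar>v i\<bar> > R i} \<le> e / 4 * (1/2) ^ Suc i" by blast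
  define box where "box = {v :: nat \<Rightarrow> real. \<forall>i. \<bar>v i\<bar> \<le> R i}"
  have box: "compact box" unfolding box_def by (rule compact_box)
  have pbox: "N.prob {v \<in> space N. v \<notin> box} \<le> e / 4"
    unfolding box_def by (rule N.prob_outside_box[OF coord R(2)])
  obtain q0 where q0: "(1/2::real) ^ q0 < e / 8" using real_arch_pow_inv[of "e / 8" "1/2"] e by auto
  define C where "C = box \<inter> tame \<kappa> q0"
  have C: "compact C" unfolding C_def by (intro compact_Int_closed box closed_tame)
  define K where "K = limit_path \<kappa> ` C"
  have cont: "continuous_map (top_of_set C) (mtopology_of ?m) (limit_path \<kappa>)"
    unfolding mtopology_of_def m.continuous_map_to_metric
  proof (intro ballI allI impI)
    fix v and \<epsilon> :: real assume v: "v \<in> topspace (top_of_set C)" and \<epsilon>: "\<epsilon> > 0"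
    obtain q1 where q1: "(1/2::real) ^ q1 < \<epsilon> / 16" using real_arch_pow_inv[of "\<epsilon> / 16" "1/2"] \<epsilon> by auto
    define q where "q = max q0 q1"
    have "(1/2::real) ^ q \<le> (1/2) ^ q1" by (intro power_decreasing) (auto simp: q_def)
    then have q: "8 * (1/2::real) ^ q < \<epsilon> / 2" "q \<ge> q0" using q1 by (linarith, simp add: q_def)
    let ?s = "\<lambda>w. \<Sum>j\<le>2 ^ \<kappa> q. \<bar>v (prod_encode (q, j)) - w (prod_encode (q, j))\<bar>"
    define U where "U = {w. ?s w < \<epsilon> / 2}"
    have "open U" unfolding U_def by (intro open_Collect_less continuous_intros)
    show "\<exists>U. openin (top_of_set C) U \<and> v \<in> U \<and> (\<forall>y\<in>U. limit_path \<kappa> y \<in> m.mball (limit_path \<kappa> v) \<epsilon>)"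
    proof (intro exI[of _ "C \<inter> U"] conjI ballI)
      show "openin (top_of_set C) (C \<inter> U)" using \<open>open U\<close> by (simp add: openin_open_Int)
      show "v \<in> C \<inter> U" using v \<epsilon> by (simp add: U_def)
      fix w assume w: "w \<in> C \<inter> U"
      have vt: "v \<in> tame \<kappa> q0" "w \<in> tame \<kappa> q0" using v w by (auto simp: C_def)
      let ?lv = "limit_path \<kappa> v" and ?lw = "limit_path \<kappa> w" and ?sv = "step_path \<kappa> q v" and ?sw = "step_path \<kappa> q w"
      have "mdist ?m ?lv ?lw \<le> mdist ?m ?lv ?sv + mdist ?m ?sv ?lw"
        by (intro mdist_triangle limit_path_space step_path_space)
      also have "mdist ?m ?sv ?lw \<le> mdist ?m ?sv ?sw + mdist ?m ?sw ?lw"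
        by (intro mdist_triangle limit_path_space step_path_space)
      also have "mdist ?m ?sw ?lw \<le> 4 * (1/2) ^ q" using limit_path_approx(2)[OF vt(2) q(2)] by (simp add: mdist_commute)
      also have "mdist ?m ?lv ?sv \<le> 4 * (1/2) ^ q" by (rule limit_path_approx(2)[OF vt(1) q(2)])
      also have "mdist ?m ?sv ?sw \<le> ?s w" by (rule step_path_dist)
      finally have "mdist ?m ?lv ?lw < \<epsilon>" using q(1) w by (simp add: U_def)
      then show "?lw \<in> m.mball ?lv \<epsilon>" using limit_path_space by (simp add: m.in_mball)
    qed
  qed
  have K: "compactin (mtopology_of ?m) K"
    unfolding K_def by (rule image_compactin[OF _ cont]) (use C in \<open>simp add: compactin_subtopology\<close>)
  have "closedin (mtopology_of ?m) K"
    by (rule compactin_imp_closedin[OF _ K]) (simp add: mtopology_of_def m.Hausdorff_space_mtopology)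
  then have "mspace ?m - K \<in> sets (borel_metric ?m)"
    by (intro open_in_borel_metric) (simp add: closedin_def)
  moreover have "K \<subseteq> mspace ?m" using limit_path_space by (auto simp: K_def)
  ultimately have Ks: "K \<in> sets (borel_metric ?m)"
    using sets.compl_sets[of "mspace ?m - K" "borel_metric ?m"] by (simp add: double_diff)
  have box_s: "- box \<in> sets N" and tame_s: "- tame \<kappa> q0 \<in> sets N"
    using compact_imp_closed[OF box] closed_tame[of \<kappa> q0] unfolding sets_N by auto
  have "measure limit_law (space limit_law - K) = N.prob (limit_path \<kappa> -` (mspace ?m - K) \<inter> space N)"
    using Ks sets.compl_sets[OF Ks] by (subst measure_distr[OF limit_path_meas_N]) auto
  also have "\<dots> \<le> N.prob (- box \<union> - tame \<kappa> q0)"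
    using box_s tame_s by (intro N.finite_measure_mono) (auto simp: K_def C_def)
  also have "\<dots> \<le> N.prob (- box) + N.prob (- tame \<kappa> q0)"
    by (rule measure_Un_le[OF box_s tame_s])
  also have "\<dots> \<le> e / 4 + 2 * (1/2) ^ q0"
    using pbox tame_prob[of q0] by (intro add_mono) (simp_all add: Compl_eq)
  also have "\<dots> < e" using q0 e by linarith
  finally have "measure limit_law (space limit_law - K) < e" .
  then show "\<exists>K. compactin (mtopology_of ?m) K \<and> K \<in> sets limit_law \<and> measure limit_law (space limit_law - K) < e"
    using K Ks by auto
qed

end

section \<open>The functional central limit theorem\<close>

context marked_sample
begin

lemma emp_process_bounded: "bounded (emp_process n \<omega> ` S)"
proof (rule boundedI)
  fix x assume "x \<in> emp_process n \<omega> ` S"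
  then obtain t where x: "x = emp_process n \<omega> t" by blast
  have mean: "\<bar>mean_mark t\<bar> \<le> (\<integral>\<omega>. \<bar>Y 0 \<omega>\<bar> \<partial>M)"
    unfolding mean_mark_def
    by (rule order_trans[OF integral_abs_bound], rule integral_mono)
       (use mark_int mark_integrable in \<open>auto simp: mark_def W_def\<close>)
  have "\<bar>\<Sum>i<n. mark t (W i \<omega>) - mean_mark t\<bar> \<le> (\<Sum>i<n. \<bar>Y i \<omega>\<bar> + (\<integral>\<omega>. \<bar>Y 0 \<omega>\<bar> \<partial>M))"
  proof (rule order_trans[OF sum_abs], rule sum_mono)
    fix i
    have "\<bar>mark t (W i \<omega>)\<bar> \<le> \<bar>Y i \<omega>\<bar>" by (auto simp: mark_def W_def)
    then show "\<bar>mark t (W i \<omega>) - mean_mark t\<bar> \<le> \<bar>Y i \<omega>\<bar> + (\<integral>\<omega>. \<bar>Y 0 \<omega>\<bar> \<partial>M)" using mean by linarith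
  qed
  then have "\<bar>1 / sqrt (real n)\<bar> * \<bar>\<Sum>i<n. mark t (W i \<omega>) - mean_mark t\<bar>
     \<le> \<bar>1 / sqrt (real n)\<bar> * (\<Sum>i<n. \<bar>Y i \<omega>\<bar> + (\<integral>\<omega>. \<bar>Y 0 \<omega>\<bar> \<partial>M))"
    by (intro mult_left_mono) auto
  then show "norm x \<le> \<bar>1 / sqrt (real n)\<bar> * (\<Sum>i<n. \<bar>Y i \<omega>\<bar> + (\<integral>\<omega>. \<bar>Y 0 \<omega>\<bar> \<partial>M))"
    unfolding x emp_process_def real_norm_def abs_mult .
qed

lemma emp_process_tight:
  assumes "e > 0"
  shows "\<exists>R. \<forall>n. prob {\<omega> \<in> space M. \<bar>emp_process n \<omega> t\<bar> > R} \<le> e"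
proof -
  define C where "C = (\<integral>\<omega>. (Y 0 \<omega>)\<^sup>2 \<partial>M)"
  have C0: "C \<ge> 0" by (simp add: C_def)
  define R where "R = sqrt ((C + 1) / e)"
  have R: "R > 0" "R\<^sup>2 = (C + 1) / e" using C0 assms by (auto simp: R_def)
  have "C / R\<^sup>2 \<le> e" unfolding R(2) using C0 assms by (simp add: divide_le_eq)
  moreover have "prob {\<omega> \<in> space M. \<bar>emp_process n \<omega> t\<bar> > R} \<le> C / R\<^sup>2" for n
    unfolding C_def by (rule order_trans[OF finite_measure_mono emp_process_tail[OF R(1), where n=n and t=t]]) auto
  ultimately show ?thesis using order_trans by blast
qed

lemma gaussian_limit_exists:
  obtains L where "tight_law (linf {0..1}) L"
    "hj_weak_conv (linf {0..1}) M (\<lambda>n \<omega>. \<lambda>t\<in>{0..1}. emp_process n \<omega> t) L"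
proof -
  have "\<exists>k0. \<forall>k\<ge>k0. \<exists>n0. \<forall>n\<ge>n0. \<exists>E\<in>events. prob E \<le> (1/2) ^ q \<and>
    (\<forall>\<omega>\<in>space M - E. \<forall>t\<in>{0..1}. \<bar>emp_process n \<omega> t - emp_process n \<omega> (of_int \<lfloor>2 ^ k * t\<rfloor> / 2 ^ k)\<bar> \<le> (1/2) ^ q)" for q :: nat
    by (rule asymptotic_equicontinuity) auto
  then have "\<exists>k0. \<forall>q. \<forall>k\<ge>k0 q. \<exists>n0. \<forall>n\<ge>n0. \<exists>E\<in>events. prob E \<le> (1/2) ^ q \<and>
    (\<forall>\<omega>\<in>space M - E. \<forall>t\<in>{0..1}. \<bar>emp_process n \<omega> t - emp_process n \<omega> (of_int \<lfloor>2 ^ k * t\<rfloor> / 2 ^ k)\<bar> \<le> (1/2) ^ q)"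
    by (intro choice allI)
  then obtain k0 :: "nat \<Rightarrow> nat" where k0: "\<And>q k. k \<ge> k0 q \<Longrightarrow> \<exists>n0. \<forall>n\<ge>n0. \<exists>E\<in>events. prob E \<le> (1/2) ^ q \<and>
    (\<forall>\<omega>\<in>space M - E. \<forall>t\<in>{0..1}. \<bar>emp_process n \<omega> t - emp_process n \<omega> (of_int \<lfloor>2 ^ k * t\<rfloor> / 2 ^ k)\<bar> \<le> (1/2) ^ q)"
    by (elim exE) blast
  define \<kappa> where "\<kappa> q = (\<Sum>p\<le>q. k0 p)" for q
  have \<kappa>: "k0 q \<le> \<kappa> q" for q unfolding \<kappa>_def by (rule member_le_sum) auto
  define g where "g i \<omega> = mark (grid_point \<kappa> i) (W 0 \<omega>) - mean_mark (grid_point \<kappa> i)" for i \<omega>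
  have g: "square_integrable M (g i)" for i
    unfolding g_def[abs_def]
    by (rule square_integrable_diff) (use mark_sq_int in \<open>auto simp: square_integrable_def\<close>)
  obtain N :: "(nat \<Rightarrow> real) measure" where N: "prob_space N" "sets N = sets borel"
    "\<And>k a. distr N borel (\<lambda>v. \<Sum>i<k. a i * v i) = normal_law 0 (sqrt (\<integral>x. (\<Sum>i<k. a i * g i x)\<^sup>2 \<partial>M))"
    by (rule gaussian_sequence_exists[of M g, OF g]) (rule that)
  interpret N: prob_space N by (rule N(1))
  interpret P: equicontinuous_paths M emp_process \<kappa> N
  proof
    show "\<kappa> q \<le> \<kappa> (Suc q)" for q by (simp add: \<kappa>_def)
    show "(\<lambda>\<omega>. emp_process n \<omega> t) \<in> borel_measurable M" for n t by simp
    show "bounded (emp_process n \<omega> ` {0..1})" for n \<omega> by (rule emp_process_bounded)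
    show "\<exists>n0. \<forall>n\<ge>n0. \<exists>E\<in>events. prob E \<le> (1/2) ^ q \<and>
      (\<forall>\<omega>\<in>space M - E. \<forall>t\<in>{0..1}. \<bar>emp_process n \<omega> t - emp_process n \<omega> (of_int \<lfloor>2 ^ \<kappa> q * t\<rfloor> / 2 ^ \<kappa> q)\<bar> \<le> (1/2) ^ q)" for q
      by (rule k0[OF \<kappa>])
    show "sets N = sets borel" by (rule N(2))
    fix f :: "(nat \<Rightarrow> real) \<Rightarrow> real" and B assume f: "continuous_on UNIV f" "\<And>x. \<bar>f x\<bar> \<le> B"
    show "(\<lambda>n. \<integral>\<omega>. f (\<lambda>i. emp_process n \<omega> (grid_point \<kappa> i)) \<partial>M) \<longlonglongrightarrow> (\<integral>v. f v \<partial>N)"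
    proof (rule weak_convergence_of_trig_convergence[OF prob_space_axioms N(1,2) _ _ _ f])
      show "(\<lambda>\<omega>. emp_process n \<omega> (grid_point \<kappa> i)) \<in> borel_measurable M" for n i by simp
      show "\<exists>R. \<forall>n. prob {\<omega> \<in> space M. \<bar>emp_process n \<omega> (grid_point \<kappa> i)\<bar> > R} \<le> e" if "e > 0" for i e
        by (rule emp_process_tight[OF that])
      fix k :: nat and a :: "nat \<Rightarrow> real" and b :: real
      have coord: "(\<lambda>v. v i) \<in> borel_measurable N" for i
        by (subst measurable_cong_sets[OF N(2) refl], rule borel_measurable_continuous_onI[OF continuous_on_coordinate])
      have "(\<integral>v. cos ((\<Sum>i<k. a i * v i) + b) \<partial>N) = (\<integral>x. cos (x + b) \<partial>distr N borel (\<lambda>v. \<Sum>i<k. a i * v i))"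
        using coord by (subst integral_distr) auto
      also have "\<dots> = (\<integral>x. cos (x + b) \<partial>normal_law 0 (sqrt (\<integral>x. (\<Sum>i<k. a i * g i x)\<^sup>2 \<partial>M)))"
        unfolding N(3) ..
      finally show "(\<lambda>n. \<integral>\<omega>. cos ((\<Sum>i<k. a i * emp_process n \<omega> (grid_point \<kappa> i)) + b) \<partial>M)
          \<longlonglongrightarrow> (\<integral>v. cos ((\<Sum>i<k. a i * v i) + b) \<partial>N)"
        using finite_dim_convergence[of "{..<k}" a "grid_point \<kappa>" b] by (simp add: g_def)
    qed
  qed
  show thesis by (rule that[OF P.limit_law_tight P.limit_law_conv])
qed

lemma coordinate_continuous_map:
  assumes "t \<in> {0..1}"
  shows "continuous_map (mtopology_of (linf {0..1})) euclideanreal (\<lambda>z. z t)"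
  by (rule lipschitz_continuous_map[where c=1]) (use linf_le_dist[OF _ _ assms] in simp)

lemma linear_form_law:
  assumes L: "hj_weak_conv (linf {0..1}) M (\<lambda>n \<omega>. \<lambda>t\<in>{0..1}. emp_process n \<omega> t) L"
    and F: "finite F" "F \<subseteq> {0..1}"
  shows "\<exists>s. distr L borel (\<lambda>z. \<Sum>t\<in>F. a t * z t) = normal_law 0 s"
proof -
  let ?m = "linf {0..1::real}"
  have prob: "prob_space L" and sp: "space L = mspace ?m" and sets: "sets L = sets (borel_metric ?m)"
    and conv: "\<And>h. continuous_map (mtopology_of ?m) euclideanreal h \<Longrightarrow> bounded (h ` mspace ?m) \<Longrightarrow>
        (\<lambda>n. outer_expectation M (\<lambda>\<omega>. h (\<lambda>t\<in>{0..1}. emp_process n \<omega> t))) \<longlonglongrightarrow> (\<integral>z. h z \<partial>L)"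
    using L unfolding hj_weak_conv_def by auto
  interpret L: prob_space L by (rule prob)
  define ell where "ell z = (\<Sum>t\<in>F. a t * z t)" for z :: "real \<Rightarrow> real"
  have lc: "continuous_map (mtopology_of ?m) euclideanreal ell"
    unfolding ell_def[abs_def] using F
    by (intro continuous_map_sum continuous_map_real_mult_left coordinate_continuous_map) auto
  have lm[measurable]: "ell \<in> borel_measurable L"
    using continuous_borel_metric[OF lc] by (simp add: measurable_cong_sets[OF sets refl])
  define var where "var = (\<integral>\<omega>. (\<Sum>t\<in>F. a t * (mark t (W 0 \<omega>) - mean_mark t))\<^sup>2 \<partial>M)"
  have cosint: "(\<integral>z. cos (u * ell z + b) \<partial>L) = (\<integral>x. cos (x + b) \<partial>normal_law 0 (sqrt (u\<^sup>2 * var)))" for u b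
  proof -
    let ?h = "\<lambda>z. cos (u * ell z + b)"
    have "continuous_map euclideanreal euclideanreal (\<lambda>x. cos (u * x + b))"
      by (auto intro!: continuous_intros)
    from continuous_map_compose[OF lc this]
    have hc: "continuous_map (mtopology_of ?m) euclideanreal ?h" by (simp add: comp_def)
    have "bounded (?h ` mspace ?m)" by (rule boundedI[where B=1]) auto
    from conv[OF hc this]
    have lim: "(\<lambda>n. outer_expectation M (\<lambda>\<omega>. ?h (\<lambda>t\<in>{0..1}. emp_process n \<omega> t))) \<longlonglongrightarrow> (\<integral>z. ?h z \<partial>L)" .
    have h_eq: "?h (\<lambda>t\<in>{0..1}. emp_process n \<omega> t) = cos ((\<Sum>t\<in>F. (u * a t) * emp_process n \<omega> t) + b)" for n \<omega>
    proof -
      have "ell (\<lambda>t\<in>{0..1}. emp_process n \<omega> t) = (\<Sum>t\<in>F. a t * emp_process n \<omega> t)"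
        unfolding ell_def using F(2) by (intro sum.cong) auto
      then show ?thesis by (simp add: sum_distrib_left mult.assoc)
    qed
    have "outer_expectation M (\<lambda>\<omega>. ?h (\<lambda>t\<in>{0..1}. emp_process n \<omega> t)) = (\<integral>\<omega>. cos ((\<Sum>t\<in>F. (u * a t) * emp_process n \<omega> t) + b) \<partial>M)" for n
      unfolding h_eq
      by (rule outer_expectation_eq, rule integrable_const_bound[where B=1]) auto
    with lim have 1: "(\<lambda>n. \<integral>\<omega>. cos ((\<Sum>t\<in>F. (u * a t) * emp_process n \<omega> t) + b) \<partial>M) \<longlonglongrightarrow> (\<integral>z. ?h z \<partial>L)" by simp
    have 2: "(\<lambda>n. \<integral>\<omega>. cos ((\<Sum>t\<in>F. (u * a t) * emp_process n \<omega> t) + b) \<partial>M)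
       \<longlonglongrightarrow> (\<integral>x. cos (x + b) \<partial>normal_law 0 (sqrt (\<integral>\<omega>. (\<Sum>t\<in>F. (u * a t) * (mark t (W 0 \<omega>) - mean_mark t))\<^sup>2 \<partial>M)))"
      by (rule finite_dim_convergence[OF F(1)])
    have "(\<integral>\<omega>. (\<Sum>t\<in>F. (u * a t) * (mark t (W 0 \<omega>) - mean_mark t))\<^sup>2 \<partial>M) = u\<^sup>2 * var"
      unfolding var_def mult.assoc sum_distrib_left[symmetric] power_mult_distrib by simp
    with LIMSEQ_unique[OF 1 2] show ?thesis by simp
  qed
  have char_cos: "char \<mu> u = complex_of_real (\<integral>x. cos (u * x) \<partial>\<mu>) + \<i> * complex_of_real (\<integral>x. cos (u * x + - (pi/2)) \<partial>\<mu>)"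
    if "real_distribution \<mu>" for \<mu> u
  proof -
    interpret \<mu>: real_distribution \<mu> by fact
    have i: "integrable \<mu> (\<lambda>x. cos (u * x))" "integrable \<mu> (\<lambda>x. sin (u * x))"
      by (auto intro!: \<mu>.integrable_const_bound[where B=1])
    have "char \<mu> u = (\<integral>x. complex_of_real (cos (u * x)) + \<i> * complex_of_real (sin (u * x)) \<partial>\<mu>)"
      unfolding char_def cis_conv_exp[symmetric] by (intro Bochner_Integration.integral_cong) (auto simp: complex_eq_iff)
    also have "\<dots> = complex_of_real (\<integral>x. cos (u * x) \<partial>\<mu>) + \<i> * complex_of_real (\<integral>x. sin (u * x) \<partial>\<mu>)"
      using i by (subst Bochner_Integration.integral_add) auto
    finally show ?thesis by (simp add: cos_diff)
  qed
  show ?thesis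
  proof (intro exI[of _ "sqrt var"] Levy_uniqueness real_distribution_normal_law ext)
    show rd: "real_distribution (distr L borel (\<lambda>z. \<Sum>t\<in>F. a t * z t))"
      using L.real_distribution_distr[OF lm] by (simp add: ell_def[abs_def])
    fix u
    have var0: "var \<ge> 0" by (simp add: var_def)
    have ld: "(\<integral>x. cos (u * x + b) \<partial>distr L borel (\<lambda>z. \<Sum>t\<in>F. a t * z t)) = (\<integral>z. cos (u * ell z + b) \<partial>L)" for b
      using lm by (subst integral_distr) (auto simp: ell_def[abs_def])
    have "char (distr L borel (\<lambda>z. \<Sum>t\<in>F. a t * z t)) u = char (normal_law 0 (sqrt (u\<^sup>2 * var))) 1"
      unfolding char_cos[OF rd] char_cos[OF real_distribution_normal_law]
      using ld[of 0] ld[of "- (pi/2)"] cosint[of u 0] cosint[of u "- (pi/2)"] by simp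
    also have "\<dots> = char (normal_law 0 (sqrt var)) u"
      using var0 by (simp add: char_normal_law power_mult_distrib)
    finally show "char (distr L borel (\<lambda>z. \<Sum>t\<in>F. a t * z t)) u = char (normal_law 0 (sqrt var)) u" .
  qed
qed

theorem functional_central_limit_theorem:
  "\<exists>L. centered_gaussian_process {0..1} L \<and> tight_law (linf {0..1}) L \<and>
     hj_weak_conv (linf {0..1}) M (\<lambda>n \<omega>. \<lambda>t\<in>{0..1}. emp_process n \<omega> t) L"
proof -
  let ?m = "linf {0..1::real}"
  obtain L where L: "tight_law ?m L" "hj_weak_conv ?m M (\<lambda>n \<omega>. \<lambda>t\<in>{0..1}. emp_process n \<omega> t) L"
    by (rule gaussian_limit_exists)
  have prob: "prob_space L" and sets: "sets L = sets (borel_metric ?m)"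
    using L(2) unfolding hj_weak_conv_def by auto
  have cm: "(\<lambda>z. z t) \<in> borel_measurable L" if "t \<in> {0..1}" for t
    using continuous_borel_metric[OF coordinate_continuous_map[OF that]]
    by (simp add: measurable_cong_sets[OF sets refl])
  have gauss: "gaussian_process {0..1} L"
    unfolding gaussian_process_def using prob cm linear_form_law[OF L(2)] by blast
  have "(\<integral>z. z t \<partial>L) = 0" if t: "t \<in> {0..1}" for t
  proof -
    obtain s where "distr L borel (\<lambda>z. \<Sum>t\<in>{t}. 1 * z t) = normal_law 0 s"
      using linear_form_law[OF L(2), of "{t}" "\<lambda>_. 1"] t by auto
    then have d: "distr L borel (\<lambda>z. z t) = normal_law 0 s" by simp
    have "(\<integral>z. z t \<partial>L) = (\<integral>x. x \<partial>distr L borel (\<lambda>z. z t))"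
      using cm[OF t] by (subst integral_distr) auto
    also have "\<dots> = (\<integral>x. s * x \<partial>std_normal_distribution)"
      unfolding d by (subst integral_normal_law) auto
    also have "\<dots> = s * (\<integral>x. x \<partial>std_normal_distribution)" by simp
    also have "(\<integral>x. x \<partial>std_normal_distribution) = 0"
      using integral_std_normal_distribution_moment_odd[of 1] by simp
    finally show ?thesis by simp
  qed
  then show ?thesis using L gauss unfolding centered_gaussian_process_def by blast
qed

lemma uniformly_bounded_in_prob:
  assumes \<eta>: "\<eta> > 0"
  shows "\<exists>R n0. R > 0 \<and> (\<forall>n\<ge>n0. \<exists>E\<in>events. prob E \<le> \<eta> \<and> (\<forall>\<omega>\<in>space M - E. \<forall>t\<in>{0..1}. \<bar>emp_process n \<omega> t\<bar> \<le> R))"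
proof -
  obtain k n0 where osc: "\<And>n. n \<ge> n0 \<Longrightarrow> \<exists>E\<in>events. prob E \<le> \<eta> / 2 \<and>
    (\<forall>\<omega>\<in>space M - E. \<forall>t\<in>{0..1}. \<bar>emp_process n \<omega> t - emp_process n \<omega> (of_int \<lfloor>2 ^ k * t\<rfloor> / 2 ^ k)\<bar> \<le> 1)"
    using asymptotic_equicontinuity[of 1 "\<eta> / 2"] \<eta> by fastforce
  define N where "N = Suc (2 ^ k)"
  have N0: "N > 0" by (simp add: N_def)
  then have pos: "\<eta> / (2 * real N) > 0" using \<eta> by simp
  have "\<exists>r. \<forall>j::nat. \<forall>n. prob {\<omega> \<in> space M. \<bar>emp_process n \<omega> (real j / 2 ^ k)\<bar> > r j} \<le> \<eta> / (2 * real N)"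
    by (intro choice allI emp_process_tight[OF pos])
  then obtain r where r: "\<And>j n. prob {\<omega> \<in> space M. \<bar>emp_process n \<omega> (real j / 2 ^ k)\<bar> > r j} \<le> \<eta> / (2 * real N)"
    by (elim exE) blast
  define R where "R = 1 + (\<Sum>j<N. \<bar>r j\<bar>)"
  have rR: "r j + 1 \<le> R" if "j < N" for j
    using member_le_sum[of j "{..<N}" "\<lambda>j. \<bar>r j\<bar>"] that by (simp add: R_def)
  show ?thesis
  proof (rule exI[of _ R], rule exI[of _ n0], intro conjI allI impI)
    show "R > 0" unfolding R_def by (intro add_pos_nonneg sum_nonneg) auto
    fix n assume "n0 \<le> n"
    then obtain E where E: "E \<in> events" "prob E \<le> \<eta> / 2"
      "\<And>\<omega> t. \<omega> \<in> space M - E \<Longrightarrow> t \<in> {0..1} \<Longrightarrow> \<bar>emp_process n \<omega> t - emp_process n \<omega> (of_int \<lfloor>2 ^ k * t\<rfloor> / 2 ^ k)\<bar> \<le> 1"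
      using osc[of n] by blast
    define A where "A j = {\<omega> \<in> space M. \<bar>emp_process n \<omega> (real j / 2 ^ k)\<bar> > r j}" for j :: nat
    have A: "A j \<in> events" for j unfolding A_def by measurable
    have "prob (E \<union> (\<Union>j<N. A j)) \<le> prob E + prob (\<Union>j<N. A j)"
      by (rule measure_Un_le) (use E A in auto)
    also have "prob (\<Union>j<N. A j) \<le> (\<Sum>j<N. prob (A j))" by (rule measure_UNION_le) (use A in auto)
    also have "\<dots> \<le> (\<Sum>j<N. \<eta> / (2 * real N))" unfolding A_def by (rule sum_mono[OF r])
    also have "\<dots> = \<eta> / 2" using N0 by simp
    finally have P: "prob (E \<union> (\<Union>j<N. A j)) \<le> \<eta>" using E(2) by simp
    show "\<exists>E\<in>events. prob E \<le> \<eta> \<and> (\<forall>\<omega>\<in>space M - E. \<forall>t\<in>{0..1}. \<bar>emp_process n \<omega> t\<bar> \<le> R)"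
    proof (intro bexI[of _ "E \<union> (\<Union>j<N. A j)"] conjI P ballI)
      show "E \<union> (\<Union>j<N. A j) \<in> events" using E A by auto
      fix \<omega> t assume \<omega>: "\<omega> \<in> space M - (E \<union> (\<Union>j<N. A j))" and t: "t \<in> {0..1::real}"
      define j where "j = nat \<lfloor>2 ^ k * t\<rfloor>"
      have j_int: "of_int \<lfloor>2 ^ k * t\<rfloor> = real j" using t by (simp add: j_def)
      have "2 ^ k * t \<le> 2 ^ k" using t by simp
      moreover have "real j \<le> 2 ^ k * t" unfolding j_int[symmetric] by linarith
      moreover have "real (2 ^ k) = 2 ^ k" by simp
      ultimately have "real j \<le> real (2 ^ k)" by linarith
      then have j: "j < N" unfolding of_nat_le_iff by (simp add: N_def)
      have "\<bar>emp_process n \<omega> (real j / 2 ^ k)\<bar> \<le> r j" using \<omega> j by (auto simp: A_def not_less)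
      moreover have "\<bar>emp_process n \<omega> t - emp_process n \<omega> (real j / 2 ^ k)\<bar> \<le> 1"
        using E(3)[of \<omega> t] \<omega> t by (simp add: j_int)
      ultimately show "\<bar>emp_process n \<omega> t\<bar> \<le> R" using rR[OF j] by linarith
    qed
  qed
qed

end

section \<open>Consistency\<close>

lemma AE_topological_support:
  assumes sets: "sets \<mu> = sets borel"
  shows "AE x in \<mu>. x \<in> topological_support \<mu>"
proof -
  define \<F> where "\<F> = {U :: real set. open U \<and> emeasure \<mu> U = 0}"
  obtain \<F>' where F': "\<F>' \<subseteq> \<F>" "countable \<F>'" "\<Union>\<F>' = \<Union>\<F>"
    by (rule Lindelof[of \<F>]) (auto simp: \<F>_def)
  have "(\<Union>U\<in>\<F>'. U) \<in> null_sets \<mu>"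
    by (rule null_sets_UN'[OF F'(2)]) (use F'(1) in \<open>auto simp: \<F>_def null_sets_def sets\<close>)
  moreover have "- topological_support \<mu> = \<Union>\<F>'"
    unfolding F'(3) by (auto simp: topological_support_def \<F>_def not_gr_zero)
  ultimately show ?thesis by (intro AE_I'[of "\<Union>\<F>'"]) auto
qed

lemma interval_measure_cdf:
  assumes "real_distribution \<mu>"
  shows "interval_measure (cdf \<mu>) = \<mu>"
proof -
  interpret real_distribution \<mu> by fact
  show ?thesis
  proof (rule cdf_unique[OF _ assms])
    show "real_distribution (interval_measure (cdf \<mu>))"
      by (intro real_distribution_interval_measure cdf_nondecreasing cdf_is_right_cont cdf_lim_at_bot cdf_lim_at_top_prob)
    show "cdf (interval_measure (cdf \<mu>)) = cdf \<mu>"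
      by (intro cdf_interval_measure cdf_nondecreasing cdf_is_right_cont cdf_lim_at_bot)
  qed
qed

lemma (in prob_space) indep_vars_AE_cong:
  fixes A B :: "nat \<Rightarrow> 'a \<Rightarrow> 'b"
  assumes A: "indep_vars (\<lambda>_. N) A UNIV" and B: "\<And>i. B i \<in> measurable M N"
    and eq: "\<And>i. AE \<omega> in M. A i \<omega> = B i \<omega>"
  shows "indep_vars (\<lambda>_. N) B UNIV"
proof -
  have Am: "A i \<in> measurable M N" for i using A by (simp add: indep_vars_def)
  have "distr M (PiM UNIV (\<lambda>_. N)) (\<lambda>\<omega>. \<lambda>i\<in>UNIV. A i \<omega>) = distr M (PiM UNIV (\<lambda>_. N)) (\<lambda>\<omega>. \<lambda>i\<in>UNIV. B i \<omega>)"
  proof (intro distr_cong_AE refl measurable_restrict Am B)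
    have "AE \<omega> in M. \<forall>i. A i \<omega> = B i \<omega>" using eq by (simp add: AE_all_countable)
    then show "AE \<omega> in M. (\<lambda>i\<in>UNIV. A i \<omega>) = (\<lambda>i\<in>UNIV. B i \<omega>)" by eventually_elim simp
  qed
  moreover have "distr M N (A i) = distr M N (B i)" for i by (rule distr_cong_AE[OF refl refl eq Am B])
  ultimately show ?thesis
    using A Am B by (simp add: indep_vars_iff_distr_eq_PiM)
qed

lemma theta_hat_bounds:
  assumes as: "0 \<le> a" "a \<le> s" "s \<le> 1"
    and below: "\<And>\<theta>. \<theta> \<in> {0..a} \<Longrightarrow> M_emp X Y n \<omega> \<theta> \<le> t n"
    and above: "\<And>\<theta>. \<theta> \<in> {s<..1} \<Longrightarrow> M_emp X Y n \<omega> \<theta> > t n"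
  shows "a \<le> theta_hat X Y t n \<omega>" "theta_hat X Y t n \<omega> \<le> s"
proof -
  let ?g = "\<lambda>\<theta>. indicator {0..1} \<theta> * of_bool (M_emp X Y n \<omega> \<theta> \<le> t n) :: real"
  have th: "theta_hat X Y t n \<omega> = (\<integral>\<theta>. ?g \<theta> \<partial>lborel)"
    by (simp add: theta_hat_def set_lebesgue_integral_def)
  have [measurable]: "(\<lambda>\<theta>. M_emp X Y n \<omega> \<theta>) \<in> borel_measurable borel"
    unfolding M_emp_def by measurable
  have gi: "integrable lborel ?g"
    by (rule Bochner_Integration.integrable_bound[of lborel "indicator {0..1} :: real \<Rightarrow> real"])
       (auto simp: indicator_def)
  have ii: "integrable lborel (indicator {0..x} :: real \<Rightarrow> real)" for x
    by (rule integrable_real_indicator) (auto simp: emeasure_lborel_Icc_eq)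
  have iv: "(\<integral>\<theta>. indicator {0..x} \<theta> \<partial>lborel) = x" if "x \<ge> 0" for x :: real using that by simp
  have "(\<integral>\<theta>. indicator {0..a} \<theta> \<partial>lborel) \<le> (\<integral>\<theta>. ?g \<theta> \<partial>lborel)"
    by (rule integral_mono[OF ii gi]) (use below as in \<open>auto simp: indicator_def\<close>)
  then show "a \<le> theta_hat X Y t n \<omega>" unfolding th iv[OF as(1)] .
  have "(\<integral>\<theta>. ?g \<theta> \<partial>lborel) \<le> (\<integral>\<theta>. indicator {0..s} \<theta> \<partial>lborel)"
    by (rule integral_mono[OF gi ii]) (use above in \<open>force simp: indicator_def not_le\<close>)
  then show "theta_hat X Y t n \<omega> \<le> s" unfolding th using iv[of s] as by simp
qed

lemma tendsto_zero_of_eventually_le: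
  fixes f :: "nat \<Rightarrow> real"
  assumes "\<And>n. f n \<ge> 0" "\<And>\<eta>. \<eta> > 0 \<Longrightarrow> \<exists>n0. \<forall>n\<ge>n0. f n \<le> \<eta>"
  shows "f \<longlonglongrightarrow> 0"
proof (rule LIMSEQ_I)
  fix r :: real assume "r > 0"
  then obtain n0 where "\<And>n. n \<ge> n0 \<Longrightarrow> f n \<le> r / 2" using assms(2)[of "r / 2"] by auto
  then show "\<exists>no. \<forall>n\<ge>no. norm (f n - 0) < r"
    using assms(1) \<open>r > 0\<close> by (intro exI[of _ n0]) (fastforce simp: abs_of_nonneg)
qed

context marked_sample
begin

lemma emp_process_eq: "emp_process n \<omega> t = sqrt (real n) * (M_emp X Y n \<omega> t - mean_mark t)"
proof (cases "n = 0")
  case False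
  have "(\<Sum>i<n. mark t (W i \<omega>)) = (\<Sum>i<n. Y i \<omega> * of_bool (X i \<omega> \<le> t))"
    by (simp add: mark_def W_def)
  moreover have "1 / sqrt (real n) * (S - real n * c) = sqrt (real n) * (1 / real n * S - c)" for S c
  proof -
    have "real n = sqrt (real n) * sqrt (real n)" by simp
    then show ?thesis using False by (simp add: field_simps)
  qed
  ultimately show ?thesis by (simp add: emp_process_def M_emp_def sum_subtractf del: of_nat_Suc)
qed (simp add: emp_process_def)

lemma deviation_event:
  assumes c: "\<forall>n\<ge>1. 0 < c n" "c \<longlonglongrightarrow> 0" and t: "\<forall>n\<ge>1. t n = real n powr (- 1 / 2) / c n" and \<eta>: "\<eta> > 0"
  shows "\<exists>n0. \<forall>n\<ge>n0. \<exists>E\<in>events. prob E \<le> \<eta> \<and>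
    (\<forall>\<omega>\<in>space M - E. \<forall>\<theta>\<in>{0..1}. \<bar>M_emp X Y n \<omega> \<theta> - mean_mark \<theta>\<bar> \<le> t n)"
proof -
  obtain R n0 where R: "R > 0" and n0: "\<And>n. n \<ge> n0 \<Longrightarrow> \<exists>E\<in>events. prob E \<le> \<eta> \<and> (\<forall>\<omega>\<in>space M - E. \<forall>t\<in>{0..1}. \<bar>emp_process n \<omega> t\<bar> \<le> R)"
    using uniformly_bounded_in_prob[OF \<eta>] by blast
  have "eventually (\<lambda>n. c n < 1 / R) sequentially" using c(2) R by (intro order_tendstoD(2)) auto
  then obtain n1 where n1: "\<And>n. n \<ge> n1 \<Longrightarrow> c n < 1 / R" by (auto simp: eventually_sequentially)
  show ?thesis
  proof (intro exI[of _ "Suc (n0 + n1)"] allI impI)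
    fix n assume n: "Suc (n0 + n1) \<le> n"
    then have n': "n \<ge> 1" "n \<ge> n0" "n \<ge> n1" by auto
    obtain E where E: "E \<in> events" "prob E \<le> \<eta>" "\<And>\<omega> t. \<omega> \<in> space M - E \<Longrightarrow> t \<in> {0..1} \<Longrightarrow> \<bar>emp_process n \<omega> t\<bar> \<le> R"
      using n0[OF n'(2)] by blast
    have cn: "c n > 0" "c n < 1 / R" using c(1) n1 n' by auto
    have sn: "sqrt (real n) > 0" using n'(1) by simp
    have tn: "t n = 1 / sqrt (real n) / c n"
      using t n'(1) by (simp add: powr_minus_divide powr_half_sqrt)
    have "R \<le> 1 / c n" using cn R by (simp add: field_simps)
    then have "R / sqrt (real n) \<le> 1 / c n / sqrt (real n)" using sn by (intro divide_right_mono) auto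
    then have Rt: "R / sqrt (real n) \<le> t n" unfolding tn by (simp add: mult.commute)
    show "\<exists>E\<in>events. prob E \<le> \<eta> \<and> (\<forall>\<omega>\<in>space M - E. \<forall>\<theta>\<in>{0..1}. \<bar>M_emp X Y n \<omega> \<theta> - mean_mark \<theta>\<bar> \<le> t n)"
    proof (intro bexI[of _ E] conjI E(1,2) ballI)
      fix \<omega> \<theta> assume "\<omega> \<in> space M - E" "\<theta> \<in> {0..1::real}"
      then have "sqrt (real n) * \<bar>M_emp X Y n \<omega> \<theta> - mean_mark \<theta>\<bar> \<le> R"
        using E(3)[of \<omega> \<theta>] by (simp add: emp_process_eq abs_mult)
      then have "\<bar>M_emp X Y n \<omega> \<theta> - mean_mark \<theta>\<bar> \<le> R / sqrt (real n)"
        using sn by (simp add: pos_le_divide_eq mult.commute)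
      then show "\<bar>M_emp X Y n \<omega> \<theta> - mean_mark \<theta>\<bar> \<le> t n" using Rt by linarith
    qed
  qed
qed

lemma sup_deviation_tendsto:
  assumes ct: "\<forall>n\<ge>1. 0 < c n" "c \<longlonglongrightarrow> 0" "\<forall>n\<ge>1. t n = real n powr (- 1 / 2) / c n"
  shows "(\<lambda>n. prob {\<omega> \<in> space M. (SUP \<theta>\<in>{0..1}. \<bar>M_emp X Y n \<omega> \<theta> - mean_mark \<theta>\<bar>) > t n}) \<longlonglongrightarrow> 0"
proof (rule tendsto_zero_of_eventually_le)
  fix \<eta> :: real assume "\<eta> > 0"
  then obtain n0 where n0: "\<And>n. n \<ge> n0 \<Longrightarrow> \<exists>E\<in>events. prob E \<le> \<eta> \<and>
    (\<forall>\<omega>\<in>space M - E. \<forall>\<theta>\<in>{0..1}. \<bar>M_emp X Y n \<omega> \<theta> - mean_mark \<theta>\<bar> \<le> t n)"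
    using deviation_event[OF ct] by blast
  show "\<exists>n0. \<forall>n\<ge>n0. prob {\<omega> \<in> space M. (SUP \<theta>\<in>{0..1}. \<bar>M_emp X Y n \<omega> \<theta> - mean_mark \<theta>\<bar>) > t n} \<le> \<eta>"
  proof (intro exI[of _ n0] allI impI)
    fix n assume "n0 \<le> n"
    then obtain E where E: "E \<in> events" "prob E \<le> \<eta>"
      "\<And>\<omega> \<theta>. \<omega> \<in> space M - E \<Longrightarrow> \<theta> \<in> {0..1} \<Longrightarrow> \<bar>M_emp X Y n \<omega> \<theta> - mean_mark \<theta>\<bar> \<le> t n"
      using n0[OF \<open>n0 \<le> n\<close>] by blast
    have "{\<omega> \<in> space M. (SUP \<theta>\<in>{0..1}. \<bar>M_emp X Y n \<omega> \<theta> - mean_mark \<theta>\<bar>) > t n} \<subseteq> E"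
    proof (rule subsetI, rule ccontr)
      fix \<omega> assume a: "\<omega> \<in> {\<omega> \<in> space M. (SUP \<theta>\<in>{0..1}. \<bar>M_emp X Y n \<omega> \<theta> - mean_mark \<theta>\<bar>) > t n}" "\<omega> \<notin> E"
      then have "(SUP \<theta>\<in>{0..1}. \<bar>M_emp X Y n \<omega> \<theta> - mean_mark \<theta>\<bar>) \<le> t n"
        by (intro cSUP_least E(3)) auto
      then show False using a by simp
    qed
    then show "prob {\<omega> \<in> space M. (SUP \<theta>\<in>{0..1}. \<bar>M_emp X Y n \<omega> \<theta> - mean_mark \<theta>\<bar>) > t n} \<le> \<eta>"
      using finite_measure_mono[OF _ E(1)] E(2) by (meson order_trans)
  qed
qed simp

lemma theta_hat_consistent:
  assumes ct: "\<forall>n\<ge>1. 0 < c n" "c \<longlonglongrightarrow> 0" "\<forall>n\<ge>1. t n = real n powr (- 1 / 2) / c n" and t0: "t \<longlonglongrightarrow> 0"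
    and \<theta>0: "\<theta>0 \<in> {0..<1}" and zero: "\<And>\<theta>. \<theta> \<in> {0..\<theta>0} \<Longrightarrow> mean_mark \<theta> = 0"
    and mono: "\<And>\<theta> \<theta>'. 0 \<le> \<theta> \<Longrightarrow> \<theta> \<le> \<theta>' \<Longrightarrow> \<theta>' \<le> 1 \<Longrightarrow> mean_mark \<theta> \<le> mean_mark \<theta>'"
    and pos: "\<And>\<theta>. \<theta> \<in> {\<theta>0<..1} \<Longrightarrow> mean_mark \<theta> > 0"
  shows "conv_in_prob M (theta_hat X Y t) \<theta>0"
  unfolding conv_in_prob_def
proof (intro allI impI)
  fix e :: real assume e: "e > 0"
  define s where "s = min 1 (\<theta>0 + e)"
  have s: "\<theta>0 < s" "s \<le> 1" "s \<le> \<theta>0 + e" using \<theta>0 e by (auto simp: s_def)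
  show "(\<lambda>n. prob {\<omega> \<in> space M. \<bar>theta_hat X Y t n \<omega> - \<theta>0\<bar> > e}) \<longlonglongrightarrow> 0"
  proof (rule tendsto_zero_of_eventually_le)
    fix \<eta> :: real assume "\<eta> > 0"
    then obtain n0 where n0: "\<And>n. n \<ge> n0 \<Longrightarrow> \<exists>E\<in>events. prob E \<le> \<eta> \<and>
      (\<forall>\<omega>\<in>space M - E. \<forall>\<theta>\<in>{0..1}. \<bar>M_emp X Y n \<omega> \<theta> - mean_mark \<theta>\<bar> \<le> t n)"
      using deviation_event[OF ct] by blast
    have "mean_mark s > 0" using pos s by simp
    then have "eventually (\<lambda>n. t n < mean_mark s / 2) sequentially" using t0 by (intro order_tendstoD(2)) auto
    then obtain n1 where n1: "\<And>n. n \<ge> n1 \<Longrightarrow> t n < mean_mark s / 2" by (auto simp: eventually_sequentially)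
    show "\<exists>n0. \<forall>n\<ge>n0. prob {\<omega> \<in> space M. \<bar>theta_hat X Y t n \<omega> - \<theta>0\<bar> > e} \<le> \<eta>"
    proof (intro exI[of _ "max n0 n1"] allI impI)
      fix n assume n: "max n0 n1 \<le> n"
      then obtain E where E: "E \<in> events" "prob E \<le> \<eta>"
        "\<And>\<omega> \<theta>. \<omega> \<in> space M - E \<Longrightarrow> \<theta> \<in> {0..1} \<Longrightarrow> \<bar>M_emp X Y n \<omega> \<theta> - mean_mark \<theta>\<bar> \<le> t n"
        using n0[of n] by auto
      have tn: "t n < mean_mark s / 2" using n1 n by simp
      have "\<bar>theta_hat X Y t n \<omega> - \<theta>0\<bar> \<le> e" if \<omega>: "\<omega> \<in> space M - E" for \<omega>
      proof -
        have below: "M_emp X Y n \<omega> \<theta> \<le> t n" if "\<theta> \<in> {0..\<theta>0}" for \<theta>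
          using E(3)[OF \<omega>, of \<theta>] zero[OF that] that \<theta>0 by auto
        have above: "M_emp X Y n \<omega> \<theta> > t n" if "\<theta> \<in> {s<..1}" for \<theta>
        proof -
          have "\<bar>M_emp X Y n \<omega> \<theta> - mean_mark \<theta>\<bar> \<le> t n" using that s \<theta>0 by (intro E(3)[OF \<omega>]) auto
          moreover have "mean_mark s \<le> mean_mark \<theta>" using that s \<theta>0 by (intro mono) auto
          ultimately show ?thesis using tn by linarith
        qed
        have "\<theta>0 \<le> theta_hat X Y t n \<omega>" "theta_hat X Y t n \<omega> \<le> s"
          using theta_hat_bounds[of \<theta>0 s X Y n \<omega> t] below above s \<theta>0 by auto
        then show ?thesis using s e by (simp add: abs_le_iff)
      qed
      then have "{\<omega> \<in> space M. \<bar>theta_hat X Y t n \<omega> - \<theta>0\<bar> > e} \<subseteq> E" by (auto simp: not_less[symmetric])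
      then show "prob {\<omega> \<in> space M. \<bar>theta_hat X Y t n \<omega> - \<theta>0\<bar> > e} \<le> \<eta>"
        using finite_measure_mono[OF _ E(1)] E(2) by (meson order_trans)
    qed
  qed simp
qed

end

theorem mainTheorem2:
  fixes \<Omega> :: "'a measure"
    and X \<epsilon> Y :: "nat \<Rightarrow> 'a \<Rightarrow> real"
    and m F\<^sub>X f\<^sub>X :: "real \<Rightarrow> real"
    and \<sigma> \<theta>0 \<Delta> :: real
  assumes "prob_space \<Omega>"
    and indep: "prob_space.indep_vars \<Omega> (\<lambda>_. borel :: (real \<times> real) measure)
                  (\<lambda>i \<omega>. (X i \<omega>, \<epsilon> i \<omega>)) UNIV"
    and ident: "\<And>i. distr \<Omega> (borel :: (real \<times> real) measure) (\<lambda>\<omega>. (X i \<omega>, \<epsilon> i \<omega>))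
                   = distr \<Omega> borel (\<lambda>\<omega>. (X 0 \<omega>, \<epsilon> 0 \<omega>))"
    and Y_meas: "\<And>i. Y i \<in> borel_measurable \<Omega>"
    and Y_eq: "\<And>i. AE \<omega> in \<Omega>. Y i \<omega> = m (X i \<omega>) + \<epsilon> i \<omega>"
    and supp: "\<And>i. topological_support (distr \<Omega> borel (X i)) = {0..1}"
    and cdf: "\<And>i. cdf (distr \<Omega> borel (X i)) = F\<^sub>X"
    and dens_nonneg: "\<And>x. 0 \<le> f\<^sub>X x"
    and dens: "\<And>i. distributed \<Omega> lborel (X i) (\<lambda>x. ennreal (f\<^sub>X x))"
    and dens_pos: "\<And>x. x \<in> {0..1} \<Longrightarrow> 0 < f\<^sub>X x"
    and cond_mean: "\<And>i. AE \<omega> in \<Omega>.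
           real_cond_exp \<Omega> (vimage_algebra (space \<Omega>) (X i) borel) (\<epsilon> i) \<omega> = 0"
    and sq_int: "\<And>i. integrable \<Omega> (\<lambda>\<omega>. (\<epsilon> i \<omega>)\<^sup>2)"
    and var: "\<And>i. prob_space.variance \<Omega> (\<epsilon> i) = \<sigma>\<^sup>2"
    and sigma: "0 < \<sigma>"
    and theta0: "\<theta>0 \<in> {0..<1}"
    and Delta: "\<Delta> \<in> {0<..1 - \<theta>0}"
    and m_cont: "continuous_on {0..1} m"
    and m_zero: "\<And>x. x \<in> {0..\<theta>0} \<Longrightarrow> m x = 0"
    and m_pos: "\<And>x. x \<in> {\<theta>0<..<\<theta>0 + \<Delta>} \<Longrightarrow> 0 < m x"
    and m_nonneg: "\<And>x. x \<in> {\<theta>0 + \<Delta>..1} \<Longrightarrow> 0 \<le> m x"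
  shows "(\<exists>L. centered_gaussian_process {0..1} L \<and> tight_law (linf {0..1}) L \<and>
            hj_weak_conv (linf {0..1}) \<Omega>
              (\<lambda>n \<omega>. \<lambda>\<theta>\<in>{0..1}. sqrt (real n) * (M_emp X Y n \<omega> \<theta> - M_true F\<^sub>X m \<theta>0 \<theta>)) L)
       \<and> (\<forall>c t :: nat \<Rightarrow> real.
            (\<forall>n\<ge>1. 0 < c n) \<and> c \<longlonglongrightarrow> 0 \<and> (\<forall>n\<ge>1. t n = real n powr (- 1 / 2) / c n) \<longrightarrow>
              (\<lambda>n. measure \<Omega> {\<omega> \<in> space \<Omega>.
                  (SUP \<theta>\<in>{0..1}. \<bar>M_emp X Y n \<omega> \<theta> - M_true F\<^sub>X m \<theta>0 \<theta>\<bar>) > t n}) \<longlonglongrightarrow> 0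
              \<and> (t \<longlonglongrightarrow> 0 \<longrightarrow> conv_in_prob \<Omega> (theta_hat X Y t) \<theta>0))"
proof -
  interpret prob_space \<Omega> by fact
  have pair[measurable]: "(\<lambda>\<omega>. (X i \<omega>, \<epsilon> i \<omega>)) \<in> borel_measurable \<Omega>" for i
    using indep unfolding indep_vars_def2 by simp
  have Xm[measurable]: "X i \<in> borel_measurable \<Omega>" for i
    using measurable_compose[OF pair[of i] borel_measurable_continuous_onI[OF continuous_on_fst[OF continuous_on_id]]] by simp
  have em[measurable]: "\<epsilon> i \<in> borel_measurable \<Omega>" for i
    using measurable_compose[OF pair[of i] borel_measurable_continuous_onI[OF continuous_on_snd[OF continuous_on_id]]] by simp
  note [measurable] = Y_meas
  define m' where "m' x = indicator {0..1} x * m x" for x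
  have m'm[measurable]: "m' \<in> borel_measurable borel"
    using borel_measurable_continuous_on_indicator[OF _ m_cont] by (simp add: m'_def[abs_def])
  have m'_nonneg: "m' x \<ge> 0" for x
  proof -
    have "m x \<ge> 0" if "x \<in> {0..1}"
      using that m_zero[of x] m_pos[of x] m_nonneg[of x] by (cases "x \<le> \<theta>0"; cases "x < \<theta>0 + \<Delta>") auto
    then show ?thesis by (simp add: m'_def indicator_def)
  qed
  have "bounded (m ` {0..1})" by (intro compact_imp_bounded compact_continuous_image m_cont) simp
  then obtain B where B: "\<And>x. x \<in> {0..1} \<Longrightarrow> \<bar>m x\<bar> \<le> B" unfolding bounded_iff by (metis imageI real_norm_def)
  have m'_bound: "\<bar>m' x\<bar> \<le> \<bar>B\<bar>" for x
    using B[of x] by (cases "x \<in> {0..1}") (auto simp: m'_def indicator_def simp del: atLeastAtMost_iff)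
  have X01: "AE \<omega> in \<Omega>. X i \<omega> \<in> {0..1}" for i
  proof -
    have "AE x in distr \<Omega> borel (X i). x \<in> {0..1}"
      using AE_topological_support[of "distr \<Omega> borel (X i)"] unfolding supp by simp
    then show ?thesis by (subst (asm) AE_distr_iff) auto
  qed
  have Y_eq': "AE \<omega> in \<Omega>. Y i \<omega> = m' (X i \<omega>) + \<epsilon> i \<omega>" for i
    using Y_eq[of i] X01[of i] by eventually_elim (simp add: m'_def)
  let ?\<phi> = "\<lambda>p :: real \<times> real. (fst p, m' (fst p) + snd p)"
  have \<phi>m: "?\<phi> \<in> borel_measurable borel"
    unfolding borel_prod[symmetric] by measurable
  have YAE: "AE \<omega> in \<Omega>. ?\<phi> (X i \<omega>, \<epsilon> i \<omega>) = (X i \<omega>, Y i \<omega>)" for i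
    using Y_eq'[of i] by eventually_elim simp
  have e_int: "integrable \<Omega> (\<epsilon> i)" for i
    by (rule square_integrable_imp_integrable[OF em sq_int])
  interpret S: marked_sample \<Omega> X Y
  proof
    show "indep_vars (\<lambda>_. borel) (\<lambda>i \<omega>. (X i \<omega>, Y i \<omega>)) UNIV"
      by (rule indep_vars_AE_cong[OF indep_vars_compose2[OF indep \<phi>m] _ YAE]) measurable
    show "distr \<Omega> borel (\<lambda>\<omega>. (X i \<omega>, Y i \<omega>)) = distr \<Omega> borel (\<lambda>\<omega>. (X 0 \<omega>, Y 0 \<omega>))" for i
    proof -
      have "distr \<Omega> borel (\<lambda>\<omega>. (X i \<omega>, Y i \<omega>)) = distr (distr \<Omega> borel (\<lambda>\<omega>. (X i \<omega>, \<epsilon> i \<omega>))) borel ?\<phi>" for i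
      proof -
        have "distr \<Omega> borel (\<lambda>\<omega>. ?\<phi> (X i \<omega>, \<epsilon> i \<omega>)) = distr \<Omega> borel (\<lambda>\<omega>. (X i \<omega>, Y i \<omega>))"
          by (rule distr_cong_AE[OF refl refl YAE measurable_compose[OF pair \<phi>m]]) measurable
        then show ?thesis by (subst distr_distr[OF \<phi>m pair]) (simp add: comp_def)
      qed
      then show ?thesis using ident[of i] by simp
    qed
    show "integrable \<Omega> (\<lambda>\<omega>. (Y 0 \<omega>)\<^sup>2)"
    proof (rule Bochner_Integration.integrable_bound)
      show "integrable \<Omega> (\<lambda>\<omega>. 2 * B\<^sup>2 + 2 * (\<epsilon> 0 \<omega>)\<^sup>2)" using sq_int[of 0] by simp
      show "AE \<omega> in \<Omega>. norm ((Y 0 \<omega>)\<^sup>2) \<le> norm (2 * B\<^sup>2 + 2 * (\<epsilon> 0 \<omega>)\<^sup>2)"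
        using Y_eq'[of 0]
      proof eventually_elim
        case (elim \<omega>)
        have "(m' (X 0 \<omega>))\<^sup>2 \<le> B\<^sup>2" using m'_bound[of "X 0 \<omega>"] by (simp add: abs_le_square_iff)
        moreover have "(m' (X 0 \<omega>) + \<epsilon> 0 \<omega>)\<^sup>2 \<le> 2 * (m' (X 0 \<omega>))\<^sup>2 + 2 * (\<epsilon> 0 \<omega>)\<^sup>2"
          using sum_squares_bound[of "m' (X 0 \<omega>)" "\<epsilon> 0 \<omega>"] by (simp add: power2_sum)
        ultimately show ?case using elim by simp
      qed
    qed measurable
    show "prob {\<omega> \<in> space \<Omega>. X 0 \<omega> = t} = 0" for t
    proof -
      have "emeasure \<Omega> (X 0 -` {t} \<inter> space \<Omega>) = (\<integral>\<^sup>+x. ennreal (f\<^sub>X x) * indicator {t} x \<partial>lborel)"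
        by (rule distributed_emeasure[OF dens]) simp
      also have "\<dots> = (\<integral>\<^sup>+x. 0 \<partial>(lborel :: real measure))"
      proof (rule nn_integral_cong_AE)
        have "AE x in lborel. x \<noteq> t" by (rule AE_lborel_singleton)
        then show "AE x in lborel. ennreal (f\<^sub>X x) * indicator {t} x = 0" by eventually_elim simp
      qed
      finally have "emeasure \<Omega> (X 0 -` {t} \<inter> space \<Omega>) = 0" by simp
      moreover have "X 0 -` {t} \<inter> space \<Omega> = {\<omega> \<in> space \<Omega>. X 0 \<omega> = t}" by auto
      ultimately show ?thesis by (simp add: emeasure_eq_measure)
    qed
  qed
  have mX_int: "integrable \<Omega> (\<lambda>\<omega>. m' (X 0 \<omega>) * of_bool (X 0 \<omega> \<le> t))" for t
    by (rule integrable_const_bound[where B="\<bar>B\<bar>"]) (use m'_bound in \<open>auto simp: of_bool_def\<close>)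
  have mean: "S.mean_mark t = (\<integral>\<omega>. m' (X 0 \<omega>) * of_bool (X 0 \<omega> \<le> t) \<partial>\<Omega>)" for t
  proof -
    let ?F = "vimage_algebra (space \<Omega>) (X 0) borel" and ?A = "X 0 -` {..t} \<inter> space \<Omega>"
    have sub: "subalgebra \<Omega> ?F"
      unfolding subalgebra_def by (auto simp: sets_vimage_algebra2)
    interpret F: sigma_finite_subalgebra \<Omega> ?F 
      by (rule finite_measure_subalgebra_is_sigma_finite)
         (use sub in \<open>simp add: finite_measure_subalgebra_def finite_measure_subalgebra_axioms_def finite_measure_axioms\<close>)
    have A: "?A \<in> sets ?F" by (rule in_vimage_algebra) simp
    have "(\<integral>\<omega>\<in>?A. \<epsilon> 0 \<omega> \<partial>\<Omega>) = (\<integral>\<omega>\<in>?A. real_cond_exp \<Omega> ?F (\<epsilon> 0) \<omega> \<partial>\<Omega>)"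
      by (rule F.real_cond_exp_intA[OF e_int A])
    also have "\<dots> = (\<integral>\<omega>. 0 \<partial>\<Omega>)"
      unfolding set_lebesgue_integral_def
      by (rule integral_cong_AE) (use cond_mean[of 0] in \<open>auto elim: eventually_mono\<close>)
    finally have "(\<integral>\<omega>\<in>?A. \<epsilon> 0 \<omega> \<partial>\<Omega>) = 0" by simp
    moreover have "(\<integral>\<omega>\<in>?A. \<epsilon> 0 \<omega> \<partial>\<Omega>) = (\<integral>\<omega>. \<epsilon> 0 \<omega> * of_bool (X 0 \<omega> \<le> t) \<partial>\<Omega>)"
      unfolding set_lebesgue_integral_def by (rule Bochner_Integration.integral_cong) (auto simp: indicator_def)
    ultimately have e0: "(\<integral>\<omega>. \<epsilon> 0 \<omega> * of_bool (X 0 \<omega> \<le> t) \<partial>\<Omega>) = 0" by simp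
    have eI: "integrable \<Omega> (\<lambda>\<omega>. \<epsilon> 0 \<omega> * of_bool (X 0 \<omega> \<le> t))"
      by (rule Bochner_Integration.integrable_bound[OF e_int[of 0]]) auto
    have "S.mean_mark t = (\<integral>\<omega>. m' (X 0 \<omega>) * of_bool (X 0 \<omega> \<le> t) + \<epsilon> 0 \<omega> * of_bool (X 0 \<omega> \<le> t) \<partial>\<Omega>)"
      unfolding S.mean_mark_def mark_def S.W_def
    proof (rule integral_cong_AE)
      show "AE \<omega> in \<Omega>. snd (X 0 \<omega>, Y 0 \<omega>) * of_bool (fst (X 0 \<omega>, Y 0 \<omega>) \<le> t) =
          m' (X 0 \<omega>) * of_bool (X 0 \<omega> \<le> t) + \<epsilon> 0 \<omega> * of_bool (X 0 \<omega> \<le> t)"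
        using Y_eq'[of 0] by eventually_elim (simp add: distrib_right)
    qed auto
    also have "\<dots> = (\<integral>\<omega>. m' (X 0 \<omega>) * of_bool (X 0 \<omega> \<le> t) \<partial>\<Omega>)"
      using mX_int eI e0 by simp
    finally show ?thesis .
  qed
  have true_eq: "M_true F\<^sub>X m \<theta>0 \<theta> = S.mean_mark \<theta>" if \<theta>: "\<theta> \<in> {0..1}" for \<theta>
  proof -
    have rd: "real_distribution (distr \<Omega> borel (X 0))" by (rule real_distribution_distr) simp
    have im: "interval_measure F\<^sub>X = distr \<Omega> borel (X 0)"
      using interval_measure_cdf[OF rd] unfolding cdf .
    have "(LINT x:{\<theta>0..\<theta>}|interval_measure F\<^sub>X. m x) = (\<integral>x. indicator {\<theta>0..\<theta>} x * m' x \<partial>distr \<Omega> borel (X 0))"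
      unfolding set_lebesgue_integral_def im
      by (rule Bochner_Integration.integral_cong) (use \<theta> theta0 in \<open>auto simp: indicator_def m'_def\<close>)
    also have "\<dots> = (\<integral>\<omega>. indicator {\<theta>0..\<theta>} (X 0 \<omega>) * m' (X 0 \<omega>) \<partial>\<Omega>)"
      by (rule integral_distr) auto
    finally have "M_true F\<^sub>X m \<theta>0 \<theta> = (\<integral>\<omega>. indicator {\<theta>0..\<theta>} (X 0 \<omega>) * m' (X 0 \<omega>) \<partial>\<Omega>) * of_bool (\<theta> > \<theta>0)"
      by (simp add: M_true_def)
    also have "\<dots> = (\<integral>\<omega>. indicator {\<theta>0..\<theta>} (X 0 \<omega>) * m' (X 0 \<omega>) * of_bool (\<theta> > \<theta>0) \<partial>\<Omega>)" by simp
    also have "\<dots> = (\<integral>\<omega>. m' (X 0 \<omega>) * of_bool (X 0 \<omega> \<le> \<theta>) \<partial>\<Omega>)"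
    proof (rule Bochner_Integration.integral_cong)
      fix \<omega>
      have "m' x = 0" if "x \<le> \<theta>0" for x using that m_zero[of x] by (simp add: m'_def indicator_def)
      then show "indicator {\<theta>0..\<theta>} (X 0 \<omega>) * m' (X 0 \<omega>) * of_bool (\<theta> > \<theta>0) = m' (X 0 \<omega>) * of_bool (X 0 \<omega> \<le> \<theta>)"
        by (cases "X 0 \<omega> \<le> \<theta>0") (auto simp: indicator_def)
    qed simp
    finally show ?thesis by (simp add: mean)
  qed
  have zero: "S.mean_mark \<theta> = 0" if "\<theta> \<in> {0..\<theta>0}" for \<theta>
    using true_eq[of \<theta>] that theta0 by (simp add: M_true_def)
  have mono: "S.mean_mark \<theta> \<le> S.mean_mark \<theta>'" if "\<theta> \<le> \<theta>'" for \<theta> \<theta>'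
    unfolding mean using that m'_nonneg by (intro integral_mono mX_int) (auto simp: of_bool_def)
  have pos: "S.mean_mark \<theta> > 0" if \<theta>: "\<theta> \<in> {\<theta>0<..1}" for \<theta>
  proof (rule ccontr)
    assume "\<not> S.mean_mark \<theta> > 0"
    moreover have "(\<integral>\<omega>. m' (X 0 \<omega>) * of_bool (X 0 \<omega> \<le> \<theta>) \<partial>\<Omega>) \<ge> 0"
      using m'_nonneg by (intro integral_nonneg_AE) auto
    ultimately have "(\<integral>\<omega>. m' (X 0 \<omega>) * of_bool (X 0 \<omega> \<le> \<theta>) \<partial>\<Omega>) = 0" by (simp add: mean)
    then have AE0: "AE \<omega> in \<Omega>. m' (X 0 \<omega>) * of_bool (X 0 \<omega> \<le> \<theta>) = 0"
      using mX_int m'_nonneg by (subst (asm) integral_nonneg_eq_0_iff_AE) auto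
    define s where "s = min \<theta> (\<theta>0 + \<Delta>)"
    have s: "\<theta>0 < s" "s \<le> 1" "s \<le> \<theta>" "s \<le> \<theta>0 + \<Delta>" using \<theta> Delta by (auto simp: s_def)
    let ?U = "{\<theta>0<..<s}"
    have "(\<theta>0 + s) / 2 \<in> topological_support (distr \<Omega> borel (X 0))"
      unfolding supp using s theta0 by auto
    then have "emeasure (distr \<Omega> borel (X 0)) ?U > 0"
      unfolding topological_support_def using s by (auto dest!: spec[of _ ?U])
    then have gt: "emeasure \<Omega> (X 0 -` ?U \<inter> space \<Omega>) > 0" by (simp add: emeasure_distr)
    have "AE \<omega> in \<Omega>. X 0 \<omega> \<notin> ?U"
      using AE0
    proof eventually_elim
      case (elim \<omega>)
      have "m' (X 0 \<omega>) > 0" if "X 0 \<omega> \<in> ?U"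
        using m_pos[of "X 0 \<omega>"] that s theta0 by (auto simp: m'_def indicator_def)
      then show ?case using elim s by fastforce
    qed
    then have "emeasure \<Omega> (X 0 -` ?U \<inter> space \<Omega>) = 0"
      using emeasure_eq_0_AE[of "\<lambda>\<omega>. X 0 \<omega> \<in> ?U" \<Omega>] by (simp add: vimage_def Int_def conj_commute)
    then show False using gt by simp
  qed
  have path_eq: "(\<lambda>\<theta>\<in>{0..1}. sqrt (real n) * (M_emp X Y n \<omega> \<theta> - M_true F\<^sub>X m \<theta>0 \<theta>)) = (\<lambda>\<theta>\<in>{0..1}. S.emp_process n \<omega> \<theta>)" for n \<omega>
    by (rule restrict_ext) (simp only: S.emp_process_eq true_eq)
  have sup_eq: "(SUP \<theta>\<in>{0..1}. \<bar>M_emp X Y n \<omega> \<theta> - M_true F\<^sub>X m \<theta>0 \<theta>\<bar>) = (SUP \<theta>\<in>{0..1}. \<bar>M_emp X Y n \<omega> \<theta> - S.mean_mark \<theta>\<bar>)" for n \<omega>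
    by (rule SUP_cong) (simp_all only: true_eq)
  show ?thesis
    unfolding path_eq sup_eq
  proof (intro conjI allI impI S.functional_central_limit_theorem)
    fix c t :: "nat \<Rightarrow> real"
    assume ct: "(\<forall>n\<ge>1. 0 < c n) \<and> c \<longlonglongrightarrow> 0 \<and> (\<forall>n\<ge>1. t n = real n powr (- 1 / 2) / c n)"
    show "(\<lambda>n. prob {\<omega> \<in> space \<Omega>. (SUP \<theta>\<in>{0..1}. \<bar>M_emp X Y n \<omega> \<theta> - S.mean_mark \<theta>\<bar>) > t n}) \<longlonglongrightarrow> 0"
      using ct by (intro S.sup_deviation_tendsto[of c]) auto
    assume "t \<longlonglongrightarrow> 0"
    then show "conv_in_prob \<Omega> (theta_hat X Y t) \<theta>0"
      using ct zero mono pos theta0 by (intro S.theta_hat_consistent[of c]) auto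
  qed
qed

end
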